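(* Let $d\ge 1$ be an integer and let $T\in (0,\infty]$. For every $p\in[1,\infty)$ there exists a function $u\in \mathring{\mathcal{H}}^1_p((0,T)\times\mathbb{R}^d_+)$ such that its zero extension $\bar u$ with respect to the spatial variable satisfies $$\bar u\notin \mathcal{H}^1_p((0,T)\times\mathbb{R}^d).$$ More precisely, $\bar u, D\bar u\in L_p((0,T)\times\mathbb{R}^d)$, but there do not exist functions $G_1,\dots,G_d,F\in L_p((0,T)\times\mathbb{R}^d)$ such that $$\bar u_t=\sum_{i=1}^d D_iG_i+F\quad\text{in }(0,T)\times\mathbb{R}^d$$ in the sense of distributions.
   Context: Notation. $\mathbb{R}^d_+=\{x=(x_1,x')\in\mathbb{R}^d: x_1>0,\ x'\in\mathbb{R}^{d-1}\}$ (so $\mathbb{R}^1_+=(0,\infty)$). Points of $(0,T)\times\Omega$ are written $(t,x)$; $D_i=\partial/\partial x_i$, $Du=(D_1u,\dots,D_du)$ is the spatial gradient and $u_t$ is the time derivative, all in the distributional sense. The zero extension $\bar u$ of a function $u$ on $(0,T)\times\mathbb{R}^d_+$ is the function on $(0,T)\times\mathbb{R}^d$ equal to $u$ for $x\in\mathbb{R}^d_+$ and to $0$ for $x\notin\mathbb{R}^d_+$. Function spaces. Let $\Omega\subset\mathbb{R}^d$ be a domain, $T\in(0,\infty]$, $p\in[1,\infty]$. (1) $W^{1,0}_p((0,T)\times\Omega)$ is the space of functions $u$ with $u, Du\in L_p((0,T)\times\Omega)$, with norm $\|u\|_{W^{1,0}_p}=\|u\|_{L_p}+\|Du\|_{L_p}$.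 (2) $u_t\in\mathbb{H}^{-1}_p((0,T)\times\Omega)$ means that there exist $g=(g_1,\dots,g_d)\in L_p((0,T)\times\Omega)^d$ and $f\in L_p((0,T)\times\Omega)$ such that $u_t=\sum_{i}D_ig_i+f$ in $(0,T)\times\Omega$ in the sense of distributions, i.e. $-\int_0^T\int_\Omega u\varphi_t\,dx\,dt=\int_0^T\int_\Omega(-\sum_i g_iD_i\varphi+f\varphi)\,dx\,dt$ for all $\varphi\in C_0^\infty((0,T)\times\Omega)$; and $\|u_t\|_{\mathbb{H}^{-1}_p}$ is the infimum of $\|g\|_{L_p}+\|f\|_{L_p}$ over all such representations. (3) $\mathcal{H}^1_p((0,T)\times\Omega)$ is the space of all $u\in W^{1,0}_p((0,T)\times\Omega)$ with $u_t\in\mathbb{H}^{-1}_p((0,T)\times\Omega)$, with norm $\|u\|_{\mathcal{H}^1_p}=\|u_t\|_{\mathbb{H}^{-1}_p}+\|u\|_{W^{1,0}_p}$. (4) $C_0^\infty([0,T]\times\Omega)$ is the set of infinitely differentiable functions on $[0,T]\times\Omega$ with compact support in $[0,T]\times\Omega$, where $[0,T]$ is understood as $[0,\infty)$ if $T=\infty$ (so such functions vanish near the lateral boundary but need not vanish at $t=0$ or $t=T$). $\mathring{\mathcal{H}}^1_p((0,T)\times\Omega)$ is the closure of $C_0^\infty([0,T]\times\Omega)$ in $\mathcal{H}^1_p((0,T)\times\Omega)$. *)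

theory Defs
  imports "HOL-Analysis.Analysis"
begin

section \<open>Lebesgue spaces on subsets of a Euclidean space\<close>

text \<open>Members of \<open>Lp p S\<close> are functions rather than almost-everywhere classes, and their values
  outside \<open>S\<close> are irrelevant. Only finite exponents \<open>p \<ge> 1\<close> are intended.\<close>

definition Lp :: "real \<Rightarrow> 'a::euclidean_space set \<Rightarrow> ('a \<Rightarrow> 'b::euclidean_space) set" where
  "Lp p S = {f \<in> borel_measurable (lebesgue_on S).
               integrable (lebesgue_on S) (\<lambda>z. norm (f z) powr p)}"

definition Lp_norm :: "real \<Rightarrow> 'a::euclidean_space set \<Rightarrow> ('a \<Rightarrow> 'b::euclidean_space) \<Rightarrow> real" where
  "Lp_norm p S f = (LINT z|lebesgue_on S. norm (f z) powr p) powr (1 / p)"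

section \<open>Smooth functions with compact support\<close>

text \<open>Derivatives are taken within \<open>S\<close>: for open \<open>S\<close> they are the ordinary ones, and on
  \<open>[0,T] \<times> \<Omega>\<close> with \<open>\<Omega>\<close> open they are one-sided in time at the end points. In both cases they are
  unique, so the existential quantifier makes no choice.\<close>

primrec Ck_on :: "nat \<Rightarrow> 'a::euclidean_space set \<Rightarrow> ('a \<Rightarrow> real) \<Rightarrow> bool" where
  "Ck_on 0 S f \<longleftrightarrow> continuous_on S f"
| "Ck_on (Suc n) S f \<longleftrightarrow>
     (\<exists>f'. (\<forall>z\<in>S. (f has_derivative f' z) (at z within S)) \<and> (\<forall>v. Ck_on n S (\<lambda>z. f' z v)))"

definition smooth_fun_on :: "'a::euclidean_space set \<Rightarrow> ('a \<Rightarrow> real) \<Rightarrow> bool" where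
  "smooth_fun_on S f \<longleftrightarrow> (\<forall>n. Ck_on n S f)"

definition C0_inf :: "'a::euclidean_space set \<Rightarrow> ('a \<Rightarrow> real) set" where
  "C0_inf S = {f. smooth_fun_on S f \<and>
                  compact (closure {z\<in>S. f z \<noteq> 0}) \<and> closure {z\<in>S. f z \<noteq> 0} \<subseteq> S}"

section \<open>Space-time domains\<close>

text \<open>Points \<open>(t, x)\<close> have type \<open>real \<times> (real ^ 'd)\<close>, where the finite type \<open>'d\<close> indexes the
  spatial coordinates, so the dimension is \<open>CARD('d) \<ge> 1\<close>. The final time \<open>T\<close> may be \<open>\<infinity>\<close>.\<close>

type_synonym 'd spacetime = "real \<times> (real ^ 'd)"

definition cyl :: "ereal \<Rightarrow> (real ^ 'd) set \<Rightarrow> 'd::finite spacetime set" where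
  "cyl T \<Omega> = {t. 0 < t \<and> ereal t < T} \<times> \<Omega>"

definition closed_time_cyl :: "ereal \<Rightarrow> (real ^ 'd) set \<Rightarrow> 'd::finite spacetime set" where
  "closed_time_cyl T \<Omega> = {t. 0 \<le> t \<and> ereal t \<le> T} \<times> \<Omega>"

text \<open>The half-space is taken with respect to an arbitrary coordinate \<open>k\<close>, which plays the role of
  the first coordinate because an abstract index type has no distinguished element.\<close>

definition half_space :: "'d \<Rightarrow> (real ^ 'd::finite) set" where
  "half_space k = {x. x $ k > 0}"

definition zero_ext :: "(real ^ 'd) set \<Rightarrow> ('d::finite spacetime \<Rightarrow> real) \<Rightarrow> 'd spacetime \<Rightarrow> real" where
  "zero_ext \<Omega> u = (\<lambda>(t, x). if x \<in> \<Omega> then u (t, x) else 0)"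

definition dt :: "('d::finite spacetime \<Rightarrow> real) \<Rightarrow> 'd spacetime \<Rightarrow> real" where
  "dt \<phi> z = frechet_derivative \<phi> (at z) (1, 0)"

definition dx :: "'d \<Rightarrow> ('d::finite spacetime \<Rightarrow> real) \<Rightarrow> 'd spacetime \<Rightarrow> real" where
  "dx i \<phi> z = frechet_derivative \<phi> (at z) (0, axis i 1)"

section \<open>Parabolic Sobolev spaces\<close>

definition is_weak_grad ::
  "ereal \<Rightarrow> (real ^ 'd) set \<Rightarrow> ('d::finite spacetime \<Rightarrow> real) \<Rightarrow> ('d spacetime \<Rightarrow> real ^ 'd) \<Rightarrow> bool" where
  "is_weak_grad T \<Omega> u w \<longleftrightarrow>
     (\<forall>\<phi>\<in>C0_inf (cyl T \<Omega>). \<forall>i.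
        (LINT z|lebesgue_on (cyl T \<Omega>). u z * dx i \<phi> z)
          = - (LINT z|lebesgue_on (cyl T \<Omega>). w z $ i * \<phi> z))"

definition W10 :: "real \<Rightarrow> ereal \<Rightarrow> (real ^ 'd) set \<Rightarrow> ('d::finite spacetime \<Rightarrow> real) set" where
  "W10 p T \<Omega> = {u \<in> Lp p (cyl T \<Omega>). \<exists>w \<in> Lp p (cyl T \<Omega>). is_weak_grad T \<Omega> u w}"

text \<open>The gradient is determined up to a null set, so the norm does not depend on the choice.\<close>

definition weak_grad ::
  "real \<Rightarrow> ereal \<Rightarrow> (real ^ 'd) set \<Rightarrow> ('d::finite spacetime \<Rightarrow> real) \<Rightarrow> 'd spacetime \<Rightarrow> real ^ 'd" where
  "weak_grad p T \<Omega> u = (SOME w. w \<in> Lp p (cyl T \<Omega>) \<and> is_weak_grad T \<Omega> u w)"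

definition W10_norm :: "real \<Rightarrow> ereal \<Rightarrow> (real ^ 'd) set \<Rightarrow> ('d::finite spacetime \<Rightarrow> real) \<Rightarrow> real" where
  "W10_norm p T \<Omega> u = Lp_norm p (cyl T \<Omega>) u + Lp_norm p (cyl T \<Omega>) (weak_grad p T \<Omega> u)"

text \<open>\<open>dt_eq_div T \<Omega> u g f\<close> says \<open>u\<^sub>t = \<Sum>\<^sub>i D\<^sub>i g\<^sub>i + f\<close> in the sense of distributions.\<close>

definition dt_eq_div ::
  "ereal \<Rightarrow> (real ^ 'd) set \<Rightarrow> ('d::finite spacetime \<Rightarrow> real)
    \<Rightarrow> ('d spacetime \<Rightarrow> real ^ 'd) \<Rightarrow> ('d spacetime \<Rightarrow> real) \<Rightarrow> bool" where
  "dt_eq_div T \<Omega> u g f \<longleftrightarrow>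
     (\<forall>\<phi>\<in>C0_inf (cyl T \<Omega>).
        - (LINT z|lebesgue_on (cyl T \<Omega>). u z * dt \<phi> z)
          = (LINT z|lebesgue_on (cyl T \<Omega>). - (\<Sum>i\<in>UNIV. g z $ i * dx i \<phi> z) + f z * \<phi> z))"

definition dt_in_Hm1 :: "real \<Rightarrow> ereal \<Rightarrow> (real ^ 'd) set \<Rightarrow> ('d::finite spacetime \<Rightarrow> real) \<Rightarrow> bool" where
  "dt_in_Hm1 p T \<Omega> u \<longleftrightarrow>
     (\<exists>g \<in> Lp p (cyl T \<Omega>). \<exists>f \<in> Lp p (cyl T \<Omega>). dt_eq_div T \<Omega> u g f)"

definition dt_Hm1_norm :: "real \<Rightarrow> ereal \<Rightarrow> (real ^ 'd) set \<Rightarrow> ('d::finite spacetime \<Rightarrow> real) \<Rightarrow> real" where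
  "dt_Hm1_norm p T \<Omega> u =
     Inf {Lp_norm p (cyl T \<Omega>) g + Lp_norm p (cyl T \<Omega>) f | g f.
            g \<in> Lp p (cyl T \<Omega>) \<and> f \<in> Lp p (cyl T \<Omega>) \<and> dt_eq_div T \<Omega> u g f}"

definition H1 :: "real \<Rightarrow> ereal \<Rightarrow> (real ^ 'd) set \<Rightarrow> ('d::finite spacetime \<Rightarrow> real) set" where
  "H1 p T \<Omega> = {u \<in> W10 p T \<Omega>. dt_in_Hm1 p T \<Omega> u}"

definition H1_norm :: "real \<Rightarrow> ereal \<Rightarrow> (real ^ 'd) set \<Rightarrow> ('d::finite spacetime \<Rightarrow> real) \<Rightarrow> real" where
  "H1_norm p T \<Omega> u = dt_Hm1_norm p T \<Omega> u + W10_norm p T \<Omega> u"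

text \<open>The closure of \<open>C0_inf ([0,T] \<times> \<Omega>)\<close> in \<open>H1\<close>.\<close>

definition H1_ring :: "real \<Rightarrow> ereal \<Rightarrow> (real ^ 'd) set \<Rightarrow> ('d::finite spacetime \<Rightarrow> real) set" where
  "H1_ring p T \<Omega> = {u \<in> H1 p T \<Omega>.
     \<forall>\<epsilon>>0. \<exists>\<phi> \<in> C0_inf (closed_time_cyl T \<Omega>) \<inter> H1 p T \<Omega>. H1_norm p T \<Omega> (\<lambda>z. u z - \<phi> z) < \<epsilon>}"

end

(*
  Near t = 0 consider V (t, x) = t^beta H (x_k / sqrt t) zeta(x'), where H is a cut-off equal to 1 near 0, and put
  u = - D_k V. It is supported where x_k is comparable to sqrt t, away from the lateral boundary, and u_t = D_k g with
  g = - V_t. On the half-space g lives on the thin layer 0 < x_k < 2 sqrt t and has size t^(beta - 1) there, which is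
  also the size of Du; both lie in L_p when beta = 1 - b / p with b < 3 / 2, and since u (t + delta, .) is smooth up to
  t = 0, dominated convergence places u in the closure of the smooth functions.

  The trace of g at x_k = 0 is a multiple of t^(beta - 1) = t^(- b / p), which is not in L_p near t = 0 as soon as
  b >= 1. If the extension had a time derivative div G + F in L_p-divergence form, testing with
  eta (t / delta) psi (x), where psi = 1 near the boundary, would give a quantity of order delta^(1 - b / p) on the left,
  while y <= s^(p - 1) y^p + 1 / s bounds the right-hand side by N s^(p - 1) + A delta / s for every s > 0. The choice
  s = K delta^(b / p) is contradictory for small delta if b > 1 and beta <> 0, i.e. b <> p.
*)
theory Submission
  imports Defs
begin

section \<open>Smooth functions\<close>

text \<open>Divergence representations are far from unique, so it is not enough that
  \<open>flux\<close> fails to be in L_p on the whole space: every pair G, F has to be excluded. The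
  formula for V makes sense for x_k <= 0 as well, where H = 1, so u_t = D_k \<open>flux\<close>
  holds classically on all of (0,T) x R^d, across the boundary. The trace of the flux can therefore
  be read off away from the boundary, on the strip -3 < x_k < -2 where the test function is cut off,
  and no boundary terms arise. The test functions are scaled in time only: their spatial derivatives
  stay bounded while their supports have measure of order \<delta>.

  The approximation in the half-space has its own obstacle. The layer at time t + \<delta> is
  thicker than the layer at time t, so t^(- b) restricted to the layer does not dominate the
  translates; the majorant trades a part of the time singularity for a singularity in x_k.

  The norm of \<open>H1\<close> evaluates a gradient picked by \<open>SOME\<close>. This is why the
  fundamental lemma of the calculus of variations comes before any norm estimate.\<close>

lemma Ck_on_Suc_D: "Ck_on (Suc n) S f \<Longrightarrow> Ck_on n S f"
proof (induction n arbitrary: f)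
  case 0
  then show ?case
    by (auto simp: continuous_on_eq_continuous_within intro: has_derivative_continuous)
next
  case (Suc n)
  from Suc.prems obtain f' where
    "\<forall>z\<in>S. (f has_derivative f' z) (at z within S)" "\<And>v. Ck_on (Suc n) S (\<lambda>z. f' z v)"
    unfolding Ck_on.simps(2)[of "Suc n"] by blast
  with Suc.IH show ?case
    unfolding Ck_on.simps(2)[of n] by blast
qed

lemma Ck_on_imp_continuous_on: "Ck_on n S f \<Longrightarrow> continuous_on S f"
  by (induction n) (auto dest: Ck_on_Suc_D simp del: Ck_on.simps(2))

lemma Ck_on_cong:
  assumes "\<And>z. z \<in> S \<Longrightarrow> f z = g z"
  shows "Ck_on n S f \<longleftrightarrow> Ck_on n S g"
proof (cases n)
  case 0
  then show ?thesis using assms by (simp cong: continuous_on_cong)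
next
  case (Suc m)
  have "(f has_derivative D) (at z within S) \<longleftrightarrow> (g has_derivative D) (at z within S)" if "z \<in> S" for z D
    using assms that by (auto elim!: has_derivative_transform[rotated 2])
  then show ?thesis by (simp add: Suc)
qed

lemma Ck_on_const: "Ck_on n S (\<lambda>z. c)"
  by (induction n arbitrary: c) (auto intro!: exI[of _ "\<lambda>_ _. 0"])

lemma Ck_on_linear:
  assumes "bounded_linear f"
  shows "Ck_on n S f"
  by (cases n) (auto simp: linear_continuous_on assms Ck_on_const
      intro!: exI[of _ "\<lambda>_. f"] bounded_linear_imp_has_derivative)

lemma Ck_on_add: "Ck_on n S f \<Longrightarrow> Ck_on n S g \<Longrightarrow> Ck_on n S (\<lambda>z. f z + g z)"
proof (induction n arbitrary: f g)
  case 0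
  then show ?case by (auto intro: continuous_on_add)
next
  case (Suc n)
  from Suc.prems obtain f' g' where
    "\<forall>z\<in>S. (f has_derivative f' z) (at z within S)" "\<forall>v. Ck_on n S (\<lambda>z. f' z v)"
    "\<forall>z\<in>S. (g has_derivative g' z) (at z within S)" "\<forall>v. Ck_on n S (\<lambda>z. g' z v)"
    by auto
  then show ?case using Suc.IH
    by (auto intro!: exI[of _ "\<lambda>z v. f' z v + g' z v"] has_derivative_add)
qed

lemma Ck_on_mult: "Ck_on n S f \<Longrightarrow> Ck_on n S g \<Longrightarrow> Ck_on n S (\<lambda>z. f z * g z)"
proof (induction n arbitrary: f g)
  case 0
  then show ?case by (auto intro: continuous_on_mult)
next
  case (Suc n)
  from Suc.prems obtain f' g' where
    fg: "\<forall>z\<in>S. (f has_derivative f' z) (at z within S)" "\<forall>v. Ck_on n S (\<lambda>z. f' z v)"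
    "\<forall>z\<in>S. (g has_derivative g' z) (at z within S)" "\<forall>v. Ck_on n S (\<lambda>z. g' z v)"
    by auto
  have "Ck_on n S f" "Ck_on n S g"
    using Suc.prems Ck_on_Suc_D by blast+
  with fg show ?case
    by (auto intro!: exI[of _ "\<lambda>z v. f z * g' z v + f' z v * g z"] has_derivative_mult
        Ck_on_add Suc.IH)
qed

lemma Ck_on_prod:
  "(\<And>i. i \<in> I \<Longrightarrow> Ck_on n S (f i)) \<Longrightarrow> Ck_on n S (\<lambda>z. \<Prod>i\<in>I. f i z)"
  by (induction I rule: infinite_finite_induct) (auto intro: Ck_on_const Ck_on_mult)

lemma Ck_on_compose:
  fixes f :: "real \<Rightarrow> real"
  shows "Ck_on n U f \<Longrightarrow> Ck_on n S g \<Longrightarrow> g ` S \<subseteq> U \<Longrightarrow> Ck_on n S (\<lambda>z. f (g z))"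
proof (induction n arbitrary: f)
  case 0
  then show ?case by (auto intro: continuous_on_compose2)
next
  case (Suc n)
  from Suc.prems obtain f' g' where
    f: "\<forall>z\<in>U. (f has_derivative f' z) (at z within U)" "\<forall>v. Ck_on n U (\<lambda>z. f' z v)"
    and g: "\<forall>z\<in>S. (g has_derivative g' z) (at z within S)" "\<forall>v. Ck_on n S (\<lambda>z. g' z v)"
    by auto
  \<comment> \<open>The direction \<open>g' z v\<close> varies with z, while \<open>Ck_on\<close>
    speaks of derivatives in a fixed direction. On the real line the direction factors out, which
    leaves a product for \<open>Ck_on_mult\<close> and the induction hypothesis.\<close>
  have lin: "f' z v = v * f' z 1" if "z \<in> U" for z v
  proof -
    interpret bounded_linear "f' z"
      using f(1) that has_derivative_bounded_linear by blast
    show ?thesis using scaleR[of v 1] by simp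
  qed
  have "((\<lambda>z. f (g z)) has_derivative (\<lambda>v. f' (g z) (g' z v))) (at z within S)" if "z \<in> S" for z
    by (rule has_derivative_in_compose2[of U f f']) (use f(1) g(1) Suc.prems(3) that in simp_all)
  moreover have "Ck_on n S (\<lambda>z. f' (g z) (g' z v))" for v
  proof -
    have "Ck_on n S (\<lambda>z. g' z v * f' (g z) 1)"
      using Ck_on_mult[OF g(2)[rule_format] Suc.IH[OF f(2)[rule_format] Ck_on_Suc_D[OF Suc.prems(2)] Suc.prems(3)]] .
    then show ?thesis
      by (rule Ck_on_cong[THEN iffD1, rotated]) (use Suc.prems(3) in \<open>blast intro: lin[symmetric]\<close>)
  qed
  ultimately show ?case
    by (auto intro!: exI[of _ "\<lambda>z v. f' (g z) (g' z v)"])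
qed

text \<open>A closed formula for all derivatives at once spares the repeated choice of derivatives
  in \<open>Ck_on\<close>. It serves for powers and for \<open>flat\<close>.\<close>

lemma smooth_fun_on_real_sequence:
  fixes F :: "nat \<Rightarrow> real \<Rightarrow> real"
  assumes "\<And>n x. x \<in> U \<Longrightarrow> (F n has_real_derivative F (Suc n) x) (at x)"
  shows "smooth_fun_on U (F m)"
proof -
  have "Ck_on n U (F m)" for n m
  proof (induction n arbitrary: m)
    case 0
    then show ?case
      by (auto intro!: continuous_at_imp_continuous_on DERIV_isCont[OF assms])
  next
    case (Suc n)
    have "(F m has_derivative (\<lambda>v. F (Suc m) x * v)) (at x within U)" if "x \<in> U" for x
      using assms[OF that, of m] has_derivative_at_withinI
      unfolding has_field_derivative_def by blast
    then show ?case
      by (auto intro!: exI[of _ "\<lambda>x v. F (Suc m) x * v"] Ck_on_mult Suc Ck_on_const)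
  qed
  then show ?thesis by (simp add: smooth_fun_on_def)
qed

lemma smooth_fun_on_real_deriv:
  fixes f :: "real \<Rightarrow> real"
  assumes "smooth_fun_on UNIV f"
  shows "(f has_real_derivative deriv f x) (at x)" and "smooth_fun_on UNIV (deriv f)"
proof -
  have *: "(f has_real_derivative f' x 1) (at x)"
    if "\<forall>z\<in>UNIV. (f has_derivative f' z) (at z within UNIV)" for f' and x :: real
  proof -
    have D: "(f has_derivative f' x) (at x)" using that by auto
    interpret bounded_linear "f' x"
      using D has_derivative_bounded_linear by blast
    have "f' x = (*) (f' x 1)"
    proof
      fix v show "f' x v = f' x 1 * v" using scaleR[of v 1] by simp
    qed
    with D show ?thesis by (simp add: has_field_derivative_def)
  qed
  have "Ck_on (Suc n) UNIV f" for n
    using assms by (simp add: smooth_fun_on_def)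
  then have ex: "\<exists>f'. (\<forall>z\<in>UNIV. (f has_derivative f' z) (at z within UNIV)) \<and> (\<forall>v. Ck_on n UNIV (\<lambda>z. f' z v))"
    for n by simp
  obtain f' where f': "\<forall>z\<in>UNIV. (f has_derivative f' z) (at z within UNIV)" using ex[of 0] by blast
  have "deriv f x = f' x 1" for x using *[OF f', of x] by (rule DERIV_imp_deriv)
  then show "(f has_real_derivative deriv f x) (at x)" using *[OF f', of x] by simp
  have "Ck_on n UNIV (deriv f)" for n
  proof -
    \<comment> \<open>The derivative supplied by \<open>Ck_on (Suc n)\<close> may depend on n;
      uniqueness of derivatives identifies each of them with \<open>deriv f\<close>.\<close>
    obtain h where h: "\<forall>z\<in>UNIV. (f has_derivative h z) (at z within UNIV)"
      "\<forall>v. Ck_on n UNIV (\<lambda>z. h z v)" using ex[of n] by blast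
    have "deriv f = (\<lambda>z. h z 1)" using *[OF h(1)] DERIV_imp_deriv by blast
    then show ?thesis using h(2) by simp
  qed
  then show "smooth_fun_on UNIV (deriv f)" by (simp add: smooth_fun_on_def)
qed

lemma Ck_on_powr: "Ck_on n {0<..} (\<lambda>t. t powr a)"
proof -
  \<comment> \<open>The n-th derivative of the power, with a falling factorial as
    coefficient.\<close>
  let ?F = "\<lambda>n t. (\<Prod>i<n. a - real i) * t powr (a - real n)"
  have "(?F n has_real_derivative ?F (Suc n) x) (at x)" if "x \<in> {0<..}" for n x
    using that by (auto intro!: derivative_eq_intros simp: algebra_simps diff_diff_eq)
  from smooth_fun_on_real_sequence[of "{0<..}" ?F, OF this, of 0]
  show ?thesis by (simp add: smooth_fun_on_def)
qed

section \<open>A smooth step function\<close>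

text \<open>The polynomial in 1/x is a parameter because the family is then closed under
  differentiation; \<open>flat 1\<close> is the usual exp (- 1 / x), extended by 0.\<close>

definition flat :: "real poly \<Rightarrow> real \<Rightarrow> real" where
  "flat P x = (if x \<le> 0 then 0 else poly P (inverse x) * exp (- inverse x))"

lemma poly_times_exp_minus_tendsto_0:
  "((\<lambda>y. poly P y * exp (- y)) \<longlongrightarrow> (0::real)) at_top"
proof -
  have "((\<lambda>y. coeff P i * (y ^ i / exp y)) \<longlongrightarrow> coeff P i * 0) at_top" for i
    by (intro tendsto_mult tendsto_const tendsto_power_div_exp_0)
  then have "((\<lambda>y. \<Sum>i\<le>degree P. coeff P i * (y ^ i / exp y)) \<longlongrightarrow> (\<Sum>i\<le>degree P. 0)) at_top"
    by (intro tendsto_sum) simp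
  then show ?thesis
    by (simp add: poly_altdef sum_distrib_right exp_minus divide_inverse mult.assoc)
qed

lemma flat_over_x_tendsto_0: "((\<lambda>x. flat P x / x) \<longlongrightarrow> 0) (at 0)"
proof -
  \<comment> \<open>\<open>pCons 0 P\<close> stands for y times P; with y = 1/x the additional
    factor y is the division by x.\<close>
  have "((\<lambda>y. poly (pCons 0 P) y * exp (- y)) \<longlongrightarrow> 0) at_top"
    by (rule poly_times_exp_minus_tendsto_0)
  then have "((\<lambda>x. poly (pCons 0 P) (inverse x) * exp (- inverse x)) \<longlongrightarrow> 0) (at_right 0)"
    by (rule filterlim_compose) (rule filterlim_inverse_at_top_right)
  moreover have "\<forall>\<^sub>F x in at_right 0. poly (pCons 0 P) (inverse x) * exp (- inverse x) = flat P x / x"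
    by (auto simp: flat_def field_simps eventually_at_right_less intro: eventually_mono[OF eventually_at_right_less])
  ultimately have "((\<lambda>x. flat P x / x) \<longlongrightarrow> 0) (at_right 0)"
    using tendsto_cong by fastforce
  moreover have "((\<lambda>x. flat P x / x) \<longlongrightarrow> 0) (at_left 0)"
    by (rule tendsto_eventually) (auto simp: flat_def eventually_at_filter)
  ultimately show ?thesis by (rule filterlim_split_at[rotated])
qed

text \<open>For x > 0 put y = 1/x, whose derivative is - y^2: then P(y) exp (- y) has the derivative
  y^2 (P - P')(y) exp (- y). At 0 the difference quotient is \<open>flat P x / x\<close>.\<close>

lemma flat_deriv:
  "(flat P has_real_derivative flat ([:0, 0, 1:] * (P - pderiv P)) x) (at x)"
proof -
  consider "x < 0" | "x = 0" | "x > 0" by linarith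
  then show ?thesis
  proof cases
    case 1
    then have "((\<lambda>x. 0) has_real_derivative 0) (at x)" by simp
    then have "(flat P has_real_derivative 0) (at x)"
      by (rule has_field_derivative_transform_within_open[of _ _ _ "{..<0}"]) (use 1 in \<open>auto simp: flat_def\<close>)
    then show ?thesis using 1 by (simp add: flat_def)
  next
    case 2
    then show ?thesis
      using flat_over_x_tendsto_0[of P] by (simp add: has_field_derivative_iff flat_def)
  next
    case 3
    then have "((\<lambda>x. poly P (inverse x) * exp (- inverse x)) has_real_derivative
        flat ([:0, 0, 1:] * (P - pderiv P)) x) (at x)"
      by (auto intro!: derivative_eq_intros DERIV_chain2[OF poly_DERIV] simp: flat_def algebra_simps power2_eq_square)
    then show ?thesis
      by (rule has_field_derivative_transform_within_open[of _ _ _ "{0<..}"]) (use 3 in \<open>auto simp: flat_def\<close>)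
  qed
qed

definition smooth_step :: "real \<Rightarrow> real" where
  "smooth_step x = flat 1 x * inverse (flat 1 x + flat 1 (1 - x))"

lemma flat_1_nonneg: "0 \<le> flat 1 x" and flat_1_pos: "0 < x \<Longrightarrow> 0 < flat 1 x"
  by (auto simp: flat_def)

lemma flat_1_sum_pos: "0 < flat 1 x + flat 1 (1 - x)"
  using flat_1_nonneg[of x] flat_1_nonneg[of "1 - x"] flat_1_pos[of x] flat_1_pos[of "1 - x"]
  by (cases "x > 0") auto

lemma smooth_smooth_step: "smooth_fun_on UNIV smooth_step"
proof -
  define F where "F n = ((\<lambda>P. [:0, 0, 1:] * (P - pderiv P)) ^^ n) (1::real poly)" for n
  have "smooth_fun_on UNIV (flat (F 0))"
    by (rule smooth_fun_on_real_sequence[of _ "\<lambda>n. flat (F n)"]) (use flat_deriv in \<open>simp add: F_def\<close>)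
  then have flat: "Ck_on n UNIV (flat 1)" for n by (simp add: F_def smooth_fun_on_def)
  have "Ck_on n UNIV (\<lambda>x::real. 1 + - 1 * x)" for n
    by (intro Ck_on_add Ck_on_mult Ck_on_const Ck_on_linear bounded_linear_ident)
  then have "Ck_on n UNIV (\<lambda>x. flat 1 (1 - x))" for n
    using Ck_on_compose[OF flat, of n UNIV "\<lambda>x. 1 - x"] by simp
  then have "Ck_on n UNIV (\<lambda>x. (flat 1 x + flat 1 (1 - x)) powr (-1))" for n
    using flat_1_sum_pos by (intro Ck_on_compose[OF Ck_on_powr[of n "-1"]] Ck_on_add flat) auto
  then have "Ck_on n UNIV (\<lambda>x. flat 1 x * (flat 1 x + flat 1 (1 - x)) powr (-1))" for n
    using flat by (intro Ck_on_mult)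
  moreover have "smooth_step = (\<lambda>x. flat 1 x * (flat 1 x + flat 1 (1 - x)) powr (-1))"
    using flat_1_sum_pos by (simp add: fun_eq_iff smooth_step_def powr_minus less_imp_le)
  ultimately show ?thesis by (simp add: smooth_fun_on_def)
qed

lemma smooth_step_eq_0: "x \<le> 0 \<Longrightarrow> smooth_step x = 0"
  and smooth_step_eq_1: "1 \<le> x \<Longrightarrow> smooth_step x = 1"
  by (auto simp: smooth_step_def flat_def)

lemma smooth_step_nonneg: "0 \<le> smooth_step x" and smooth_step_le_1: "smooth_step x \<le> 1"
  using flat_1_sum_pos[of x] flat_1_nonneg[of x] flat_1_nonneg[of "1 - x"]
  by (auto simp: smooth_step_def field_simps)

section \<open>Support, sign and bounds of the derivatives of the step function\<close>

abbreviation step1 :: "real \<Rightarrow> real" where "step1 \<equiv> deriv smooth_step"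
abbreviation step2 :: "real \<Rightarrow> real" where "step2 \<equiv> deriv step1"

lemma smooth_step1: "smooth_fun_on UNIV step1"
  using smooth_fun_on_real_deriv(2)[OF smooth_smooth_step] .

lemmas smooth_step_DERIV = smooth_fun_on_real_deriv(1)[OF smooth_smooth_step]
lemmas step1_DERIV = smooth_fun_on_real_deriv(1)[OF smooth_step1]

lemma step_continuous: "continuous_on UNIV smooth_step" "continuous_on UNIV step1" "continuous_on UNIV step2"
proof -
  show "continuous_on UNIV smooth_step" "continuous_on UNIV step1"
    using smooth_smooth_step smooth_step1 by (auto simp: smooth_fun_on_def intro: Ck_on_imp_continuous_on[of 0])
  show "continuous_on UNIV step2"
    using smooth_fun_on_real_deriv(2)[OF smooth_step1]
    by (auto simp: smooth_fun_on_def intro: Ck_on_imp_continuous_on[of 0])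
qed

text \<open>Local constancy gives 0 on the two open rays, and continuity of the derivative carries
  this to the end points 0 and 1.\<close>

lemma deriv_locally_const_0:
  fixes f :: "real \<Rightarrow> real"
  assumes cont: "continuous_on UNIV (deriv f)" and x: "x \<notin> {0<..<1}"
    and const: "\<And>y. y < 0 \<Longrightarrow> f y = c0" "\<And>y. y > 1 \<Longrightarrow> f y = c1"
  shows "deriv f x = 0"
proof -
  have *: "deriv f y = 0" if "y \<in> {..<0} \<union> {1<..}" for y
  proof -
    have "(f has_real_derivative 0) (at y)" if "y \<in> {..<0}"
      by (rule has_field_derivative_transform_within_open[of "\<lambda>_. c0" _ _ "{..<0}"])
        (use that const in auto)
    moreover have "(f has_real_derivative 0) (at y)" if "y \<in> {1<..}"
      by (rule has_field_derivative_transform_within_open[of "\<lambda>_. c1" _ _ "{1<..}"])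
        (use that const in auto)
    ultimately show ?thesis using that DERIV_imp_deriv by blast
  qed
  have "x \<in> closure ({..<0} \<union> {1<..})"
    using x by (auto simp: closure_Un not_less)
  with cont * show ?thesis
    by (rule continuous_constant_on_closure[OF continuous_on_subset[OF _ subset_UNIV]])
qed

lemma step1_eq_0: "x \<notin> {0<..<1} \<Longrightarrow> step1 x = 0"
  by (rule deriv_locally_const_0[OF step_continuous(2)]) (auto simp: smooth_step_eq_0 smooth_step_eq_1)

lemma step2_eq_0: "x \<notin> {0<..<1} \<Longrightarrow> step2 x = 0"
  by (rule deriv_locally_const_0[OF step_continuous(3)]) (auto simp: step1_eq_0)

text \<open>Strictness provides a positive minimum of \<open>step1\<close> on [1/4, 3/4], hence a
  positive constant in \<open>flux_lower_bound\<close>. By the quotient rule the numerator is A' B +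
  A B' with all four values positive.\<close>

lemma step1_pos: assumes "0 < x" "x < 1" shows "0 < step1 x"
proof -
  define A where "A = flat 1 x"
  define B where "B = flat 1 (1 - x)"
  define A' where "A' = flat [:0, 0, 1:] x"
  define B' where "B' = flat [:0, 0, 1:] (1 - x)"
  have fd: "(flat 1 has_real_derivative flat [:0, 0, 1:] y) (at y)" for y
    using flat_deriv[of 1 y] by (simp add: one_pCons pderiv_pCons)
  have pos: "A > 0" "B > 0" "A' > 0" "B' > 0"
    using assms by (auto simp: A_def B_def A'_def B'_def flat_def)
  have "(smooth_step has_real_derivative
      A' * inverse (A + B) + A * (- (inverse (A + B) * (A' - B') * inverse (A + B)))) (at x)"
    unfolding smooth_step_def[abs_def] A_def B_def A'_def B'_def
    using flat_1_sum_pos[of x]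
    by (auto intro!: derivative_eq_intros DERIV_chain2[OF fd] fd)
  then have "step1 x = A' * inverse (A + B) + A * (- (inverse (A + B) * (A' - B') * inverse (A + B)))"
    by (rule DERIV_imp_deriv)
  also have "\<dots> = (A' * B + A * B') / (A + B)\<^sup>2"
    using pos by (simp add: field_simps power2_eq_square add_nonneg_eq_0_iff)
  also have "\<dots> > 0" using pos by (intro divide_pos_pos add_pos_pos mult_pos_pos) auto
  finally show ?thesis .
qed

lemma step1_nonneg: "0 \<le> step1 x"
  using step1_pos step1_eq_0 by (cases "x \<in> {0<..<1}") (auto simp: less_imp_le)

lemma bounded_if_eq_0:
  fixes f :: "real \<Rightarrow> real"
  assumes "continuous_on UNIV f" "\<And>x. x \<notin> {0<..<1} \<Longrightarrow> f x = 0"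
  obtains C where "C > 0" "\<And>x. \<bar>f x\<bar> \<le> C"
proof -
  have "compact (f ` {0..1})"
    by (intro compact_continuous_image continuous_on_subset[OF assms(1)]) auto
  then obtain C where "C > 0" "\<forall>y\<in>f ` {0..1}. norm y \<le> C"
    using compact_imp_bounded bounded_pos by blast
  then have "\<bar>f x\<bar> \<le> C" for x
    using assms(2)[of x] by (cases "x \<in> {0..1}") auto
  with \<open>C > 0\<close> show ?thesis using that by blast
qed

section \<open>Integration by parts and uniqueness of weak gradients\<close>

lemma continuous_on_extend_0:
  fixes h :: "'a::euclidean_space \<Rightarrow> real"
  assumes "open S" "compact K" "K \<subseteq> S" "continuous_on S h" "\<And>z. z \<in> S - K \<Longrightarrow> h z = 0"
  shows "continuous_on UNIV (\<lambda>z. if z \<in> S then h z else 0)"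
proof -
  have "continuous_on (S \<union> - K) (\<lambda>z. if z \<in> S then h z else 0)"
  proof (rule continuous_on_open_Un)
    show "continuous_on S (\<lambda>z. if z \<in> S then h z else 0)"
      using assms(4) by (rule continuous_on_eq) simp
    show "continuous_on (- K) (\<lambda>z. if z \<in> S then h z else 0)"
      by (rule continuous_on_eq[of _ "\<lambda>_. 0"]) (use assms in auto)
  qed (use assms compact_imp_closed in auto)
  moreover have "S \<union> - K = UNIV" using assms by auto
  ultimately show ?thesis by simp
qed

lemma integrable_continuous_compact_support:
  fixes h :: "'a::euclidean_space \<Rightarrow> real"
  assumes "continuous_on UNIV h" "compact K" "\<And>z. z \<notin> K \<Longrightarrow> h z = 0"
  shows "integrable lborel h"
proof -
  have "integrable lborel (\<lambda>z. indicator K z *\<^sub>R h z)"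
    using borel_integrable_compact[OF assms(2) continuous_on_subset[OF assms(1)]] by (simp add: indicator_scaleR_eq_if)
  moreover have "(\<lambda>z. indicator K z *\<^sub>R h z) = h"
    using assms(3) by (auto simp: indicator_def fun_eq_iff)
  ultimately show ?thesis by simp
qed

lemma integral_lebesgue_on_extend_0:
  fixes h :: "'a::euclidean_space \<Rightarrow> real"
  assumes "open S" "compact K" "K \<subseteq> S" "continuous_on S h" "\<And>z. z \<in> S - K \<Longrightarrow> h z = 0"
  shows "integrable (lebesgue_on S) h"
    and "integral\<^sup>L (lebesgue_on S) h = integral\<^sup>L lborel (\<lambda>z. if z \<in> S then h z else 0)"
proof -
  let ?h = "\<lambda>z. if z \<in> S then h z else 0"
  have eq: "(\<lambda>z. indicator S z *\<^sub>R h z) = ?h" by (auto simp: indicator_def)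
  have S: "S \<inter> space lebesgue \<in> sets lebesgue" using assms(1) by simp
  have c: "continuous_on UNIV ?h"
    using assms by (rule continuous_on_extend_0)
  then have m: "?h \<in> borel_measurable lborel"
    by (simp add: borel_measurable_continuous_onI)
  have "integrable lborel ?h"
    by (rule integrable_continuous_compact_support[OF c assms(2)]) (use assms in auto)
  then have "integrable lebesgue ?h"
    using integrable_completion[OF m] by simp
  then show "integrable (lebesgue_on S) h"
    using integrable_restrict_space[OF S, of h] eq by simp
  show "integral\<^sup>L (lebesgue_on S) h = integral\<^sup>L lborel ?h"
    using integral_restrict_space[OF S, of h] eq integral_completion[OF m] by simp
qed

lemma DERIV_along_line:
  fixes F F' :: "'a::real_normed_vector \<Rightarrow> real"
  assumes "\<And>z. ((\<lambda>s. F (z + s *\<^sub>R v)) has_real_derivative F' z) (at 0)"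
  shows "((\<lambda>s. F (z + s *\<^sub>R v)) has_real_derivative F' (z + s *\<^sub>R v)) (at s)"
proof -
  have eq: "(\<lambda>r. F ((z + s *\<^sub>R v) + r *\<^sub>R v)) = (\<lambda>r. F (z + (r + s) *\<^sub>R v))"
    by (simp add: algebra_simps)
  show ?thesis
    using assms[of "z + s *\<^sub>R v", unfolded eq] DERIV_shift[of "\<lambda>s. F (z + s *\<^sub>R v)" _ 0 s]
    by simp
qed

text \<open>The difference quotients of F along v have integral 0 because Lebesgue measure is
  translation invariant. They converge to F' and are bounded, by the mean value theorem, on one
  fixed ball, so dominated convergence concludes.\<close>

lemma integral_directional_derivative_eq_0:
  fixes F F' :: "'a::euclidean_space \<Rightarrow> real"
  assumes D: "\<And>z. ((\<lambda>s. F (z + s *\<^sub>R v)) has_real_derivative F' z) (at 0)"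
    and cF: "continuous_on UNIV F" and cF': "continuous_on UNIV F'"
    and K: "compact K" "\<And>z. z \<notin> K \<Longrightarrow> F z = 0" "\<And>z. z \<notin> K \<Longrightarrow> F' z = 0"
  shows "integral\<^sup>L lborel F' = 0"
proof -
  obtain R where R: "\<And>z. z \<in> K \<Longrightarrow> norm z \<le> R"
    using compact_imp_bounded[OF K(1)] bounded_iff by blast
  obtain B where B: "\<And>z. z \<in> K \<Longrightarrow> \<bar>F' z\<bar> \<le> B" "0 < B"
  proof -
    have "compact (F' ` K)" by (intro compact_continuous_image continuous_on_subset[OF cF'] K) auto
    then obtain B where "0 < B" "\<forall>y\<in>F' ` K. norm y \<le> B"
      using compact_imp_bounded bounded_pos by blast
    then show ?thesis using that by auto
  qed
  have B': "\<bar>F' z\<bar> \<le> B" for z using B K(3)[of z] by (cases "z \<in> K") auto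
  define s where "s n = inverse (real (Suc n))" for n
  have s: "0 < s n" "s n \<le> 1" for n by (auto simp: s_def inverse_le_1_iff)
  define q where "q n z = (F (z + s n *\<^sub>R v) - F z) / s n" for n z
  \<comment> \<open>The ball contains K and its translates by vectors no longer than v, hence the
    supports of all quotients.\<close>
  have qB: "\<bar>q n z\<bar> \<le> B * indicator (cball 0 (R + norm v)) z" for n z
  proof (cases "norm z \<le> R + norm v")
    case True
    obtain \<xi> where "F (z + s n *\<^sub>R v) - F (z + 0 *\<^sub>R v) = (s n - 0) * F' (z + \<xi> *\<^sub>R v)"
      using MVT2[OF s(1)[of n], of "\<lambda>s. F (z + s *\<^sub>R v)" "\<lambda>s. F' (z + s *\<^sub>R v)"] DERIV_along_line[OF D]
      by blast
    then have "q n z = F' (z + \<xi> *\<^sub>R v)" using s(1)[of n] by (simp add: q_def)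
    then show ?thesis using True B' by simp
  next
    case False
    have "norm z \<le> norm (z + s n *\<^sub>R v) + norm (s n *\<^sub>R v)"
      using norm_triangle_ineq4[of "z + s n *\<^sub>R v" "s n *\<^sub>R v"] by simp
    moreover have "norm (s n *\<^sub>R v) \<le> norm v"
      using s[of n] mult_left_le_one_le[of "norm v" "s n"] by simp
    ultimately have "z \<notin> K" "z + s n *\<^sub>R v \<notin> K" using False R[of z] R[of "z + s n *\<^sub>R v"] norm_ge_zero[of v]
      by auto
    then show ?thesis using K(2) by (simp add: q_def False)
  qed
  have iF: "integrable lborel F"
    using integrable_continuous_compact_support[OF cF K(1,2)] by blast
  have shift: "integrable lborel (\<lambda>z. F (z + c))" "integral\<^sup>L lborel (\<lambda>z. F (z + c)) = integral\<^sup>L lborel F" for c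
  proof -
    have m: "F \<in> borel_measurable borel" using cF by (simp add: borel_measurable_continuous_onI)
    have i: "integrable (distr lborel borel ((+) c)) F" using iF by (simp add: lborel_distr_plus)
    show "integrable lborel (\<lambda>z. F (z + c))"
      using integrable_distr[OF _ i] by (simp add: add.commute)
    show "integral\<^sup>L lborel (\<lambda>z. F (z + c)) = integral\<^sup>L lborel F"
      using integral_distr[of "(+) c" lborel borel F] m by (simp add: lborel_distr_plus add.commute)
  qed
  have "integral\<^sup>L lborel (q n) = 0" for n
    unfolding q_def using shift iF by simp
  moreover have "(\<lambda>n. integral\<^sup>L lborel (q n)) \<longlonglongrightarrow> integral\<^sup>L lborel F'"
  proof (rule integral_dominated_convergence)
    show "F' \<in> borel_measurable lborel" using cF' by (simp add: borel_measurable_continuous_onI)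
    show "q n \<in> borel_measurable lborel" for n
      unfolding q_def using shift(1)[of "s n *\<^sub>R v"] iF by measurable
    show "integrable lborel (\<lambda>z. B * indicator (cball 0 (R + norm v)) z)"
      by (intro integrable_mult_right integrable_real_indicator) (use emeasure_bounded_finite[OF bounded_cball, of 0 "R + norm v"] in simp_all)
    have "(\<lambda>n. q n z) \<longlonglongrightarrow> F' z" for z
    proof -
      have "filterlim s (at 0) sequentially"
        unfolding s_def using s LIMSEQ_inverse_real_of_nat
        by (auto simp: filterlim_at s_def)
      moreover have "((\<lambda>h. (F (z + h *\<^sub>R v) - F z) / h) \<longlongrightarrow> F' z) (at 0)"
        using D[of z] by (simp add: has_field_derivative_iff)
      ultimately show ?thesis unfolding q_def by (rule filterlim_compose[rotated])
    qed
    then show "AE z in lborel. (\<lambda>n. q n z) \<longlonglongrightarrow> F' z" by simp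
    show "AE z in lborel. norm (q n z) \<le> B * indicator (cball 0 (R + norm v)) z" for n
      using qB by simp
  qed
  ultimately show ?thesis by (simp add: LIMSEQ_const_iff)
qed

text \<open>\<open>dt\<close> and \<open>dx\<close> use \<open>frechet_derivative\<close>, whereas
  \<open>Ck_on\<close> provides some derivative within S. On an open set the two agree, and off the
  support both the function and its derivative vanish.\<close>

lemma C0_infE:
  fixes \<phi> :: "'a::euclidean_space \<Rightarrow> real"
  assumes "\<phi> \<in> C0_inf S" "open S"
  obtains K where "compact K" "K \<subseteq> S" "\<And>z. z \<in> S - K \<Longrightarrow> \<phi> z = 0"
    "\<And>z v. z \<in> S - K \<Longrightarrow> frechet_derivative \<phi> (at z) v = 0"
    "\<And>z. z \<in> S \<Longrightarrow> (\<phi> has_derivative frechet_derivative \<phi> (at z)) (at z)"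
    "\<And>v. continuous_on S (\<lambda>z. frechet_derivative \<phi> (at z) v)"
    "continuous_on S \<phi>"
proof -
  have Ck: "Ck_on n S \<phi>" for n using assms by (simp add: C0_inf_def smooth_fun_on_def)
  obtain f' where f': "\<forall>z\<in>S. (\<phi> has_derivative f' z) (at z within S)" "\<forall>v. continuous_on S (\<lambda>z. f' z v)"
    using Ck[of "Suc 0"] by auto
  have D: "(\<phi> has_derivative f' z) (at z)" if "z \<in> S" for z
    using f'(1) that at_within_open[OF that assms(2)] by auto
  then have eq: "f' z = frechet_derivative \<phi> (at z)" if "z \<in> S" for z
    using that frechet_derivative_at by blast
  let ?K = "closure {z \<in> S. \<phi> z \<noteq> 0}"
  have K: "compact ?K" "?K \<subseteq> S" using assms by (auto simp: C0_inf_def)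
  have 0: "\<phi> z = 0" if "z \<in> S - ?K" for z
    using that closure_subset[of "{z \<in> S. \<phi> z \<noteq> 0}"] by blast
  have "frechet_derivative \<phi> (at z) v = 0" if z: "z \<in> S - ?K" for z v
  proof -
    have "open (S - ?K)" using assms(2) by auto
    have "((\<lambda>_. 0) has_derivative frechet_derivative \<phi> (at z)) (at z)"
    proof (rule has_derivative_transform_within_open[OF _ \<open>open (S - ?K)\<close> z])
      show "(\<phi> has_derivative frechet_derivative \<phi> (at z)) (at z)" using D[of z] eq[of z] z by auto
    qed (rule 0)
    then have "frechet_derivative \<phi> (at z) = (\<lambda>_. 0)"
      by (rule has_derivative_unique) (rule has_derivative_const)
    then show ?thesis by simp
  qed
  moreover have "continuous_on S (\<lambda>z. frechet_derivative \<phi> (at z) v)" for v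
    using f'(2)[rule_format, of v] by (rule continuous_on_eq) (simp add: eq)
  ultimately show ?thesis
    using that[OF K 0] D eq Ck[of 0] by auto
qed

lemma directional_DERIV:
  fixes \<phi> :: "'a::real_normed_vector \<Rightarrow> real"
  assumes "(\<phi> has_derivative D) (at z)"
  shows "((\<lambda>s. \<phi> (z + s *\<^sub>R v)) has_real_derivative D v) (at 0)"
proof -
  have "((\<lambda>s::real. z + s *\<^sub>R v) has_derivative (\<lambda>s. s *\<^sub>R v)) (at 0)"
    by (auto intro!: derivative_eq_intros)
  then have "((\<lambda>s. \<phi> (z + s *\<^sub>R v)) has_derivative (\<lambda>s. D (s *\<^sub>R v))) (at 0)"
    by (rule has_derivative_compose) (use assms in simp)
  moreover have "(\<lambda>s. D (s *\<^sub>R v)) = (\<lambda>s. D v * s)"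
    using linear_simps(5)[OF has_derivative_bounded_linear[OF assms]] by (simp add: mult.commute)
  ultimately show ?thesis by (simp add: has_field_derivative_def)
qed

text \<open>The product of f and \<phi>, extended by 0, has a directional derivative with integral
  0. Differentiability of f is asked along v alone, which suits \<open>flux\<close>: it is
  differentiated only in the direction k.\<close>

lemma integration_by_parts:
  fixes f f' :: "'a::euclidean_space \<Rightarrow> real"
  assumes S: "open S" and \<phi>: "\<phi> \<in> C0_inf S"
    and cf: "continuous_on S f" and cf': "continuous_on S f'"
    and D: "\<And>z. z \<in> S \<Longrightarrow> ((\<lambda>s. f (z + s *\<^sub>R v)) has_real_derivative f' z) (at 0)"
  shows "(LINT z|lebesgue_on S. f z * frechet_derivative \<phi> (at z) v) = - (LINT z|lebesgue_on S. f' z * \<phi> z)"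
proof -
  let ?D = "\<lambda>z. frechet_derivative \<phi> (at z) v"
  obtain K where K: "compact K" "K \<subseteq> S" and \<phi>0: "\<And>z. z \<in> S - K \<Longrightarrow> \<phi> z = 0"
    and D0: "\<And>z. z \<in> S - K \<Longrightarrow> ?D z = 0"
    and D\<phi>: "\<And>z. z \<in> S \<Longrightarrow> (\<phi> has_derivative frechet_derivative \<phi> (at z)) (at z)"
    and c: "continuous_on S ?D" "continuous_on S \<phi>"
    using C0_infE[OF \<phi> S] by metis
  let ?F = "\<lambda>z. if z \<in> S then f z * \<phi> z else 0"
  let ?F' = "\<lambda>z. if z \<in> S then f z * ?D z + f' z * \<phi> z else 0"
  have cF': "continuous_on UNIV ?F'" and cF: "continuous_on UNIV ?F"
    using cf cf' c \<phi>0 D0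
    by (intro continuous_on_extend_0[OF S K] continuous_on_add continuous_on_mult; simp)+
  have line: "((\<lambda>s. z + s *\<^sub>R v) \<longlongrightarrow> z) (at 0)" for z :: 'a
    by (auto intro!: tendsto_eq_intros)
  have "integral\<^sup>L lborel ?F' = 0"
  proof (rule integral_directional_derivative_eq_0[OF _ cF cF' K(1)])
    fix z
    show "((\<lambda>s. ?F (z + s *\<^sub>R v)) has_real_derivative ?F' z) (at 0)"
    proof (cases "z \<in> S")
      case True
      have D1: "((\<lambda>s. f (z + s *\<^sub>R v) * \<phi> (z + s *\<^sub>R v)) has_real_derivative ?F' z) (at 0)"
        using DERIV_mult[OF D[OF True] directional_DERIV[OF D\<phi>[OF True], where v=v]] True by (simp add: add.commute mult.commute)
      have ev: "\<forall>\<^sub>F s in nhds 0. f (z + s *\<^sub>R v) * \<phi> (z + s *\<^sub>R v) = ?F (z + s *\<^sub>R v)"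
      proof -
        have "\<forall>\<^sub>F s in at 0. z + s *\<^sub>R v \<in> S"
          using topological_tendstoD[OF line S True] .
        then show ?thesis
          using True unfolding eventually_at_filter by (auto elim: eventually_mono)
      qed
      show ?thesis
        using iffD1[OF DERIV_cong_ev[OF refl ev refl] D1] .
    next
      case False
      \<comment> \<open>A point outside S has a neighbourhood that misses K, and the extended
        product is identically 0 there.\<close>
      have "open (- K)" "z \<in> - K" using False K compact_imp_closed by auto
      then have "\<forall>\<^sub>F s in at 0. z + s *\<^sub>R v \<in> - K"
        using topological_tendstoD[OF line] by blast
      then have ev: "\<forall>\<^sub>F s in nhds 0. 0 = ?F (z + s *\<^sub>R v)"
        using False \<phi>0 unfolding eventually_at_filter by (auto elim!: eventually_mono)
      have "((\<lambda>_. 0) has_real_derivative ?F' z) (at 0)" using False by simp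
      then show ?thesis
        using iffD1[OF DERIV_cong_ev[OF refl ev refl]] by blast
    qed
  qed (use \<phi>0 D0 in auto)
  moreover have "integral\<^sup>L lborel ?F' = (LINT z|lebesgue_on S. f z * ?D z + f' z * \<phi> z)"
    using cf cf' c \<phi>0 D0
    by (intro integral_lebesgue_on_extend_0(2)[OF S K, symmetric] continuous_on_add continuous_on_mult) simp_all
  moreover have "integrable (lebesgue_on S) (\<lambda>z. f z * ?D z)" "integrable (lebesgue_on S) (\<lambda>z. f' z * \<phi> z)"
    using cf cf' c \<phi>0 D0
    by (intro integral_lebesgue_on_extend_0(1)[OF S K] continuous_on_mult; simp)+
  ultimately show ?thesis by simp
qed

section \<open>Functions orthogonal to all test functions vanish almost everywhere\<close>

lemma AE_eq_0_if_integral_boxes_eq_0: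
  fixes f :: "'a::euclidean_space \<Rightarrow> real"
  assumes f: "integrable lborel f" and "integral\<^sup>L lborel f = 0"
    and box: "\<And>c d. (LINT z:box c d|lborel. f z) = 0"
  shows "AE z in lborel. f z = 0"
proof (rule sigma_finite_measure.density_zero[OF sigma_finite_lborel f])
  let ?E = "range (\<lambda>(a, b). box a b::'a set)"
  have si: "set_integrable lborel A f" if "A \<in> sets borel" for A
    using f that unfolding set_integrable_def by (intro integrable_mult_indicator) auto
  fix A :: "'a set" assume "A \<in> sets lborel"
  then have A: "A \<in> sigma_sets UNIV ?E" by (simp add: borel_eq_box)
  \<comment> \<open>Open boxes are stable under intersection and generate the Borel sets, so
    complements and disjoint unions remain; complements are where the total integral enters.\<close>
  have "Int_stable ?E" "?E \<subseteq> Pow UNIV" by (auto simp: Int_stable_def box_Int_box)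
  then show "(LINT z:A|lborel. f z) = 0" using A
  proof (induction rule: sigma_sets_induct_disjoint)
    case (compl A)
    then have A: "A \<in> sets borel" by (simp add: borel_eq_box)
    have "(LINT z:A \<union> - A|lborel. f z) = (LINT z:A|lborel. f z) + (LINT z:- A|lborel. f z)"
      using A by (intro set_integral_Un si) auto
    then show ?case using compl assms(2) by (simp add: set_lebesgue_integral_def Compl_eq_Diff_UNIV)
  next
    case (union A)
    then have "A i \<in> sets borel" for i by (auto simp: borel_eq_box)
    then have "(LINT z:(\<Union>i. A i)|lborel. f z) = (\<Sum>i. LINT z:A i|lborel. f z)"
      using union by (intro lebesgue_integral_countable_add si sets.countable_UN) (auto simp: disjoint_family_on_def)
    then show ?case using union by simp
  qed (use box in \<open>auto simp: set_lebesgue_integral_def\<close>)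
qed

lemma Ck_on_smooth_step_affine:
  assumes "bounded_linear f"
  shows "Ck_on n S (\<lambda>z. smooth_step (a * f z + c))"
proof -
  have "Ck_on n UNIV smooth_step" using smooth_smooth_step by (simp add: smooth_fun_on_def)
  then show ?thesis
    by (rule Ck_on_compose) (intro Ck_on_add Ck_on_mult Ck_on_const Ck_on_linear[OF assms], simp)
qed

lemma C0_infI:
  assumes "\<And>n. Ck_on n S f" "compact K" "K \<subseteq> S" "\<And>z. z \<in> S \<Longrightarrow> z \<notin> K \<Longrightarrow> f z = 0"
  shows "f \<in> C0_inf S"
proof -
  have "closure {z \<in> S. f z \<noteq> 0} \<subseteq> K"
    using assms by (intro closure_minimal compact_imp_closed) auto
  with assms show ?thesis
    using compact_Int_closed[of K "closure {z \<in> S. f z \<noteq> 0}"]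
    by (auto simp: C0_inf_def smooth_fun_on_def Int_absorb1)
qed

lemma smooth_approx_indicator_box:
  fixes c d :: "'a::euclidean_space"
  assumes "cbox c d \<subseteq> S"
  obtains \<phi> :: "nat \<Rightarrow> 'a \<Rightarrow> real" where "\<And>n. \<phi> n \<in> C0_inf S" "\<And>n z. \<bar>\<phi> n z\<bar> \<le> indicator (cbox c d) z"
    "\<And>z. (\<lambda>n. \<phi> n z) \<longlonglongrightarrow> indicator (box c d) z"
proof
  \<comment> \<open>Each factor rises from 0 on a face of the box to 1 at distance 1/n from it, so
    the product vanishes off the open box. The arguments have the shape a * f z + c of
    \<open>Ck_on_smooth_step_affine\<close>.\<close>
  define \<phi> where "\<phi> n z = (\<Prod>j\<in>Basis. smooth_step (real n * (z \<bullet> j) + - real n * (c \<bullet> j)) *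
      smooth_step (- real n * (z \<bullet> j) + real n * (d \<bullet> j)))" for n and z :: 'a
  have le0: "real n * x + - real n * y \<le> 0" if "x \<le> y" for n x y
    using that mult_left_mono[of x y "real n"] by simp
  have le0': "- real n * x + real n * y \<le> 0" if "y \<le> x" for n x y
    using that mult_left_mono[of y x "real n"] by simp
  have out: "\<phi> n z = 0" if z: "z \<notin> box c d" for n z
  proof -
    obtain j where "j \<in> Basis" "z \<bullet> j \<le> c \<bullet> j \<or> d \<bullet> j \<le> z \<bullet> j"
      using z unfolding mem_box not_less[symmetric] by blast
    then show ?thesis
      unfolding \<phi>_def using le0 le0' smooth_step_eq_0 by (intro prod_zero bexI[of _ j]) auto
  qed
  show "\<phi> n \<in> C0_inf S" for n
  proof (rule C0_infI[OF _ _ assms])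
    show "Ck_on m S (\<phi> n)" for m unfolding \<phi>_def
      by (intro Ck_on_prod Ck_on_mult Ck_on_smooth_step_affine bounded_linear_inner_left)
    show "\<phi> n z = 0" if "z \<notin> cbox c d" for z using out that box_subset_cbox by blast
  qed simp
  show "\<bar>\<phi> n z\<bar> \<le> indicator (cbox c d) z" for n z
  proof (cases "z \<in> box c d")
    case True
    have "0 \<le> \<phi> n z" "\<phi> n z \<le> 1" unfolding \<phi>_def
      by (intro prod_nonneg prod_le_1 ballI conjI mult_nonneg_nonneg mult_le_one smooth_step_nonneg smooth_step_le_1)+
    then show ?thesis using True box_subset_cbox by (auto simp: indicator_def)
  qed (simp add: out)
  show "(\<lambda>n. \<phi> n z) \<longlonglongrightarrow> indicator (box c d) z" for z
  proof (cases "z \<in> box c d")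
    case True
    have ev: "\<forall>\<^sub>F n in sequentially. smooth_step (real n * x + - real n * y) = 1" if "y < x" for x y
    proof -
      obtain N where N: "1 < real N * (x - y)" using reals_Archimedean3[of "x - y"] \<open>y < x\<close> by force
      have "smooth_step (real n * x + - real n * y) = 1" if "N \<le> n" for n
      proof -
        have "real N * (x - y) \<le> real n * (x - y)" using that \<open>y < x\<close> by (intro mult_right_mono) auto
        then show ?thesis using N by (intro smooth_step_eq_1) (simp add: algebra_simps)
      qed
      then show ?thesis by (auto simp: eventually_sequentially)
    qed
    have "\<forall>\<^sub>F n in sequentially. \<forall>j\<in>Basis. smooth_step (real n * (z \<bullet> j) + - real n * (c \<bullet> j)) = 1 \<and>
        smooth_step (- real n * (z \<bullet> j) + real n * (d \<bullet> j)) = 1"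
    proof (intro eventually_ball_finite ballI eventually_conj)
      fix j :: 'a assume "j \<in> Basis"
      then have "c \<bullet> j < z \<bullet> j" "z \<bullet> j < d \<bullet> j" using True by (auto simp: mem_box)
      then show "\<forall>\<^sub>F n in sequentially. smooth_step (real n * (z \<bullet> j) + - real n * (c \<bullet> j)) = 1"
        "\<forall>\<^sub>F n in sequentially. smooth_step (- real n * (z \<bullet> j) + real n * (d \<bullet> j)) = 1"
        using ev[of "c \<bullet> j" "z \<bullet> j"] ev[of "z \<bullet> j" "d \<bullet> j"] by (auto simp: add.commute)
    qed simp
    then have "\<forall>\<^sub>F n in sequentially. \<phi> n z = 1"
      by (rule eventually_mono) (simp add: \<phi>_def)
    then show ?thesis using True by (simp add: tendsto_eventually)
  qed (simp add: out)
qed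

text \<open>Smooth approximations of indicators give integral 0 over every open box whose closure
  lies in S. Hence w vanishes almost everywhere in each closed box inside S, and countably many of
  these fill S.\<close>

lemma fundamental_lemma:
  fixes w :: "'a::euclidean_space \<Rightarrow> real"
  assumes S: "open S"
    and int: "\<And>K. compact K \<Longrightarrow> K \<subseteq> S \<Longrightarrow> integrable (lebesgue_on S) (\<lambda>z. indicator K z * w z)"
    and zero: "\<And>\<phi>. \<phi> \<in> C0_inf S \<Longrightarrow> (LINT z|lebesgue_on S. w z * \<phi> z) = 0"
  shows "AE z in lebesgue_on S. w z = 0"
proof -
  have S': "S \<inter> space lebesgue \<in> sets lebesgue" using S by simp
  have box0: "(LINT z|lebesgue. indicator (box c d) z * w z) = 0" if cd: "cbox c d \<subseteq> S" for c d
  proof -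
    obtain \<phi> where \<phi>: "\<And>n. \<phi> n \<in> C0_inf S" "\<And>n z. \<bar>\<phi> n z\<bar> \<le> indicator (cbox c d) z"
      "\<And>z. (\<lambda>n. \<phi> n z) \<longlonglongrightarrow> indicator (box c d) z"
      using smooth_approx_indicator_box[OF cd] by metis
    have iw: "integrable (lebesgue_on S) (\<lambda>z. indicator (cbox c d) z * w z)" using int cd by simp
    have supp: "indicator (cbox c d) z * w z * \<phi> n z = w z * \<phi> n z"
      "indicator (cbox c d) z * w z * indicator (box c d) z = indicator (box c d) z * w z" for n z
      using \<phi>(2)[of n z] box_subset_cbox[of c d] by (auto simp: indicator_def)
    have "(\<lambda>n. LINT z|lebesgue_on S. w z * \<phi> n z) \<longlonglongrightarrow> (LINT z|lebesgue_on S. indicator (box c d) z * w z)"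
    proof (rule integral_dominated_convergence[where w="\<lambda>z. \<bar>indicator (cbox c d) z * w z\<bar>"])
      have m: "(\<lambda>z. indicator (cbox c d) z * w z) \<in> borel_measurable (lebesgue_on S)" using iw by simp
      have "continuous_on S (\<phi> n)" for n using \<phi>(1)[of n] by (auto simp: C0_inf_def smooth_fun_on_def dest: spec[of _ 0])
      then have "\<phi> n \<in> borel_measurable (lebesgue_on S)" for n
        using S by (intro continuous_imp_measurable_on_sets_lebesgue) auto
      then have "(\<lambda>z. indicator (cbox c d) z * w z * \<phi> n z) \<in> borel_measurable (lebesgue_on S)" for n
        using m by measurable
      then show "(\<lambda>z. w z * \<phi> n z) \<in> borel_measurable (lebesgue_on S)" for n by (simp add: supp)
      have "(indicator (box c d) :: 'a \<Rightarrow> real) \<in> borel_measurable lebesgue"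
        by (intro borel_measurable_indicator) simp
      then have "(indicator (box c d) :: 'a \<Rightarrow> real) \<in> borel_measurable (lebesgue_on S)"
        by (rule measurable_restrict_space1)
      then have "(\<lambda>z. indicator (cbox c d) z * w z * indicator (box c d) z) \<in> borel_measurable (lebesgue_on S)"
        using m by measurable
      then show "(\<lambda>z. indicator (box c d) z * w z) \<in> borel_measurable (lebesgue_on S)" by (simp add: supp)
      show "integrable (lebesgue_on S) (\<lambda>z. \<bar>indicator (cbox c d) z * w z\<bar>)" using iw by simp
      have "(\<lambda>n. w z * \<phi> n z) \<longlonglongrightarrow> indicator (box c d) z * w z" for z
        using tendsto_mult_left[OF \<phi>(3)[of z], of "w z"] by (simp add: mult.commute)
      then show "AE z in lebesgue_on S. (\<lambda>n. w z * \<phi> n z) \<longlonglongrightarrow> indicator (box c d) z * w z" by simp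
      have "\<bar>w z * \<phi> n z\<bar> \<le> \<bar>indicator (cbox c d) z * w z\<bar>" for n z
        using mult_left_mono[OF \<phi>(2)[of n z], of "\<bar>w z\<bar>"] by (simp add: abs_mult mult.commute)
      then show "AE z in lebesgue_on S. norm (w z * \<phi> n z) \<le> \<bar>indicator (cbox c d) z * w z\<bar>" for n by simp
    qed
    then have "(LINT z|lebesgue_on S. indicator (box c d) z * w z) = 0"
      using zero[OF \<phi>(1)] by (simp add: LIMSEQ_const_iff)
    moreover have "(LINT z|lebesgue_on S. indicator (box c d) z * w z) = (LINT z|lebesgue. indicator S z *\<^sub>R (indicator (box c d) z * w z))"
      by (rule integral_restrict_space[OF S'])
    moreover have "(\<lambda>z. indicator S z *\<^sub>R (indicator (box c d) z * w z)) = (\<lambda>z. indicator (box c d) z * w z)"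
      using cd box_subset_cbox[of c d] by (auto simp: indicator_def fun_eq_iff)
    ultimately show ?thesis by simp
  qed
  have AE_cbox: "AE z in lebesgue. z \<in> cbox a b \<longrightarrow> w z = 0" if ab: "cbox a b \<subseteq> S" for a b
  proof -
    let ?f = "\<lambda>z. indicator (box a b) z * w z"
    have "integrable (lebesgue_on S) (\<lambda>z. indicator (cbox a b) z * w z)" using int ab by simp
    then have "integrable lebesgue (\<lambda>z. indicator S z *\<^sub>R (indicator (cbox a b) z * w z))"
      unfolding integrable_restrict_space[OF S'] .
    then have "integrable lebesgue (\<lambda>z. indicator (box a b) z *\<^sub>R (indicator S z *\<^sub>R (indicator (cbox a b) z * w z)))"
      by (rule integrable_mult_indicator[rotated]) simp
    moreover have "(\<lambda>z. indicator (box a b) z *\<^sub>R (indicator S z *\<^sub>R (indicator (cbox a b) z * w z))) = ?f"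
      using ab box_subset_cbox[of a b] by (auto simp: indicator_def fun_eq_iff)
    ultimately have f: "integrable lebesgue ?f" by simp
    \<comment> \<open>The criterion with boxes is about \<open>lborel\<close>, so the restriction of
      w to the box is replaced by a Borel function that agrees with it almost everywhere.\<close>
    then obtain g where g: "g \<in> borel_measurable lborel" "AE z in lborel. ?f z = g z"
      using completion_ex_borel_measurable_real[of ?f lborel] by auto
    then have ae: "AE z in lebesgue. ?f z = g z" by (simp add: AE_completion_iff AE_completion)
    have gm: "g \<in> borel_measurable lebesgue" using g(1) by (simp add: measurable_completion)
    have "integrable lebesgue g"
      using integrable_cong_AE[OF _ gm ae] f by simp
    then have ig: "integrable lborel g" using integrable_completion[OF g(1)] by simp
    have int_box: "(LINT z:box c d|lborel. g z) = (LINT z|lebesgue. indicator (box c d \<inter> box a b) z * w z)" for c d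
    proof -
      have m: "(\<lambda>z. indicator (box c d) z *\<^sub>R g z) \<in> borel_measurable lborel" using g(1) by simp
      have "(LINT z:box c d|lborel. g z) = (LINT z|lebesgue. indicator (box c d) z *\<^sub>R g z)"
        using integral_completion[OF m] by (simp add: set_lebesgue_integral_def)
      also have "\<dots> = (LINT z|lebesgue. indicator (box c d) z *\<^sub>R ?f z)"
      proof (rule integral_cong_AE)
        show "(\<lambda>z. indicator (box c d) z *\<^sub>R g z) \<in> borel_measurable lebesgue"
          using gm by (intro borel_measurable_scaleR borel_measurable_indicator) auto
        show "(\<lambda>z. indicator (box c d) z *\<^sub>R ?f z) \<in> borel_measurable lebesgue"
          using f by (intro borel_measurable_scaleR borel_measurable_indicator) auto
        show "AE z in lebesgue. indicator (box c d) z *\<^sub>R g z = indicator (box c d) z *\<^sub>R ?f z"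
          using ae by eventually_elim simp
      qed
      also have "\<dots> = (LINT z|lebesgue. indicator (box c d \<inter> box a b) z * w z)"
        by (simp add: indicator_inter_arith mult.assoc)
      finally show ?thesis .
    qed
    have "AE z in lborel. g z = 0"
    proof (rule AE_eq_0_if_integral_boxes_eq_0[OF ig])
      show "(LINT z:box c d|lborel. g z) = 0" for c d
      proof -
        obtain c' d' where cd: "box c d \<inter> box a b = box c' d'"  by (simp add: box_Int_box)
        show ?thesis
        proof (cases "box c' d' = {}")
          case True
          then show ?thesis using int_box[of c d] cd by simp
        next
          case False
          have "box c' d' \<subseteq> box a b" using cd by blast
          then have "cbox c' d' \<subseteq> cbox a b"
            using False by (metis closure_box closure_mono box_subset_cbox closure_cbox subset_trans)
          then show ?thesis using int_box[of c d] cd box0[of c' d'] ab by auto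
        qed
      qed
      have "integral\<^sup>L lborel g = integral\<^sup>L lebesgue g" using integral_completion[OF g(1)] by simp
      also have "\<dots> = integral\<^sup>L lebesgue ?f"
        using f gm ae by (intro integral_cong_AE) auto
      also have "\<dots> = 0" by (rule box0[OF ab])
      finally show "integral\<^sup>L lborel g = 0" .
    qed
    then have "AE z in lebesgue. g z = 0" by (simp add: AE_completion)
    \<comment> \<open>Only the open box has been reached so far; its faces form a null set.\<close>
    moreover have "cbox a b - box a b \<in> null_sets lebesgue"
      using negligible_frontier_interval[of a b] by (simp add: negligible_iff_null_sets)
    then have "AE z in lebesgue. z \<notin> cbox a b - box a b" by (rule AE_not_in)
    ultimately show ?thesis using ae by eventually_elim (auto simp: indicator_def split: if_splits)
  qed
  obtain \<D> where \<D>: "countable \<D>" "\<D> \<subseteq> Pow S" "\<And>X. X \<in> \<D> \<Longrightarrow> \<exists>a b. X = cbox a b" "\<Union>\<D> = S"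
    by (rule open_countable_Union_open_cbox[OF S]) (rule that)
  have "AE z in lebesgue. z \<in> X \<longrightarrow> w z = 0" if X: "X \<in> \<D>" for X
    using AE_cbox \<D>(2) \<D>(3)[OF X] X by blast
  then have "AE z in lebesgue. \<forall>X\<in>\<D>. z \<in> X \<longrightarrow> w z = 0"
    by (rule AE_ball_countable'[OF _ \<D>(1)])
  then have "AE z in lebesgue. z \<in> S \<longrightarrow> w z = 0"
    by eventually_elim (use \<D>(4) in blast)
  then show ?thesis by (simp add: AE_restrict_space_iff[OF S'])
qed

section \<open>The spaces \<open>Lp\<close> and \<open>H1\<close>\<close>

lemma open_time_interval: "open {t. 0 < t \<and> ereal t < T}"
proof -
  have "open (ereal -` {..<T})" by (intro open_vimage continuous_on_ereal continuous_on_id open_lessThan)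
  then have "open ({0<..} \<inter> ereal -` {..<T})" by (rule open_Int[OF open_greaterThan])
  also have "{0<..} \<inter> ereal -` {..<T} = {t. 0 < t \<and> ereal t < T}" by fastforce
  finally show ?thesis .
qed

lemma open_cyl: "open \<Omega> \<Longrightarrow> open (cyl T \<Omega>)"
  unfolding cyl_def by (intro open_Times open_time_interval)

lemma Lp_I:
  fixes f :: "'a::euclidean_space \<Rightarrow> 'b::euclidean_space"
  assumes S: "S \<in> sets lebesgue" and f: "continuous_on S f" and \<Phi>: "integrable (lebesgue_on S) \<Phi>"
    and le: "\<And>z. z \<in> S \<Longrightarrow> norm (f z) powr p \<le> \<Phi> z"
  shows "f \<in> Lp p S"
proof -
  have m: "f \<in> borel_measurable (lebesgue_on S)"
    using continuous_imp_measurable_on_sets_lebesgue[OF f S] .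
  have "integrable (lebesgue_on S) (\<lambda>z. norm (f z) powr p)"
  proof (rule Bochner_Integration.integrable_bound[OF \<Phi>])
    show "(\<lambda>z. norm (f z) powr p) \<in> borel_measurable (lebesgue_on S)"
      using m by measurable
    show "AE z in lebesgue_on S. norm (norm (f z) powr p) \<le> norm (\<Phi> z)"
      using le by (intro AE_I2) fastforce
  qed
  with m show ?thesis by (simp add: Lp_def)
qed

text \<open>A substitute for Hoelder's inequality that includes p = 1: either y <= 1 / s, or y * s >
  1 and then y * s <= (y * s)^p. The case s = 1 gives local integrability; a small s, coupled to
  \<delta>, gives the final contradiction.\<close>

lemma le_scaled_powr:
  fixes y :: real
  assumes "1 \<le> p" "0 \<le> y" "0 < s"
  shows "y \<le> s powr (p - 1) * y powr p + 1 / s"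
proof (cases "y * s \<le> 1")
  case True
  then have "y \<le> 1 / s" using assms by (simp add: field_simps)
  moreover have "0 \<le> s powr (p - 1) * y powr p" by simp
  ultimately show ?thesis by linarith
next
  case False
  have pos: "0 < y" using False assms by (cases "y = 0") auto
  have "(y * s) powr 1 \<le> (y * s) powr p" using False assms by (intro powr_mono) auto
  then have "y * s \<le> y powr p * s powr p" using assms pos by (simp add: powr_mult)
  also have "s powr p = s powr (p - 1) * s"
    using powr_add[of s "p - 1" 1] assms by simp
  finally have "y * s \<le> (s powr (p - 1) * y powr p) * s" by (simp add: mult_ac)
  then have "y \<le> s powr (p - 1) * y powr p" using assms by simp
  moreover have "0 \<le> 1 / s" using assms by simp
  ultimately show ?thesis by linarith
qed

lemma Lp_locally_integrable:
  fixes f :: "'a::euclidean_space \<Rightarrow> 'b::euclidean_space"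
  assumes p: "1 \<le> p" and f: "f \<in> Lp p S" and S: "S \<in> sets lebesgue" and K: "compact K"
  shows "integrable (lebesgue_on S) (\<lambda>z. indicator K z *\<^sub>R f z)"
proof -
  have fm: "f \<in> borel_measurable (lebesgue_on S)"
    and fi: "integrable (lebesgue_on S) (\<lambda>z. norm (f z) powr p)" using f by (auto simp: Lp_def)
  have Km: "K \<in> lmeasurable" using K by (rule lmeasurable_compact)
  have iK: "integrable (lebesgue_on S) (indicator K :: 'a \<Rightarrow> real)"
  proof -
    have "integrable lebesgue (indicator K :: 'a \<Rightarrow> real)" using Km by (simp add: lmeasurable_iff_integrable)
    then have "integrable lebesgue (\<lambda>z. indicator S z *\<^sub>R (indicator K z :: real))"
      by (rule integrable_mult_indicator[OF S])
    then show ?thesis using integrable_restrict_space[of S lebesgue "indicator K :: 'a \<Rightarrow> real"] S by simp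
  qed
  show ?thesis
  proof (rule Bochner_Integration.integrable_bound)
    show "integrable (lebesgue_on S) (\<lambda>z. norm (f z) powr p + indicator K z)"
      using fi iK by simp
    show "(\<lambda>z. indicator K z *\<^sub>R f z) \<in> borel_measurable (lebesgue_on S)"
      using fm iK by (intro borel_measurable_scaleR) auto
    show "AE z in lebesgue_on S. norm (indicator K z *\<^sub>R f z) \<le> norm (norm (f z) powr p + indicator K z)"
      using le_scaled_powr[OF p norm_ge_zero, of 1] by (intro AE_I2) (auto simp: indicator_def)
  qed
qed

lemma integrable_Lp_mult_C0_inf:
  fixes w :: "'a::euclidean_space \<Rightarrow> real"
  assumes S: "open S" and w: "w \<in> Lp p S" and p: "1 \<le> p" and \<phi>: "\<phi> \<in> C0_inf S"
  shows "integrable (lebesgue_on S) (\<lambda>z. w z * \<phi> z)"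
proof -
  obtain K where K: "compact K" "K \<subseteq> S" and \<phi>0: "\<And>z. z \<in> S - K \<Longrightarrow> \<phi> z = 0" and c: "continuous_on S \<phi>"
    using C0_infE[OF \<phi> S] by metis
  have "compact (\<phi> ` K)" using K c by (intro compact_continuous_image continuous_on_subset[OF c])
  then obtain B where B: "\<forall>y\<in>\<phi> ` K. norm y \<le> B" using compact_imp_bounded bounded_iff by blast
  have "integrable (lebesgue_on S) (\<lambda>z. B * \<bar>indicator K z *\<^sub>R w z\<bar>)"
    using Lp_locally_integrable[OF p w _ K(1)] S by (intro integrable_mult_right integrable_abs) auto
  then show ?thesis
  proof (rule Bochner_Integration.integrable_bound)
    have "\<phi> \<in> borel_measurable (lebesgue_on S)"
      using c S by (intro continuous_imp_measurable_on_sets_lebesgue) auto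
    then show "(\<lambda>z. w z * \<phi> z) \<in> borel_measurable (lebesgue_on S)"
      using w by (intro borel_measurable_times) (auto simp: Lp_def)
    have "\<bar>w z * \<phi> z\<bar> \<le> B * \<bar>indicator K z *\<^sub>R w z\<bar>" if "z \<in> S" for z
      using \<phi>0[of z] B that mult_left_mono[of "\<bar>\<phi> z\<bar>" B "\<bar>w z\<bar>"]
      by (cases "z \<in> K") (auto simp: abs_mult mult.commute)
    then show "AE z in lebesgue_on S. norm (w z * \<phi> z) \<le> norm (B * \<bar>indicator K z *\<^sub>R w z\<bar>)"
      by (intro AE_I2) fastforce
  qed
qed

lemma Lp_component:
  fixes w :: "'a::euclidean_space \<Rightarrow> real ^ 'd::finite"
  assumes p: "0 \<le> p" and w: "w \<in> Lp p S"
  shows "(\<lambda>z. w z $ i) \<in> Lp p S"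
proof -
  have m: "w \<in> borel_measurable (lebesgue_on S)" and i: "integrable (lebesgue_on S) (\<lambda>z. norm (w z) powr p)"
    using w by (auto simp: Lp_def)
  have mi: "(\<lambda>z. w z $ i) \<in> borel_measurable (lebesgue_on S)"
    by (rule borel_measurable_continuous_on[OF _ m]) (intro continuous_on_component continuous_on_id)
  have "integrable (lebesgue_on S) (\<lambda>z. norm (w z $ i) powr p)"
    using i
  proof (rule Bochner_Integration.integrable_bound)
    show "(\<lambda>z. norm (w z $ i) powr p) \<in> borel_measurable (lebesgue_on S)" using mi by measurable
    show "AE z in lebesgue_on S. norm (norm (w z $ i) powr p) \<le> norm (norm (w z) powr p)"
      using p component_le_norm_cart[of "w _" i] by (intro AE_I2) (auto intro!: powr_mono2)
  qed
  with mi show ?thesis by (simp add: Lp_def)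
qed

lemma Lp_norm_cong_AE:
  assumes "f \<in> Lp p S" "g \<in> Lp p S" "AE z in lebesgue_on S. f z = g z"
  shows "Lp_norm p S f = Lp_norm p S g"
proof -
  have "(LINT z|lebesgue_on S. norm (f z) powr p) = (LINT z|lebesgue_on S. norm (g z) powr p)"
  proof (rule integral_cong_AE)
    show "AE z in lebesgue_on S. norm (f z) powr p = norm (g z) powr p"
      using assms(3) by eventually_elim simp
  qed (use assms in \<open>auto simp: Lp_def\<close>)
  then show ?thesis by (simp add: Lp_norm_def)
qed

text \<open>Componentwise, the difference of two gradients is locally integrable, since p >= 1, and
  orthogonal to all test functions.\<close>

lemma weak_grad_unique:
  fixes u :: "'d::finite spacetime \<Rightarrow> real"
  assumes p: "1 \<le> p" and \<Omega>: "open \<Omega>"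
    and w: "w \<in> Lp p (cyl T \<Omega>)" "is_weak_grad T \<Omega> u w"
    and w': "w' \<in> Lp p (cyl T \<Omega>)" "is_weak_grad T \<Omega> u w'"
  shows "AE z in lebesgue_on (cyl T \<Omega>). w z = w' z"
proof -
  let ?S = "cyl T \<Omega>"
  have S: "open ?S" using \<Omega> by (rule open_cyl)
  have "AE z in lebesgue_on ?S. w z $ i - w' z $ i = 0" for i
  proof (rule fundamental_lemma[OF S])
    have wi: "(\<lambda>z. w z $ i) \<in> Lp p ?S" and wi': "(\<lambda>z. w' z $ i) \<in> Lp p ?S"
      by (rule Lp_component[OF _ w(1)], use p in simp) (rule Lp_component[OF _ w'(1)], use p in simp)
    show "integrable (lebesgue_on ?S) (\<lambda>z. indicator K z * (w z $ i - w' z $ i))" if "compact K" for K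
    proof -
      have L: "?S \<in> sets lebesgue" using S by simp
      have "integrable (lebesgue_on ?S) (\<lambda>z. indicator K z *\<^sub>R (w z $ i) - indicator K z *\<^sub>R (w' z $ i))"
        by (rule Bochner_Integration.integrable_diff[OF Lp_locally_integrable[OF p wi L that] Lp_locally_integrable[OF p wi' L that]])
      then show ?thesis by (simp only: real_scaleR_def right_diff_distrib)
    qed
    fix \<phi> assume \<phi>: "\<phi> \<in> C0_inf ?S"
    have "(LINT z|lebesgue_on ?S. w z $ i * \<phi> z) = (LINT z|lebesgue_on ?S. w' z $ i * \<phi> z)"
      using w(2) w'(2) \<phi> unfolding is_weak_grad_def by simp
    then show "(LINT z|lebesgue_on ?S. (w z $ i - w' z $ i) * \<phi> z) = 0"
      by (simp add: left_diff_distrib Bochner_Integration.integral_diff[OF integrable_Lp_mult_C0_inf[OF S wi p \<phi>] integrable_Lp_mult_C0_inf[OF S wi' p \<phi>]])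
  qed
  then have "AE z in lebesgue_on ?S. \<forall>i\<in>UNIV. w z $ i - w' z $ i = 0"
    by (intro AE_ball_countable') (auto intro: uncountable_infinite)
  then show ?thesis by eventually_elim (simp add: vec_eq_iff)
qed

lemma Lp_norm_nonneg: "0 \<le> Lp_norm p S f"
  by (simp add: Lp_norm_def)

text \<open>One function \<open>vt\<close> is both the t-derivative of v and the k-derivative of g,
  so two integrations by parts move the derivative from time to space. For the counterexample a
  vector field with the single component k suffices.\<close>

lemma classical_H1:
  fixes v g vt :: "'d::finite spacetime \<Rightarrow> real" and w :: "'d spacetime \<Rightarrow> real ^ 'd"
  assumes \<Omega>: "open \<Omega>"
    and c: "continuous_on (cyl T \<Omega>) v" "continuous_on (cyl T \<Omega>) w" "continuous_on (cyl T \<Omega>) vt" "continuous_on (cyl T \<Omega>) g"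
    and Dx: "\<And>z i. z \<in> cyl T \<Omega> \<Longrightarrow> ((\<lambda>s. v (z + s *\<^sub>R (0, axis i 1))) has_real_derivative w z $ i) (at 0)"
    and Dt: "\<And>z. z \<in> cyl T \<Omega> \<Longrightarrow> ((\<lambda>s. v (z + s *\<^sub>R (1, 0))) has_real_derivative vt z) (at 0)"
    and Dg: "\<And>z. z \<in> cyl T \<Omega> \<Longrightarrow> ((\<lambda>s. g (z + s *\<^sub>R (0, axis k 1))) has_real_derivative vt z) (at 0)"
  shows "is_weak_grad T \<Omega> v w"
    and "dt_eq_div T \<Omega> v (\<lambda>z. axis k (g z)) (\<lambda>_. 0)"
proof -
  let ?S = "cyl T \<Omega>"
  have S: "open ?S" using \<Omega> by (rule open_cyl)
  show "is_weak_grad T \<Omega> v w"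
    unfolding is_weak_grad_def dx_def
    by (intro ballI allI integration_by_parts[OF S] c Dx continuous_on_component)
  have "- (LINT z|lebesgue_on ?S. v z * dt \<phi> z) =
      (LINT z|lebesgue_on ?S. - (\<Sum>i\<in>UNIV. axis k (g z) $ i * dx i \<phi> z) + 0 * \<phi> z)"
    if \<phi>: "\<phi> \<in> C0_inf ?S" for \<phi>
  proof -
    have "- (LINT z|lebesgue_on ?S. v z * dt \<phi> z) = (LINT z|lebesgue_on ?S. vt z * \<phi> z)"
      unfolding dt_def using integration_by_parts[OF S \<phi> c(1,3) Dt] by simp
    also have "\<dots> = - (LINT z|lebesgue_on ?S. g z * dx k \<phi> z)"
      unfolding dx_def using integration_by_parts[OF S \<phi> c(4,3) Dg] by simp
    also have "\<dots> = (LINT z|lebesgue_on ?S. - (\<Sum>i\<in>UNIV. axis k (g z) $ i * dx i \<phi> z) + 0 * \<phi> z)"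
      by (simp add: axis_def if_distrib[of "\<lambda>x. x * _"] cong: if_cong)
    finally show ?thesis .
  qed
  then show "dt_eq_div T \<Omega> v (\<lambda>z. axis k (g z)) (\<lambda>_. 0)"
    unfolding dt_eq_div_def by blast
qed

text \<open>The infimum over representations is at most the value of the one at hand, and the
  gradient chosen by \<open>weak_grad\<close> has the norm of w by uniqueness.\<close>

lemma H1_norm_le:
  fixes v :: "'d::finite spacetime \<Rightarrow> real"
  assumes p: "1 \<le> p" and \<Omega>: "open \<Omega>"
    and v: "v \<in> Lp p (cyl T \<Omega>)" and w: "w \<in> Lp p (cyl T \<Omega>)" "is_weak_grad T \<Omega> v w"
    and g: "g \<in> Lp p (cyl T \<Omega>)" "dt_eq_div T \<Omega> v (\<lambda>z. axis k (g z)) (\<lambda>_. 0)"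
  shows "v \<in> H1 p T \<Omega>"
    and "H1_norm p T \<Omega> v \<le> Lp_norm p (cyl T \<Omega>) v + Lp_norm p (cyl T \<Omega>) w + Lp_norm p (cyl T \<Omega>) g"
proof -
  let ?S = "cyl T \<Omega>"
  have ax: "axis k (r::real) = r *\<^sub>R axis k 1" for r by (simp add: vec_eq_iff axis_def)
  have n: "norm (axis k r :: real ^ 'd) = norm r" for r :: real by (simp add: ax[of r] norm_axis_1)
  have G: "(\<lambda>z. axis k (g z)) \<in> Lp p ?S"
    using g(1) by (auto simp: Lp_def n ax[of "g _"])
  have "(\<lambda>_. 0 :: real) \<in> Lp p ?S" by (simp add: Lp_def)
  then have ex: "dt_in_Hm1 p T \<Omega> v" using G g(2) unfolding dt_in_Hm1_def by blast
  show "v \<in> H1 p T \<Omega>" using ex v w by (auto simp: H1_def W10_def)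
  have "dt_Hm1_norm p T \<Omega> v \<le> Lp_norm p ?S (\<lambda>z. axis k (g z) :: real ^ 'd) + Lp_norm p ?S (\<lambda>_. 0 :: real)"
    unfolding dt_Hm1_norm_def
  proof (rule cInf_lower)
    show "bdd_below {Lp_norm p ?S g + Lp_norm p ?S f |g f. g \<in> Lp p ?S \<and> f \<in> Lp p ?S \<and> dt_eq_div T \<Omega> v g f}"
      by (rule bdd_belowI[of _ 0]) (auto intro!: add_nonneg_nonneg Lp_norm_nonneg)
  qed (use G g(2) \<open>(\<lambda>_. 0) \<in> Lp p ?S\<close> in blast)
  also have "\<dots> = Lp_norm p ?S g" by (simp add: Lp_norm_def n)
  finally have 1: "dt_Hm1_norm p T \<Omega> v \<le> Lp_norm p ?S g" .
  have "weak_grad p T \<Omega> v \<in> Lp p ?S \<and> is_weak_grad T \<Omega> v (weak_grad p T \<Omega> v)"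
    unfolding weak_grad_def by (rule someI[of _ w]) (use w in blast)
  then have "Lp_norm p ?S (weak_grad p T \<Omega> v) = Lp_norm p ?S w"
    using weak_grad_unique[OF p \<Omega>] w by (intro Lp_norm_cong_AE) auto
  with 1 show "H1_norm p T \<Omega> v \<le> Lp_norm p ?S v + Lp_norm p ?S w + Lp_norm p ?S g"
    by (simp add: H1_norm_def W10_norm_def)
qed

section \<open>The counterexample\<close>

text \<open>Equal to 1 for |y| <= 1 and to 0 for |y| >= 2.\<close>

definition plateau :: "real \<Rightarrow> real" where
  "plateau y = smooth_step (2 - y) * smooth_step (y + 2)"

definition dplateau :: "real \<Rightarrow> real" where
  "dplateau y = smooth_step (2 - y) * step1 (y + 2) - step1 (2 - y) * smooth_step (y + 2)"

text \<open>Equal to 1 for t <= 1/2 and to 0 for t >= 1. It confines the construction to bounded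
  times when T is large or infinite.\<close>

definition tcut :: "real \<Rightarrow> real" where
  "tcut t = smooth_step (2 - 2 * t)"

definition zeta :: "'d \<Rightarrow> real ^ 'd::finite \<Rightarrow> real" where
  "zeta k x = (\<Prod>j\<in>UNIV - {k}. plateau (x $ j))"

definition dzeta :: "'d \<Rightarrow> 'd \<Rightarrow> real ^ 'd::finite \<Rightarrow> real" where
  "dzeta k i x = dplateau (x $ i) * (\<Prod>j\<in>UNIV - {k} - {i}. plateau (x $ j))"

abbreviation isq :: "real \<Rightarrow> real" where
  "isq t \<equiv> t powr (- (1 / 2))"

text \<open>For \<open>t > 0\<close> and \<open>V (t, x) = t powr \<beta> * tcut t * smooth_step (2 - x $ k / sqrt t) * zeta k x\<close> the function
  below is \<open>- D\<^sub>k V\<close> and \<open>flux\<close> is \<open>- V\<^sub>t\<close>, so that the time derivative of the one is \<open>D\<^sub>k\<close> of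
  the other.\<close>

definition cex :: "real \<Rightarrow> 'd \<Rightarrow> 'd::finite spacetime \<Rightarrow> real" where
  "cex \<beta> k z = fst z powr \<beta> * isq (fst z) * tcut (fst z) * step1 (2 - snd z $ k * isq (fst z)) * zeta k (snd z)"

definition cex_grad :: "real \<Rightarrow> 'd \<Rightarrow> 'd::finite spacetime \<Rightarrow> real ^ 'd" where
  "cex_grad \<beta> k z = (\<chi> i. if i = k
     then - (fst z powr \<beta> * (isq (fst z))\<^sup>2 * tcut (fst z) * step2 (2 - snd z $ k * isq (fst z)) * zeta k (snd z))
     else fst z powr \<beta> * isq (fst z) * tcut (fst z) * step1 (2 - snd z $ k * isq (fst z)) * dzeta k i (snd z))"

definition flux :: "real \<Rightarrow> 'd \<Rightarrow> 'd::finite spacetime \<Rightarrow> real" where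
  "flux \<beta> k z = - ((\<beta> * fst z powr \<beta> * (isq (fst z))\<^sup>2 * tcut (fst z) - fst z powr \<beta> * 2 * step1 (2 - 2 * fst z))
       * smooth_step (2 - snd z $ k * isq (fst z))
     + fst z powr \<beta> * tcut (fst z) * step1 (2 - snd z $ k * isq (fst z)) * (snd z $ k * isq (fst z) * (isq (fst z))\<^sup>2 / 2))
     * zeta k (snd z)"

text \<open>The common value - D_k V_t of u_t and D_k \<open>flux\<close>.\<close>

definition cex_dt :: "real \<Rightarrow> 'd \<Rightarrow> 'd::finite spacetime \<Rightarrow> real" where
  "cex_dt \<beta> k z = (((\<beta> - 1 / 2) * fst z powr \<beta> * (isq (fst z)) ^ 3 * tcut (fst z)
       - fst z powr \<beta> * isq (fst z) * 2 * step1 (2 - 2 * fst z)) * step1 (2 - snd z $ k * isq (fst z))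
     + fst z powr \<beta> * isq (fst z) * tcut (fst z) * step2 (2 - snd z $ k * isq (fst z)) * (snd z $ k * (isq (fst z)) ^ 3 / 2))
     * zeta k (snd z)"

section \<open>Derivatives\<close>

lemma step_DERIV_chain:
  assumes "(h has_real_derivative D) (at s)"
  shows "((\<lambda>s. smooth_step (h s)) has_real_derivative step1 (h s) * D) (at s)"
    and "((\<lambda>s. step1 (h s)) has_real_derivative step2 (h s) * D) (at s)"
  by (rule DERIV_chain2[OF smooth_step_DERIV assms], rule DERIV_chain2[OF step1_DERIV assms])

lemma DERIV_tcut: "(tcut has_real_derivative - 2 * step1 (2 - 2 * t)) (at t)"
  unfolding tcut_def[abs_def]
  by (rule DERIV_cong[OF DERIV_chain2[OF smooth_step_DERIV, where Db="-2"]])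
    (auto intro!: derivative_eq_intros)

lemma DERIV_plateau: "(plateau has_real_derivative dplateau y) (at y)"
proof -
  have "((\<lambda>y. 2 - y) has_real_derivative - 1) (at y)" "((\<lambda>y. y + 2) has_real_derivative 1) (at y)"
    by (auto intro!: derivative_eq_intros)
  note h = this[THEN step_DERIV_chain(1)]
  from DERIV_mult[OF h] show ?thesis
    unfolding plateau_def[abs_def] dplateau_def by (simp add: algebra_simps)
qed

lemma isq_sq: "0 < t \<Longrightarrow> (isq t)\<^sup>2 = t powr (- 1)"
  by (simp add: powr_power)

lemma powr_minus_1_eq_isq: "0 < t \<Longrightarrow> t powr (a - 1) = t powr a * (isq t)\<^sup>2"
  unfolding isq_sq powr_add[symmetric] by simp

lemma DERIV_powr_isq: "0 < t \<Longrightarrow> ((\<lambda>t. t powr a) has_real_derivative a * t powr a * (isq t)\<^sup>2) (at t)"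
  using powr_minus_1_eq_isq[of t a] by (auto intro!: derivative_eq_intros simp: field_simps)

lemma DERIV_isq: "0 < t \<Longrightarrow> (isq has_real_derivative (- ((isq t) ^ 3 / 2))) (at t)"
  using DERIV_powr_isq[of t "- (1 / 2)"] by (simp add: power3_eq_cube power2_eq_square mult.assoc)

lemma zeta_shift: "zeta k (x + s *\<^sub>R axis k 1) = zeta k x"
  unfolding zeta_def by (rule prod.cong) (auto simp: axis_def)

lemma DERIV_zeta:
  assumes "i \<noteq> k"
  shows "((\<lambda>s. zeta k (x + s *\<^sub>R axis i 1)) has_real_derivative dzeta k i x) (at 0)"
proof -
  have "zeta k (x + s *\<^sub>R axis i 1) = plateau (x $ i + s) * (\<Prod>j\<in>UNIV - {k} - {i}. plateau (x $ j))" for s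
  proof -
    have "zeta k (x + s *\<^sub>R axis i 1) = plateau ((x + s *\<^sub>R axis i 1) $ i) *
        (\<Prod>j\<in>UNIV - {k} - {i}. plateau ((x + s *\<^sub>R axis i 1) $ j))"
      unfolding zeta_def by (rule prod.remove) (use assms in auto)
    also have "(\<Prod>j\<in>UNIV - {k} - {i}. plateau ((x + s *\<^sub>R axis i 1) $ j)) = (\<Prod>j\<in>UNIV - {k} - {i}. plateau (x $ j))"
      by (rule prod.cong) (auto simp: axis_def)
    finally show ?thesis by simp
  qed
  moreover have "((\<lambda>s. plateau (x $ i + s)) has_real_derivative dplateau (x $ i)) (at 0)"
    using DERIV_plateau[of "x $ i"] DERIV_shift[of plateau _ 0 "x $ i"] by (simp add: add.commute)
  ultimately show ?thesis
    unfolding dzeta_def by (simp add: DERIV_cmult_right)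
qed

lemma cex_DERIV_x:
  "((\<lambda>s. cex \<beta> k (z + s *\<^sub>R (0, axis i 1))) has_real_derivative cex_grad \<beta> k z $ i) (at 0)"
proof (cases "i = k")
  case True
  obtain t x where z: "z = (t, x)" by (cases z)
  have "((\<lambda>s. step1 (2 - (x $ k + s) * isq t)) has_real_derivative
      step2 (2 - (x $ k + 0) * isq t) * (- isq t)) (at 0)"
    by (rule step_DERIV_chain) (auto intro!: derivative_eq_intros)
  then have "((\<lambda>s. t powr \<beta> * isq t * tcut t * step1 (2 - (x $ k + s) * isq t) * zeta k x) has_real_derivative
      t powr \<beta> * isq t * tcut t * (step2 (2 - (x $ k + 0) * isq t) * (- isq t)) * zeta k x) (at 0)"
    by (intro DERIV_cmult DERIV_cmult_right)
  then show ?thesis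
    using True by (simp add: z cex_def cex_grad_def zeta_shift power2_eq_square algebra_simps)
next
  case False
  obtain t x where z: "z = (t, x)" by (cases z)
  have "axis i (1::real) $ k = 0" using False by (simp add: axis_def)
  then show ?thesis
    using DERIV_cmult[OF DERIV_zeta[OF False, of x], of "t powr \<beta> * isq t * tcut t * step1 (2 - x $ k * isq t)"] False
    by (simp add: z cex_def cex_grad_def)
qed

lemma cex_DERIV_t:
  assumes "0 < fst z"
  shows "((\<lambda>s. cex \<beta> k (z + s *\<^sub>R (1, 0))) has_real_derivative cex_dt \<beta> k z) (at 0)"
proof -
  obtain t x where z: "z = (t, x)" by (cases z)
  have t: "0 < t" using assms z by simp
  have "((\<lambda>t. 2 - x $ k * isq t) has_real_derivative x $ k * ((isq t) ^ 3 / 2)) (at t)"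
    by (rule DERIV_cong[OF DERIV_diff[OF DERIV_const DERIV_cmult[OF DERIV_isq[OF t]]]]) simp
  note D = step_DERIV_chain(2)[OF this]
  have "((\<lambda>t. t powr \<beta> * isq t * tcut t * step1 (2 - x $ k * isq t) * zeta k x) has_real_derivative cex_dt \<beta> k z) (at t)"
    by (rule DERIV_cong[OF DERIV_cmult_right[OF DERIV_mult[OF DERIV_mult[OF DERIV_mult[OF DERIV_powr_isq[OF t] DERIV_isq[OF t]] DERIV_tcut] D]]])
      (simp add: z cex_dt_def power2_eq_square power3_eq_cube algebra_simps)
  then have "((\<lambda>s. cex \<beta> k (s, x)) has_real_derivative cex_dt \<beta> k z) (at t)"
    by (simp add: cex_def)
  then show ?thesis using DERIV_shift[of "\<lambda>s. cex \<beta> k (s, x)" _ 0 t] by (simp add: z add.commute)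
qed

lemma flux_DERIV:
  "((\<lambda>s. flux \<beta> k (z + s *\<^sub>R (0, axis k 1))) has_real_derivative cex_dt \<beta> k z) (at 0)"
proof -
  obtain t x where z: "z = (t, x)" by (cases z)
  let ?q = "isq t" and ?P = "t powr \<beta>"
  have h: "((\<lambda>r. 2 - r * ?q) has_real_derivative - ?q) (at (x $ k))"
    by (auto intro!: derivative_eq_intros)
  note D = step_DERIV_chain[OF h]
  have l: "((\<lambda>r. r * ?q * ?q\<^sup>2 / 2) has_real_derivative ?q * ?q\<^sup>2 / 2) (at (x $ k))"
    by (auto intro!: derivative_eq_intros)
  have "((\<lambda>r. - ((\<beta> * ?P * ?q\<^sup>2 * tcut t - ?P * 2 * step1 (2 - 2 * t)) * smooth_step (2 - r * ?q)
      + ?P * tcut t * step1 (2 - r * ?q) * (r * ?q * ?q\<^sup>2 / 2)) * zeta k x) has_real_derivative cex_dt \<beta> k z) (at (x $ k))"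
    by (rule DERIV_cong[OF DERIV_cmult_right[OF DERIV_minus[OF DERIV_add[OF DERIV_cmult[OF D(1)] DERIV_mult[OF DERIV_cmult[OF D(2)] l]]]]])
      (simp add: z cex_dt_def power2_eq_square power3_eq_cube algebra_simps)
  then have "((\<lambda>r. flux \<beta> k (t, x + (r - x $ k) *\<^sub>R axis k 1)) has_real_derivative cex_dt \<beta> k z) (at (0 + x $ k))"
    by (simp add: flux_def zeta_shift)
  then show ?thesis
    unfolding DERIV_shift by (simp add: z)
qed

section \<open>Continuity and support\<close>

lemma step_continuous_compose:
  assumes "continuous_on S h"
  shows "continuous_on S (\<lambda>z. smooth_step (h z))" "continuous_on S (\<lambda>z. step1 (h z))" "continuous_on S (\<lambda>z. step2 (h z))"
  by (rule continuous_on_compose2[OF step_continuous(1) assms], simp)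
    (rule continuous_on_compose2[OF step_continuous(2) assms], simp,
      rule continuous_on_compose2[OF step_continuous(3) assms], simp)

lemma cex_continuous:
  fixes k :: "'d::finite"
  defines "S \<equiv> {z :: 'd spacetime. 0 < fst z}"
  shows "continuous_on S (cex \<beta> k)" "continuous_on S (cex_grad \<beta> k)" "continuous_on S (cex_dt \<beta> k)" "continuous_on S (flux \<beta> k)"
proof -
  have p: "continuous_on S (\<lambda>z. fst z powr a)" for a
    unfolding S_def by (intro continuous_on_powr continuous_intros) auto
  have z: "continuous_on S (\<lambda>z. zeta k (snd z))" "continuous_on S (\<lambda>z. dzeta k i (snd z))" for i
    unfolding zeta_def dzeta_def plateau_def dplateau_def
    by (intro continuous_intros step_continuous_compose)+
  have h: "continuous_on S (\<lambda>z. h z / 2)" if "continuous_on S h" for h :: "'d spacetime \<Rightarrow> real"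
    using that by (intro continuous_on_divide continuous_on_const) auto
  note c = continuous_on_add continuous_on_diff continuous_on_mult continuous_on_minus continuous_on_const
    continuous_on_power continuous_on_fst continuous_on_snd continuous_on_id continuous_on_component
    step_continuous_compose p z h
  show "continuous_on S (cex \<beta> k)" unfolding cex_def[abs_def] tcut_def by (intro c)
  show "continuous_on S (cex_dt \<beta> k)" unfolding cex_dt_def[abs_def] tcut_def by (intro c)
  show "continuous_on S (flux \<beta> k)" unfolding flux_def[abs_def] tcut_def by (intro c)
  show "continuous_on S (cex_grad \<beta> k)" unfolding cex_grad_def[abs_def] tcut_def
  proof (rule continuous_on_vec_lambda)
    fix i show "continuous_on S (\<lambda>z. if i = k
     then - (fst z powr \<beta> * (isq (fst z))\<^sup>2 * smooth_step (2 - 2 * fst z) * step2 (2 - snd z $ k * isq (fst z)) * zeta k (snd z))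
     else fst z powr \<beta> * isq (fst z) * smooth_step (2 - 2 * fst z) * step1 (2 - snd z $ k * isq (fst z)) * dzeta k i (snd z))"
      by (cases "i = k") (simp_all, (intro c)+)
  qed
qed

text \<open>The parabolic layer, cut by \<open>tcut\<close> and \<open>zeta\<close>, that carries u,
  its gradient and the flux inside the half-space. For x_k <= 0 the flux need not vanish; hence the
  condition \<open>0 < x $ k\<close> in \<open>outside_region\<close>.\<close>

definition region :: "'d \<Rightarrow> 'd::finite spacetime set" where
  "region k = {(t, x). 0 < t \<and> t < 1 \<and> 0 < x $ k \<and> x $ k * isq t < 2 \<and> (\<forall>j. j \<noteq> k \<longrightarrow> \<bar>x $ j\<bar> < 2)}"

lemma plateau_eq_0: "2 \<le> \<bar>y\<bar> \<Longrightarrow> plateau y = 0" and dplateau_eq_0: "2 \<le> \<bar>y\<bar> \<Longrightarrow> dplateau y = 0"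
proof -
  assume "2 \<le> \<bar>y\<bar>"
  then consider "2 - y \<le> 0" | "y + 2 \<le> 0" by linarith
  then have "plateau y = 0 \<and> dplateau y = 0"
    by cases (auto simp: plateau_def dplateau_def smooth_step_eq_0 step1_eq_0)
  then show "plateau y = 0" "dplateau y = 0" by auto
qed

lemma plateau_nonneg: "0 \<le> plateau y" and plateau_le_1: "plateau y \<le> 1"
  by (auto simp: plateau_def intro!: mult_nonneg_nonneg mult_le_one smooth_step_nonneg smooth_step_le_1)

lemma zeta_eq_0: "j \<noteq> k \<Longrightarrow> 2 \<le> \<bar>x $ j\<bar> \<Longrightarrow> zeta k x = 0"
  unfolding zeta_def by (rule prod_zero) (auto intro!: bexI[of _ j] plateau_eq_0)

lemma dzeta_eq_0: "j \<noteq> k \<Longrightarrow> 2 \<le> \<bar>x $ j\<bar> \<Longrightarrow> dzeta k i x = 0"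
  unfolding dzeta_def by (cases "j = i") (auto intro!: bexI[of _ j] prod_zero plateau_eq_0 dplateau_eq_0)

lemma zeta_nonneg: "0 \<le> zeta k x" and zeta_le_1: "zeta k x \<le> 1"
  unfolding zeta_def by (auto intro!: prod_nonneg prod_le_1 plateau_nonneg plateau_le_1)

lemma tcut_eq_0: "1 \<le> t \<Longrightarrow> tcut t = 0" and step1_tcut_eq_0: "1 \<le> t \<Longrightarrow> step1 (2 - 2 * t) = 0"
  by (simp_all add: tcut_def smooth_step_eq_0 step1_eq_0)

lemma step_eq_0_le: "x \<le> 0 \<Longrightarrow> step1 x = 0" "x \<le> 0 \<Longrightarrow> step2 x = 0" "1 \<le> x \<Longrightarrow> step1 x = 0" "1 \<le> x \<Longrightarrow> step2 x = 0"
  by (auto intro!: step1_eq_0 step2_eq_0)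

text \<open>H is constant on the half-line up to 1, so D_k V and its gradient are 0 for x_k <= 0.
  Thus u is its own zero extension.\<close>

lemma cex_eq_0: "z $ k \<le> 0 \<Longrightarrow> cex \<beta> k (t, z) = 0" and cex_grad_eq_0: "z $ k \<le> 0 \<Longrightarrow> cex_grad \<beta> k (t, z) = 0"
proof -
  assume "z $ k \<le> 0"
  then have "z $ k * isq t \<le> 0" by (intro mult_nonpos_nonneg) auto
  then have "1 \<le> 2 - z $ k * isq t" by simp
  from step_eq_0_le(3,4)[OF this] show "cex \<beta> k (t, z) = 0" "cex_grad \<beta> k (t, z) = 0"
    by (auto simp: cex_def cex_grad_def vec_eq_iff)
qed

lemma outside_region:
  assumes "(t, x) \<notin> region k" "0 < t" "0 < x $ k"
  shows "cex \<beta> k (t, x) = 0" "cex_grad \<beta> k (t, x) = 0" "flux \<beta> k (t, x) = 0"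
proof -
  consider "1 \<le> t" | "2 - x $ k * isq t \<le> 0" | j where "j \<noteq> k" "2 \<le> \<bar>x $ j\<bar>"
    using assms by (force simp: region_def not_less)
  then have "cex \<beta> k (t, x) = 0 \<and> cex_grad \<beta> k (t, x) = 0 \<and> flux \<beta> k (t, x) = 0"
  proof cases
    case 1
    from tcut_eq_0[OF this] step1_tcut_eq_0[OF this] show ?thesis
      by (simp add: cex_def cex_grad_def flux_def vec_eq_iff)
  next
    case 2
    from step_eq_0_le(1,2)[OF this] smooth_step_eq_0[OF this] show ?thesis
      by (simp add: cex_def cex_grad_def flux_def vec_eq_iff)
  next
    case 3
    from zeta_eq_0[OF this] dzeta_eq_0[OF this] show ?thesis
      by (simp add: cex_def cex_grad_def flux_def vec_eq_iff)
  qed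
  then show "cex \<beta> k (t, x) = 0" "cex_grad \<beta> k (t, x) = 0" "flux \<beta> k (t, x) = 0" by auto
qed

section \<open>Size estimates\<close>

lemma isq_ge_1: "0 < t \<Longrightarrow> t < 1 \<Longrightarrow> 1 \<le> isq t"
  using powr_mono2'[of "- (1/2)" t 1] by simp

text \<open>For 0 < t < 1 the powers of t^(-1/2) that occur are at most t^(-1), and y = x_k / sqrt t
  is at most 2 on the layer. So one power t^(\<beta> - 1) controls all three quantities.\<close>

lemma region_bounds:
  fixes \<beta> :: real and k :: "'d::finite"
  obtains C where "0 < C" "\<And>z. z \<in> region k \<Longrightarrow> \<bar>cex \<beta> k z\<bar> \<le> C * fst z powr (\<beta> - 1)"
    "\<And>z. z \<in> region k \<Longrightarrow> norm (cex_grad \<beta> k z) \<le> C * fst z powr (\<beta> - 1)"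
    "\<And>z. z \<in> region k \<Longrightarrow> \<bar>flux \<beta> k z\<bar> \<le> C * fst z powr (\<beta> - 1)"
proof -
  obtain C1 where C1: "C1 > 0" "\<And>x. \<bar>step1 x\<bar> \<le> C1"
    using bounded_if_eq_0[OF step_continuous(2) step1_eq_0] by metis
  obtain C2 where C2: "C2 > 0" "\<And>x. \<bar>step2 x\<bar> \<le> C2"
    using bounded_if_eq_0[OF step_continuous(3) step2_eq_0] by metis
  have s1: "\<bar>smooth_step x\<bar> \<le> 1" for x
    using smooth_step_nonneg[of x] smooth_step_le_1[of x] by simp
  have dpl: "\<bar>dplateau y\<bar> \<le> 2 * C1" for y
  proof -
    have "\<bar>dplateau y\<bar> \<le> \<bar>smooth_step (2 - y)\<bar> * \<bar>step1 (y + 2)\<bar> + \<bar>step1 (2 - y)\<bar> * \<bar>smooth_step (y + 2)\<bar>"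
      unfolding dplateau_def by (metis abs_mult abs_triangle_ineq4)
    also have "\<dots> \<le> 1 * C1 + C1 * 1"
      using C1 s1 by (intro add_mono mult_mono) auto
    finally show ?thesis by simp
  qed
  have dz: "\<bar>dzeta k i x\<bar> \<le> 2 * C1" for i x
  proof -
    have "\<bar>\<Prod>j\<in>UNIV - {k} - {i}. plateau (x $ j)\<bar> \<le> 1"
      using plateau_nonneg plateau_le_1 by (simp add: abs_prod prod_le_1)
    then have "\<bar>dzeta k i x\<bar> \<le> (2 * C1) * 1"
      unfolding dzeta_def abs_mult using dpl C1 by (intro mult_mono) auto
    then show ?thesis by simp
  qed
  have z1: "\<bar>zeta k x\<bar> \<le> 1" for x using zeta_nonneg[of k x] zeta_le_1[of k x] by simp
  have t1: "\<bar>tcut t\<bar> \<le> 1" for t using s1 by (simp add: tcut_def)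
  define M where "M = max C1 (max C2 (2 * C1 * C1))"
  have M: "C1 \<le> M" "C2 \<le> M" "C1 * (2 * C1) \<le> M" "0 < M" using C1 by (auto simp: M_def)
  \<comment> \<open>The factor \<open>CARD('d)\<close> comes from bounding the Euclidean norm by the
    sum of the components; |\<beta>| + 3 * C1 adds up the bounds of the three terms a, b, c of the
    flux below.\<close>
  define C where "C = (real CARD('d) * M + \<bar>\<beta>\<bar> + 3 * C1)"
  have C: "M \<le> C" "real CARD('d) * M \<le> C" "\<bar>\<beta>\<bar> + 3 * C1 \<le> C" "0 < C"
  proof -
    have "M \<le> real CARD('d) * M" using M by (simp add: Suc_leI)
    then show "M \<le> C" "real CARD('d) * M \<le> C" "\<bar>\<beta>\<bar> + 3 * C1 \<le> C" "0 < C"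
      unfolding C_def using M C1 by linarith+
  qed
  have main: "\<bar>cex \<beta> k z\<bar> \<le> C * fst z powr (\<beta> - 1) \<and> norm (cex_grad \<beta> k z) \<le> C * fst z powr (\<beta> - 1) \<and>
      \<bar>flux \<beta> k z\<bar> \<le> C * fst z powr (\<beta> - 1)" if "z \<in> region k" for z
  proof -
    obtain t x where z: "z = (t, x)" by (cases z)
    define P where "P = t powr \<beta>"
    define q where "q = isq t"
    define y where "y = x $ k * q"
    have t: "0 < t" "t < 1" and y: "0 \<le> y" "y \<le> 2"
      using that by (auto simp: z region_def y_def q_def)
    have P: "0 \<le> P" by (simp add: P_def)
    have q: "1 \<le> q" using isq_ge_1[OF t] by (simp add: q_def)
    then have qq: "1 \<le> q\<^sup>2" "q \<le> q\<^sup>2" using mult_mono[of 1 q 1 q] mult_left_mono[of 1 q q] by (auto simp: power2_eq_square)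
    have Q: "t powr (\<beta> - 1) = P * q\<^sup>2" using powr_minus_1_eq_isq[OF t(1)] by (simp add: P_def q_def)
    have PQ: "0 \<le> P * q\<^sup>2" "P * q \<le> P * q\<^sup>2" "P \<le> P * q\<^sup>2"
      using P qq mult_left_mono[OF qq(2) P] mult_left_mono[OF qq(1) P] by auto
    have "\<bar>cex \<beta> k z\<bar> = P * q * (\<bar>tcut t\<bar> * (\<bar>step1 (2 - y)\<bar> * \<bar>zeta k x\<bar>))"
      using P q by (simp add: z cex_def abs_mult P_def q_def y_def)
    also have "\<dots> \<le> (P * q\<^sup>2) * (1 * (C1 * 1))"
      using P q qq PQ t1 C1 z1 by (intro mult_mono mult_nonneg_nonneg) auto
    also have "\<dots> \<le> P * q\<^sup>2 * C" using PQ C M by (intro mult_left_mono) auto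
    finally have 1: "\<bar>cex \<beta> k z\<bar> \<le> C * t powr (\<beta> - 1)" by (simp add: Q mult.commute)
    have gi: "\<bar>cex_grad \<beta> k z $ i\<bar> \<le> (P * q\<^sup>2) * M" for i
    proof (cases "i = k")
      case True
      have "\<bar>cex_grad \<beta> k z $ i\<bar> = (P * q\<^sup>2) * (\<bar>tcut t\<bar> * (\<bar>step2 (2 - y)\<bar> * \<bar>zeta k x\<bar>))"
        using P True by (simp add: z cex_grad_def abs_mult P_def q_def y_def)
      also have "\<dots> \<le> (P * q\<^sup>2) * (1 * (C2 * 1))"
        using P PQ t1 C2 z1 by (intro mult_mono mult_nonneg_nonneg) auto
      also have "\<dots> \<le> (P * q\<^sup>2) * M" using PQ M by (intro mult_left_mono) auto
      finally show ?thesis .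
    next
      case False
      have "\<bar>cex_grad \<beta> k z $ i\<bar> = P * q * (\<bar>tcut t\<bar> * (\<bar>step1 (2 - y)\<bar> * \<bar>dzeta k i x\<bar>))"
        using P q False by (simp add: z cex_grad_def abs_mult P_def q_def y_def)
      also have "\<dots> \<le> (P * q\<^sup>2) * (1 * (C1 * (2 * C1)))"
        using P q qq PQ t1 C1 dz by (intro mult_mono mult_nonneg_nonneg) auto
      also have "\<dots> \<le> (P * q\<^sup>2) * M" using PQ M by (intro mult_left_mono) auto
      finally show ?thesis .
    qed
    have "norm (cex_grad \<beta> k z) \<le> (\<Sum>i\<in>UNIV. \<bar>cex_grad \<beta> k z $ i\<bar>)" by (rule norm_le_l1_cart)
    also have "\<dots> \<le> (\<Sum>i\<in>(UNIV::'d set). (P * q\<^sup>2) * M)" by (intro sum_mono gi)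
    also have "\<dots> = (P * q\<^sup>2) * (real CARD('d) * M)" by simp
    also have "\<dots> \<le> (P * q\<^sup>2) * C" using PQ C by (intro mult_left_mono) auto
    finally have 2: "norm (cex_grad \<beta> k z) \<le> C * t powr (\<beta> - 1)" by (simp add: Q mult.commute)
    define a where "a = \<beta> * P * q\<^sup>2 * tcut t"
    define b where "b = P * 2 * step1 (2 - 2 * t)"
    \<comment> \<open>One factor t^(-1/2) is absorbed in y, which is at most 2, so that only t^(-1)
      is left.\<close>
    define c where "c = P * tcut t * step1 (2 - y) * (y * q\<^sup>2 / 2)"
    have "\<bar>a\<bar> = (P * q\<^sup>2) * (\<bar>\<beta>\<bar> * \<bar>tcut t\<bar>)" using P by (simp add: a_def abs_mult)
    also have "\<dots> \<le> (P * q\<^sup>2) * (\<bar>\<beta>\<bar> * 1)" using PQ t1 by (intro mult_left_mono) auto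
    finally have a: "\<bar>a\<bar> \<le> (P * q\<^sup>2) * \<bar>\<beta>\<bar>" by simp
    have "\<bar>b\<bar> = P * (2 * \<bar>step1 (2 - 2 * t)\<bar>)" using P by (simp add: b_def abs_mult)
    also have "\<dots> \<le> (P * q\<^sup>2) * (2 * C1)" using PQ C1 P qq by (intro mult_mono) auto
    finally have b: "\<bar>b\<bar> \<le> (P * q\<^sup>2) * (2 * C1)" .
    have "\<bar>c\<bar> = (P * q\<^sup>2) * (\<bar>tcut t\<bar> * (\<bar>step1 (2 - y)\<bar> * (y / 2)))" using P y by (simp add: c_def abs_mult)
    also have "\<dots> \<le> (P * q\<^sup>2) * (1 * (C1 * 1))"
      using P PQ C1 t1 y by (intro mult_mono mult_nonneg_nonneg) auto
    finally have c: "\<bar>c\<bar> \<le> (P * q\<^sup>2) * C1" by simp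
    have "\<bar>flux \<beta> k z\<bar> = \<bar>(a - b) * smooth_step (2 - y) + c\<bar> * \<bar>zeta k x\<bar>"
      by (simp add: z flux_def a_def b_def c_def P_def q_def y_def abs_mult del: minus_add_distrib)
    also have "\<dots> \<le> \<bar>(a - b) * smooth_step (2 - y) + c\<bar> * 1"
      using z1 by (intro mult_left_mono) auto
    also have "\<dots> \<le> \<bar>a - b\<bar> * \<bar>smooth_step (2 - y)\<bar> + \<bar>c\<bar>"
      using abs_triangle_ineq[of "(a - b) * smooth_step (2 - y)" c] by (simp add: abs_mult)
    also have "\<dots> \<le> (\<bar>a\<bar> + \<bar>b\<bar>) * 1 + \<bar>c\<bar>"
      using s1 abs_triangle_ineq4[of a b] by (intro add_right_mono mult_mono) auto
    also have "\<dots> \<le> (P * q\<^sup>2) * \<bar>\<beta>\<bar> + (P * q\<^sup>2) * (2 * C1) + (P * q\<^sup>2) * C1"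
      unfolding mult_1_right by (intro add_mono a b c)
    also have "\<dots> = (P * q\<^sup>2) * (\<bar>\<beta>\<bar> + 3 * C1)" by (simp add: algebra_simps)
    also have "\<dots> \<le> (P * q\<^sup>2) * C" using PQ C by (intro mult_left_mono) auto
    finally have 3: "\<bar>flux \<beta> k z\<bar> \<le> C * t powr (\<beta> - 1)" by (simp add: Q mult.commute)
    from 1 2 3 show ?thesis by (simp add: z)
  qed
  show ?thesis using that[OF C(4)] main by blast
qed

section \<open>An integrable majorant that decreases in time\<close>

text \<open>On \<open>region k\<close> one has \<open>(x $ k)\<^sup>2 < 4 * t\<close>, so \<open>t powr (- b)\<close> is at most a constant times
  \<open>t powr (- 7/8) * (x $ k) powr (- 2 * (b - 7/8))\<close>; for \<open>b \<le> 5/4\<close> both exponents are above \<open>- 1\<close>.\<close>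

definition majorant_factor :: "real \<Rightarrow> 'd::finite \<Rightarrow> 'd spacetime \<Rightarrow> real \<Rightarrow> real" where
  "majorant_factor \<kappa> k e s = (if e = (1, 0) then indicator {0..1} s * s powr (- (7 / 8))
     else if e = (0, axis k 1) then indicator {0..2} s * s powr (- \<kappa>) else indicator {-2..2} s)"

text \<open>A product over the basis of space-time, so that its integral splits into one-dimensional
  integrals; the one in the direction k is finite for \<kappa> < 1.\<close>

definition majorant :: "real \<Rightarrow> 'd::finite \<Rightarrow> 'd spacetime \<Rightarrow> real" where
  "majorant \<kappa> k z = (\<Prod>e\<in>Basis. majorant_factor \<kappa> k e (z \<bullet> e))"

lemma nn_integral_powr_finite:
  assumes "a < 1" "0 \<le> c"
  shows "(\<integral>\<^sup>+s. ennreal (indicator {0..c} s * s powr (- a)) \<partial>lborel) < \<infinity>"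
proof -
  obtain I where "((\<lambda>s. s powr (- a)) has_integral I) {0..c}"
    using integrable_on_powr_from_0[of "- a" c] assms by (auto simp: integrable_on_def)
  then show ?thesis
    using nn_integral_has_integral_lebesgue[of "{0..c}" "\<lambda>s. s powr (- a)" I] by simp
qed

lemma majorant_factor_nonneg: "0 \<le> majorant_factor \<kappa> k e s"
  by (simp add: majorant_factor_def)

lemma majorant_factor_measurable: "majorant_factor \<kappa> k e \<in> borel_measurable borel"
  unfolding majorant_factor_def[abs_def]
  by (cases "e = (1, 0)"; cases "e = (0, axis k 1)") simp_all

lemma majorant_integrable:
  assumes "\<kappa> < 1"
  shows "integrable lborel (majorant \<kappa> k)"
proof -
  have m: "majorant \<kappa> k \<in> borel_measurable borel"
    unfolding majorant_def[abs_def]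
    by (intro borel_measurable_prod measurable_compose[OF _ majorant_factor_measurable]) simp
  have "(\<integral>\<^sup>+z. ennreal (majorant \<kappa> k z) \<partial>lborel) = (\<integral>\<^sup>+z. (\<Prod>e\<in>Basis. ennreal (majorant_factor \<kappa> k e (z \<bullet> e))) \<partial>lborel)"
    unfolding majorant_def by (simp add: prod_ennreal majorant_factor_nonneg)
  also have "\<dots> = (\<Prod>e\<in>Basis. (\<integral>\<^sup>+s. ennreal (majorant_factor \<kappa> k e s) \<partial>lborel))"
    by (rule nn_integral_lborel_prod)
      (intro measurable_compose[OF majorant_factor_measurable measurable_ennreal], simp)
  also have "\<dots> < \<infinity>"
  proof -
    have "(\<integral>\<^sup>+s. ennreal (majorant_factor \<kappa> k e s) \<partial>lborel) < top" for e
    proof -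
      consider "e = (1, 0)" | "e = (0, axis k 1)" | "e \<noteq> (1, 0)" "e \<noteq> (0, axis k 1)" by blast
      then show ?thesis
      proof cases
        case 1
        then show ?thesis using nn_integral_powr_finite[of "7/8" 1] by (simp add: majorant_factor_def)
      next
        case 2
        then show ?thesis using nn_integral_powr_finite[OF assms, of 2] by (simp add: majorant_factor_def)
      next
        case 3
        then have "(\<integral>\<^sup>+s. ennreal (majorant_factor \<kappa> k e s) \<partial>lborel) = (\<integral>\<^sup>+s. indicator {-2..2::real} s \<partial>lborel)"
          by (simp add: majorant_factor_def ennreal_indicator)
        then show ?thesis by simp
      qed
    qed
    then have "(\<Prod>e\<in>B. (\<integral>\<^sup>+s. ennreal (majorant_factor \<kappa> k e s) \<partial>lborel)) < top" for B
      by (induction B rule: infinite_finite_induct) (simp_all add: ennreal_mult_less_top)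
    then show ?thesis by simp
  qed
  finally show ?thesis
    using m by (intro integrableI_nonneg) (auto simp: majorant_def intro!: prod_nonneg majorant_factor_nonneg)
qed

lemma majorant_eq:
  assumes "0 < t" "t < 1" "0 < x $ k" "x $ k < 2" "\<And>j. j \<noteq> k \<Longrightarrow> \<bar>x $ j\<bar> < 2"
  shows "majorant \<kappa> k (t, x) = t powr (- (7 / 8)) * (x $ k) powr (- \<kappa>)"
proof -
  let ?f = "\<lambda>e. majorant_factor \<kappa> k e ((t, x) \<bullet> e)"
  let ?e0 = "(1, 0) :: 'a spacetime" and ?e1 = "(0, axis k 1) :: 'a spacetime"
  have B: "?e0 \<in> Basis" "?e1 \<in> Basis - {?e0}"
    by (auto simp: Basis_prod_def axis_in_Basis_iff)
  have "majorant \<kappa> k (t, x) = ?f ?e0 * (?f ?e1 * (\<Prod>e\<in>Basis - {?e0} - {?e1}. ?f e))"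
    unfolding majorant_def using B by (simp add: prod.remove[OF _ B(1)] prod.remove[OF _ B(2)])
  also have "(\<Prod>e\<in>Basis - {?e0} - {?e1}. ?f e) = 1"
  proof (rule prod.neutral, rule ballI)
    fix e assume e: "e \<in> Basis - {?e0} - {?e1}"
    then obtain j where "e = (0, axis j 1)" "j \<noteq> k"
      by (auto simp: Basis_prod_def Basis_vec_def)
    then show "?f e = 1"
      using e assms(5)[of j] by (auto simp: majorant_factor_def inner_axis indicator_def)
  qed
  finally show ?thesis using assms by (simp add: majorant_factor_def inner_axis)
qed

text \<open>The bound must be uniform in \<delta> and taken at (t, x), which may lie outside the
  layer. The factor (t + \<delta>)^(- 7/8) only grows when \<delta> is dropped; the remaining power
  is estimated through x_k / 2 < sqrt (t + \<delta>), whose left-hand side involves neither t nor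
  \<delta>.\<close>

lemma powr_le_majorant:
  fixes x :: "real ^ 'd::finite"
  assumes b: "1 < b" "b \<le> 5 / 4" and t: "0 < t" and \<delta>: "0 \<le> \<delta>" and r: "(t + \<delta>, x) \<in> region k"
  shows "(t + \<delta>) powr (- b) \<le> 2 powr (2 * (b - 7 / 8)) * majorant (2 * (b - 7 / 8)) k (t, x)"
proof -
  let ?s = "t + \<delta>" and ?c = "b - 7 / 8"
  have s: "0 < ?s" "?s < 1" and x: "0 < x $ k" "x $ k * isq ?s < 2" "\<And>j. j \<noteq> k \<Longrightarrow> \<bar>x $ j\<bar> < 2"
    using r by (auto simp: region_def)
  have "x $ k = x $ k * (isq ?s * ?s powr (1 / 2))" using s by (simp add: powr_add[symmetric])
  also have "\<dots> < 2 * ?s powr (1 / 2)"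
    using mult_strict_right_mono[OF x(2), of "?s powr (1 / 2)"] s by (simp only: mult.assoc) simp
  finally have xs: "x $ k / 2 < ?s powr (1 / 2)" by simp
  then have "x $ k / 2 < 1" using powr_mono2[of "1 / 2" ?s 1] s by simp
  then have x2: "x $ k < 2" by simp
  have "?s powr (- ?c) = (?s powr (1 / 2)) powr (- (2 * ?c))" using s by (simp add: powr_powr diff_divide_distrib)
  also have "\<dots> \<le> (x $ k / 2) powr (- (2 * ?c))"
    using xs x b by (intro powr_mono2') auto
  also have "\<dots> = 2 powr (2 * ?c) * (x $ k) powr (- (2 * ?c))"
    using x by (simp add: powr_divide powr_minus field_simps)
  finally have 1: "?s powr (- ?c) \<le> 2 powr (2 * ?c) * (x $ k) powr (- (2 * ?c))" .
  have 2: "?s powr (- (7 / 8)) \<le> t powr (- (7 / 8))" using t \<delta> by (intro powr_mono2') auto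
  have "?s powr (- b) = ?s powr (- (7 / 8)) * ?s powr (- ?c)"
    by (simp add: powr_add[symmetric])
  also have "\<dots> \<le> t powr (- (7 / 8)) * (2 powr (2 * ?c) * (x $ k) powr (- (2 * ?c)))"
    using 1 2 by (intro mult_mono) auto
  also have "\<dots> = 2 powr (2 * ?c) * majorant (2 * ?c) k (t, x)"
    using majorant_eq[of t x k "2 * ?c"] t \<delta> s x x2 by simp
  finally show ?thesis .
qed

lemma norm_powr_le_majorant:
  fixes W :: "'d::finite spacetime \<Rightarrow> 'b::real_normed_vector"
  assumes p: "1 \<le> p" and b: "1 < b" "b \<le> 5 / 4"
    and C: "0 < C" "\<And>z. z \<in> region k \<Longrightarrow> norm (W z) \<le> C * fst z powr ((1 - b / p) - 1)"
    and t: "0 < t" and \<delta>: "0 \<le> \<delta>" and out: "(t + \<delta>, x) \<notin> region k \<Longrightarrow> W (t + \<delta>, x) = 0"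
  shows "norm (W (t + \<delta>, x)) powr p \<le> C powr p * 2 powr (2 * (b - 7 / 8)) * majorant (2 * (b - 7 / 8)) k (t, x)"
proof (cases "(t + \<delta>, x) \<in> region k")
  case True
  have "norm (W (t + \<delta>, x)) powr p \<le> (C * (t + \<delta>) powr (- (b / p))) powr p"
    using C(2)[OF True] p by (intro powr_mono2) auto
  \<comment> \<open>The choice \<beta> = 1 - b / p amounts to p * (\<beta> - 1) = - b.\<close>
  also have "\<dots> = C powr p * (t + \<delta>) powr (- b)"
    using C(1) p by (simp add: powr_mult powr_powr)
  also have "\<dots> \<le> C powr p * (2 powr (2 * (b - 7 / 8)) * majorant (2 * (b - 7 / 8)) k (t, x))"
    using powr_le_majorant[OF b t \<delta> True] by (intro mult_left_mono) auto
  finally show ?thesis by (simp add: mult.assoc)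
next
  case False
  then show ?thesis using out p by (simp add: majorant_def prod_nonneg majorant_factor_nonneg)
qed

lemma integrable_lebesgue_on_lborel:
  fixes f :: "'a::euclidean_space \<Rightarrow> real"
  assumes "integrable lborel f" "S \<in> sets lebesgue"
  shows "integrable (lebesgue_on S) f"
proof -
  have "integrable lebesgue f" using assms(1) integrable_completion[of f lborel] by auto
  then have "integrable lebesgue (\<lambda>x. indicator S x *\<^sub>R f x)"
    by (rule integrable_mult_indicator[OF assms(2)])
  then show ?thesis using assms(2) integrable_restrict_space[of S lebesgue f] by simp
qed

section \<open>Translation in time\<close>

lemma translate_Lp:
  fixes W :: "'d::finite spacetime \<Rightarrow> 'b::euclidean_space"
  assumes p: "1 \<le> p" and \<Omega>: "open \<Omega>" and c: "continuous_on {z. 0 < fst z} W"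
    and \<Phi>: "integrable (lebesgue_on (cyl T \<Omega>)) \<Phi>"
    and le: "\<And>\<delta> z. 0 \<le> \<delta> \<Longrightarrow> z \<in> cyl T \<Omega> \<Longrightarrow> norm (W (z + \<delta> *\<^sub>R (1, 0))) powr p \<le> \<Phi> z"
  shows "0 \<le> \<delta> \<Longrightarrow> (\<lambda>z. W (z + \<delta> *\<^sub>R (1, 0))) \<in> Lp p (cyl T \<Omega>)"
    and "0 \<le> \<delta> \<Longrightarrow> (\<lambda>z. W z - W (z + \<delta> *\<^sub>R (1, 0))) \<in> Lp p (cyl T \<Omega>)"
    and "(\<lambda>n. Lp_norm p (cyl T \<Omega>) (\<lambda>z. W z - W (z + inverse (real (Suc n)) *\<^sub>R (1, 0)))) \<longlonglongrightarrow> 0"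
proof -
  let ?S = "cyl T \<Omega>"
  have S: "?S \<in> sets lebesgue" using open_cyl[OF \<Omega>] by simp
  have pos: "0 < fst z" if "z \<in> ?S" for z using that by (auto simp: cyl_def)
  have ct: "continuous_on ?S (\<lambda>z. W (z + \<delta> *\<^sub>R (1, 0)))" if "0 \<le> \<delta>" for \<delta>
    by (rule continuous_on_compose2[OF c]) (use that pos in \<open>auto intro!: continuous_intros add_pos_nonneg\<close>)
  have ct0: "continuous_on ?S W" by (rule continuous_on_subset[OF c]) (use pos in auto)
  have le': "norm (W z - W (z + \<delta> *\<^sub>R (1, 0))) powr p \<le> 2 powr p * \<Phi> z" if "0 \<le> \<delta>" "z \<in> ?S" for \<delta> z
  proof -
    let ?a = "norm (W z)" and ?b = "norm (W (z + \<delta> *\<^sub>R (1, 0)))"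
    \<comment> \<open>With the maximum in place of the sum, a single \<Phi> suffices: it bounds each
      of the two powers, that of W z as the case \<delta> = 0.\<close>
    have "norm (W z - W (z + \<delta> *\<^sub>R (1, 0))) \<le> 2 * max ?a ?b"
      using norm_triangle_ineq4[of "W z" "W (z + \<delta> *\<^sub>R (1, 0))"] by simp
    then have "norm (W z - W (z + \<delta> *\<^sub>R (1, 0))) powr p \<le> (2 * max ?a ?b) powr p"
      using p by (intro powr_mono2) auto
    also have "\<dots> = 2 powr p * max ?a ?b powr p" by (simp add: powr_mult)
    also have "\<dots> \<le> 2 powr p * \<Phi> z"
      using le[OF that] le[OF order_refl that(2)] by (intro mult_left_mono) (auto simp: max_def zero_prod_def[symmetric])
    finally show ?thesis .
  qed
  show "(\<lambda>z. W (z + \<delta> *\<^sub>R (1, 0))) \<in> Lp p ?S" if "0 \<le> \<delta>"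
    using Lp_I[OF S ct[OF that] \<Phi> le[OF that]] .
  have i\<Phi>: "integrable (lebesgue_on ?S) (\<lambda>z. 2 powr p * \<Phi> z)" using \<Phi> by simp
  show L: "(\<lambda>z. W z - W (z + \<delta> *\<^sub>R (1, 0))) \<in> Lp p ?S" if "0 \<le> \<delta>" for \<delta>
    using Lp_I[OF S continuous_on_diff[OF ct0 ct[OF that]] i\<Phi> le'[OF that]] .
  define s where "s n = inverse (real (Suc n))" for n
  have s: "0 \<le> s n" for n by (simp add: s_def)
  have "(\<lambda>n. LINT z|lebesgue_on ?S. norm (W z - W (z + s n *\<^sub>R (1, 0))) powr p) \<longlonglongrightarrow> (LINT z|lebesgue_on ?S. 0)"
  proof (rule integral_dominated_convergence[OF _ _ i\<Phi>])
    show "(\<lambda>z. norm (W z - W (z + s n *\<^sub>R (1, 0))) powr p) \<in> borel_measurable (lebesgue_on ?S)" for n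
      using L[OF s[of n]] by (auto simp: Lp_def)
    show "AE z in lebesgue_on ?S. norm (norm (W z - W (z + s n *\<^sub>R (1, 0))) powr p) \<le> 2 powr p * \<Phi> z" for n
      using le'[OF s[of n]] by (intro AE_I2) simp
    have "(\<lambda>n. norm (W z - W (z + s n *\<^sub>R (1, 0))) powr p) \<longlonglongrightarrow> 0" if z: "z \<in> ?S" for z
    proof -
      have "s \<longlonglongrightarrow> 0" unfolding s_def using LIMSEQ_inverse_real_of_nat by simp
      then have "(\<lambda>n. z + s n *\<^sub>R (1, 0)) \<longlonglongrightarrow> z + 0 *\<^sub>R (1, 0)" by (intro tendsto_intros)
      moreover have "isCont W z"
        using c pos[OF z] by (intro continuous_on_interior[OF c]) (simp add: interior_open open_Collect_less continuous_on_fst)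
      ultimately have "(\<lambda>n. W (z + s n *\<^sub>R (1, 0))) \<longlonglongrightarrow> W z"
        using isCont_tendsto_compose[of z W] by (simp add: zero_prod_def[symmetric])
      then have "(\<lambda>n. norm (W z - W (z + s n *\<^sub>R (1, 0)))) \<longlonglongrightarrow> norm (W z - W z)"
        by (intro tendsto_intros)
      then show ?thesis
        using p by (intro tendsto_zero_powrI[of _ _ _ p]) auto
    qed
    then show "AE z in lebesgue_on ?S. (\<lambda>n. norm (W z - W (z + s n *\<^sub>R (1, 0))) powr p) \<longlonglongrightarrow> 0"
      by (intro AE_I2) simp
  qed simp
  then show "(\<lambda>n. Lp_norm p ?S (\<lambda>z. W z - W (z + inverse (real (Suc n)) *\<^sub>R (1, 0)))) \<longlonglongrightarrow> 0"
    unfolding Lp_norm_def s_def[symmetric] using p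
    by (intro tendsto_zero_powrI[of _ _ _ "1 / p"]) (auto intro!: always_eventually)
qed

section \<open>Membership in the function spaces\<close>

lemma open_half_space: "open (half_space k)"
  unfolding half_space_def by (intro open_Collect_less continuous_intros)

lemma Ck_on_diff:
  assumes "Ck_on n S f" "Ck_on n S g"
  shows "Ck_on n S (\<lambda>z. f z - g z)"
  using Ck_on_add[OF assms(1) Ck_on_mult[OF Ck_on_const[of n S "-1"] assms(2)]] by simp

text \<open>The coefficients (a, c) = (1, 0), (0, 1) and (1, -1) give u, its translate and their
  difference, so that one computation serves all three.\<close>

lemma translate_combination:
  fixes k :: "'d::finite" and a c \<delta> \<beta> :: real
  assumes \<Omega>: "open \<Omega>" and \<delta>: "0 \<le> \<delta>"
  shows "is_weak_grad T \<Omega> (\<lambda>z. a * cex \<beta> k z + c * cex \<beta> k (z + \<delta> *\<^sub>R (1, 0)))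
      (\<lambda>z. a *\<^sub>R cex_grad \<beta> k z + c *\<^sub>R cex_grad \<beta> k (z + \<delta> *\<^sub>R (1, 0)))"
    and "dt_eq_div T \<Omega> (\<lambda>z. a * cex \<beta> k z + c * cex \<beta> k (z + \<delta> *\<^sub>R (1, 0)))
      (\<lambda>z. axis k (a * flux \<beta> k z + c * flux \<beta> k (z + \<delta> *\<^sub>R (1, 0)))) (\<lambda>_. 0)"
proof -
  let ?S = "cyl T \<Omega>" and ?e = "\<delta> *\<^sub>R (1, 0) :: 'd spacetime"
  have pos: "0 < fst z" "0 < fst (z + ?e)" if "z \<in> ?S" for z
    using that \<delta> by (auto simp: cyl_def add_pos_nonneg)
  have c0: "continuous_on ?S W" if "continuous_on {z. 0 < fst z} W" for W :: "'d spacetime \<Rightarrow> 'b::real_normed_vector"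
    by (rule continuous_on_subset[OF that]) (use pos in auto)
  have c1: "continuous_on ?S (\<lambda>z. W (z + ?e))" if "continuous_on {z. 0 < fst z} W" for W :: "'d spacetime \<Rightarrow> 'b::real_normed_vector"
  proof (rule continuous_on_compose2[OF that])
    show "continuous_on ?S (\<lambda>z. z + ?e)" by (intro continuous_intros)
    show "(\<lambda>z. z + ?e) ` ?S \<subseteq> {z. 0 < fst z}" using pos(2) by blast
  qed
  have comm: "(z + s *\<^sub>R v) + ?e = (z + ?e) + s *\<^sub>R v" for z v :: "'d spacetime" and s
    by (simp only: add_ac)
  let ?v = "\<lambda>z. a * cex \<beta> k z + c * cex \<beta> k (z + ?e)"
  let ?w = "\<lambda>z. a *\<^sub>R cex_grad \<beta> k z + c *\<^sub>R cex_grad \<beta> k (z + ?e)"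
  let ?vt = "\<lambda>z. a * cex_dt \<beta> k z + c * cex_dt \<beta> k (z + ?e)"
  let ?g = "\<lambda>z. a * flux \<beta> k z + c * flux \<beta> k (z + ?e)"
  have c: "continuous_on ?S ?v" "continuous_on ?S ?w" "continuous_on ?S ?vt" "continuous_on ?S ?g"
    by (intro continuous_on_add continuous_on_mult continuous_on_scaleR continuous_on_const c0 c1 cex_continuous)+
  have Dx: "((\<lambda>s. ?v (z + s *\<^sub>R (0, axis i 1))) has_real_derivative ?w z $ i) (at 0)" for z i
    unfolding comm vector_add_component vector_scaleR_component real_scaleR_def
    by (intro DERIV_add DERIV_cmult cex_DERIV_x)
  have Dt: "((\<lambda>s. ?v (z + s *\<^sub>R (1, 0))) has_real_derivative ?vt z) (at 0)" if "z \<in> ?S" for z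
    unfolding comm by (intro DERIV_add DERIV_cmult cex_DERIV_t pos that)
  have Dg: "((\<lambda>s. ?g (z + s *\<^sub>R (0, axis k 1))) has_real_derivative ?vt z) (at 0)" for z
    unfolding comm by (intro DERIV_add DERIV_cmult flux_DERIV)
  show "is_weak_grad T \<Omega> ?v ?w" "dt_eq_div T \<Omega> ?v (\<lambda>z. axis k (?g z)) (\<lambda>_. 0)"
    by (rule classical_H1[OF \<Omega> c Dx Dt Dg], assumption)+
qed

text \<open>Applied to u, to its gradient and, on the half-space only, to the flux. On the whole
  space the hypothesis \<open>out\<close> fails for the flux, which is the point of the
  example.\<close>

lemma translates:
  fixes k :: "'d::finite" and W :: "'d spacetime \<Rightarrow> 'b::euclidean_space"
  assumes p: "1 \<le> p" and b: "1 < b" "b \<le> 5 / 4" and \<Omega>: "open \<Omega>"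
    and cont: "continuous_on {z. 0 < fst z} W"
    and C: "0 < C" "\<forall>z\<in>region k. norm (W z) \<le> C * fst z powr ((1 - b / p) - 1)"
    and out: "\<forall>t x. (t, x) \<notin> region k \<longrightarrow> 0 < t \<longrightarrow> x \<in> \<Omega> \<longrightarrow> W (t, x) = 0"
  shows "0 \<le> \<delta> \<Longrightarrow> (\<lambda>z. W (z + \<delta> *\<^sub>R (1, 0))) \<in> Lp p (cyl T \<Omega>)"
    and "0 \<le> \<delta> \<Longrightarrow> (\<lambda>z. W z - W (z + \<delta> *\<^sub>R (1, 0))) \<in> Lp p (cyl T \<Omega>)"
    and "(\<lambda>n. Lp_norm p (cyl T \<Omega>) (\<lambda>z. W z - W (z + inverse (real (Suc n)) *\<^sub>R (1, 0)))) \<longlonglongrightarrow> 0"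
proof -
  let ?\<Phi> = "\<lambda>z. C powr p * 2 powr (2 * (b - 7 / 8)) * majorant (2 * (b - 7 / 8)) k z"
  have i: "integrable (lebesgue_on (cyl T \<Omega>)) ?\<Phi>"
    using b open_cyl[OF \<Omega>, of T]
    by (intro integrable_mult_right integrable_lebesgue_on_lborel majorant_integrable) auto
  have le: "norm (W (z + \<delta> *\<^sub>R (1, 0))) powr p \<le> ?\<Phi> z" if "0 \<le> \<delta>" "z \<in> cyl T \<Omega>" for \<delta> z
  proof -
    obtain t x where z: "z = (t, x)" by (cases z)
    then have t: "0 < t" "x \<in> \<Omega>" using that by (auto simp: cyl_def)
    show ?thesis
      unfolding z add_Pair scaleR_Pair
      using norm_powr_le_majorant[OF p b C(1) C(2)[rule_format] t(1) that(1), where x=x] out t that(1)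
      by (simp add: add_pos_nonneg)
  qed
  show "0 \<le> \<delta> \<Longrightarrow> (\<lambda>z. W (z + \<delta> *\<^sub>R (1, 0))) \<in> Lp p (cyl T \<Omega>)"
    and "0 \<le> \<delta> \<Longrightarrow> (\<lambda>z. W z - W (z + \<delta> *\<^sub>R (1, 0))) \<in> Lp p (cyl T \<Omega>)"
    and "(\<lambda>n. Lp_norm p (cyl T \<Omega>) (\<lambda>z. W z - W (z + inverse (real (Suc n)) *\<^sub>R (1, 0)))) \<longlonglongrightarrow> 0"
    using translate_Lp[OF p \<Omega> cont i le] by blast+
qed

text \<open>After the shift the time argument is at least \<delta>, so all powers are smooth up to t
  = 0; and \<open>step1\<close> forces x_k >= sqrt \<delta> on the support, which keeps it away from
  the lateral boundary.\<close>

lemma translate_C0_inf: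
  fixes k :: "'d::finite"
  assumes T: "0 < T" and \<delta>: "0 < \<delta>"
  shows "(\<lambda>z. cex \<beta> k (z + \<delta> *\<^sub>R (1, 0))) \<in> C0_inf (closed_time_cyl T (half_space k))"
proof -
  let ?S = "closed_time_cyl T (half_space k)"
  have pos: "0 < fst z + \<delta>" if "z \<in> ?S" for z using that \<delta> by (auto simp: closed_time_cyl_def)
  have sm: "Ck_on n S (\<lambda>z. smooth_step (h z))" "Ck_on n S (\<lambda>z. step1 (h z))" if "Ck_on n S h"
    for n and S :: "'d spacetime set" and h
    by (rule Ck_on_compose[OF _ that, of UNIV], use smooth_smooth_step smooth_step1 in \<open>simp_all add: smooth_fun_on_def\<close>)+
  have pw: "Ck_on n ?S (\<lambda>z. (fst z + \<delta>) powr a)" for n a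
    by (rule Ck_on_compose[OF Ck_on_powr Ck_on_add[OF Ck_on_linear[OF bounded_linear_fst] Ck_on_const]])
      (use pos in auto)
  have lin: "Ck_on n ?S (\<lambda>z. snd z $ j)" "Ck_on n ?S fst" for n j
    by (intro Ck_on_linear bounded_linear_fst bounded_linear_compose[OF bounded_linear_vec_nth bounded_linear_snd])+
  have "Ck_on n ?S (\<lambda>z. (fst z + \<delta>) powr \<beta> * isq (fst z + \<delta>) * tcut (fst z + \<delta>) *
      step1 (2 - snd z $ k * isq (fst z + \<delta>)) * zeta k (snd z))" for n
    unfolding zeta_def tcut_def plateau_def
    by (intro Ck_on_mult Ck_on_prod Ck_on_add Ck_on_diff Ck_on_const pw lin sm)
  then have Ck: "Ck_on n ?S (\<lambda>z. cex \<beta> k (z + \<delta> *\<^sub>R (1, 0)))" for n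
    by (simp add: cex_def)
  \<comment> \<open>The minimum of 1 and T as a real number, which keeps the box below compact and
    inside the closed cylinder for infinite T as well.\<close>
  obtain \<tau> where \<tau>: "ereal \<tau> \<le> T" "\<And>t. t \<le> 1 \<Longrightarrow> ereal t \<le> T \<Longrightarrow> t \<le> \<tau>"
  proof (cases "1 \<le> T")
    case True
    then show ?thesis using that[of 1] by (simp add: one_ereal_def)
  next
    case False
    then obtain r where "T = ereal r" using T by (cases T) auto
    then show ?thesis using that[of r] by simp
  qed
  let ?K = "cbox (0, \<chi> j. if j = k then \<delta> powr (1 / 2) else - 2) (\<tau>, \<chi> j. 2) :: 'd spacetime set"
  have mem: "(t, x) \<in> ?K \<longleftrightarrow> 0 \<le> t \<and> t \<le> \<tau> \<and> (\<forall>j. (if j = k then \<delta> powr (1 / 2) else - 2) \<le> x $ j \<and> x $ j \<le> 2)" for t x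
    by (auto simp: cbox_Pair_eq mem_box_cart)
  show ?thesis
  proof (rule C0_infI[OF Ck])
    show "compact ?K" by (rule compact_cbox)
    show "?K \<subseteq> ?S"
    proof
      fix z assume "z \<in> ?K"
      obtain t x where zz: "z = (t, x)" by (cases z)
      have "0 \<le> t \<and> t \<le> \<tau> \<and> (\<forall>j. (if j = k then \<delta> powr (1 / 2) else - 2) \<le> x $ j \<and> x $ j \<le> 2)"
        using \<open>z \<in> ?K\<close> unfolding zz mem .
      then have z: "z = (t, x)" "0 \<le> t" "t \<le> \<tau>" "\<delta> powr (1 / 2) \<le> x $ k"
        using zz by (auto dest: spec[of _ k])
      moreover have "ereal t \<le> T" using z(3) \<tau>(1) by (metis ereal_less_eq(3) order_trans)
      moreover have "0 < x $ k" using z(4) \<delta> by (metis powr_gt_zero less_irrefl less_le_trans)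
      ultimately show "z \<in> ?S" by (auto simp: closed_time_cyl_def half_space_def)
    qed
    fix z assume "z \<in> ?S" and nK: "z \<notin> ?K"
    then obtain t x where z: "z = (t, x)" "0 \<le> t" "ereal t \<le> T" "0 < x $ k"
      by (auto simp: closed_time_cyl_def half_space_def)
    have "cex \<beta> k (t + \<delta>, x) = 0"
    proof (cases "(t + \<delta>, x) \<in> region k")
      case False
      then show ?thesis by (rule outside_region(1)) (use z \<delta> in auto)
    next
      case True
      let ?r = "(t + \<delta>) powr (1 / 2)"
      have r: "0 < ?r" "isq (t + \<delta>) * ?r = 1" using z(2) \<delta> by (auto simp: powr_add[symmetric])
      have t: "t + \<delta> < 1" "x $ k * isq (t + \<delta>) < 2" "\<And>j. j \<noteq> k \<Longrightarrow> \<bar>x $ j\<bar> < 2"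
        using True by (auto simp: region_def)
      have "x $ k = x $ k * isq (t + \<delta>) * ?r" using r by (simp add: mult.assoc)
      also have "\<dots> \<le> 2 * 1"
        using t z \<delta> powr_mono2[of "1 / 2" "t + \<delta>" 1] by (intro mult_mono) auto
      finally have "x $ k \<le> 2" by simp
      \<comment> \<open>The point satisfies all other constraints of the box, so it must violate
        this one. Then x_k / sqrt (t + \<delta>) <= 1, where H is constant.\<close>
      have "x $ k < \<delta> powr (1 / 2)"
      proof (rule ccontr)
        assume "\<not> x $ k < \<delta> powr (1 / 2)"
        then have "\<forall>j. (if j = k then \<delta> powr (1 / 2) else - 2) \<le> x $ j \<and> x $ j \<le> 2"
          using \<open>x $ k \<le> 2\<close> t(3) by (auto simp: abs_less_iff) (smt (verit))+
        moreover have "t \<le> \<tau>" using t(1) z(3) \<delta> \<tau>(2)[of t] by simp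
        ultimately have "z \<in> ?K" using z(2) unfolding z(1) mem by blast
        with nK show False ..
      qed
      also have "\<dots> \<le> ?r" using z(2) \<delta> by (intro powr_mono2) auto
      finally have "x $ k * isq (t + \<delta>) \<le> ?r * isq (t + \<delta>)" by (intro mult_right_mono) auto
      then have "1 \<le> 2 - x $ k * isq (t + \<delta>)" using r by (simp add: mult.commute)
      then show ?thesis using step_eq_0_le(3) by (simp add: cex_def)
    qed
    then show "cex \<beta> k (z + \<delta> *\<^sub>R (1, 0)) = 0" by (simp add: z)
  qed
qed

lemma cex_in_H1_ring:
  fixes k :: "'d::finite"
  assumes T: "0 < T" and p: "1 \<le> p" and b: "1 < b" "b \<le> 5 / 4"
  shows "cex (1 - b / p) k \<in> H1_ring p T (half_space k)"
proof -
  let ?\<beta> = "1 - b / p" and ?O = "half_space k" and ?S = "cyl T (half_space k)"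
  let ?e = "\<lambda>\<delta>::real. \<delta> *\<^sub>R (1, 0) :: 'd spacetime"
  note \<Omega> = open_half_space[of k]
  obtain C where C: "0 < C" "\<forall>z\<in>region k. \<bar>cex ?\<beta> k z\<bar> \<le> C * fst z powr (?\<beta> - 1)"
    "\<forall>z\<in>region k. norm (cex_grad ?\<beta> k z) \<le> C * fst z powr (?\<beta> - 1)"
    "\<forall>z\<in>region k. \<bar>flux ?\<beta> k z\<bar> \<le> C * fst z powr (?\<beta> - 1)"
    using region_bounds[of k ?\<beta>] by metis
  have out: "\<forall>t x. (t, x) \<notin> region k \<longrightarrow> 0 < t \<longrightarrow> x \<in> ?O \<longrightarrow> cex ?\<beta> k (t, x) = 0"
    "\<forall>t x. (t, x) \<notin> region k \<longrightarrow> 0 < t \<longrightarrow> x \<in> ?O \<longrightarrow> cex_grad ?\<beta> k (t, x) = 0"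
    "\<forall>t x. (t, x) \<notin> region k \<longrightarrow> 0 < t \<longrightarrow> x \<in> ?O \<longrightarrow> flux ?\<beta> k (t, x) = 0"
    using outside_region by (auto simp: half_space_def)
  note Wc = translates[OF p b \<Omega> cex_continuous(1) C(1) C(2)[folded real_norm_def] out(1), where T=T]
  note Wg = translates[OF p b \<Omega> cex_continuous(2) C(1) C(3) out(2), where T=T]
  note Wf = translates[OF p b \<Omega> cex_continuous(4) C(1) C(4)[folded real_norm_def] out(3), where T=T]
  note N = H1_norm_le[OF p \<Omega>, where k=k]
  have u: "cex ?\<beta> k \<in> H1 p T ?O"
  proof (rule N(1))
    show "cex ?\<beta> k \<in> Lp p ?S" using Wc(1)[where \<delta>=0] by (simp flip: zero_prod_def)
    show "cex_grad ?\<beta> k \<in> Lp p ?S" using Wg(1)[where \<delta>=0] by (simp flip: zero_prod_def)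
    show "flux ?\<beta> k \<in> Lp p ?S" using Wf(1)[where \<delta>=0] by (simp flip: zero_prod_def)
    show "is_weak_grad T ?O (cex ?\<beta> k) (cex_grad ?\<beta> k)" "dt_eq_div T ?O (cex ?\<beta> k) (\<lambda>z. axis k (flux ?\<beta> k z)) (\<lambda>_. 0)"
      using translate_combination[OF \<Omega> order_refl, of T 1 ?\<beta> k 0] by (simp_all flip: zero_prod_def)
  qed
  have "\<exists>\<phi> \<in> C0_inf (closed_time_cyl T ?O) \<inter> H1 p T ?O. H1_norm p T ?O (\<lambda>z. cex ?\<beta> k z - \<phi> z) < \<epsilon>"
    if \<epsilon>: "0 < \<epsilon>" for \<epsilon>
  proof -
    define s where "s n = inverse (real (Suc n))" for n
    let ?D = "\<lambda>W n z. W z - W (z + ?e (s n))"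
    have "(\<lambda>n. Lp_norm p ?S (?D (cex ?\<beta> k) n) + Lp_norm p ?S (?D (cex_grad ?\<beta> k) n) + Lp_norm p ?S (?D (flux ?\<beta> k) n)) \<longlonglongrightarrow> 0 + 0 + 0"
      unfolding s_def by (intro tendsto_add Wc(3) Wg(3) Wf(3))
    then have "\<forall>\<^sub>F n in sequentially. Lp_norm p ?S (?D (cex ?\<beta> k) n) + Lp_norm p ?S (?D (cex_grad ?\<beta> k) n) + Lp_norm p ?S (?D (flux ?\<beta> k) n) < \<epsilon>"
      using \<epsilon> by (intro order_tendstoD(2)) auto
    then obtain n where n: "Lp_norm p ?S (?D (cex ?\<beta> k) n) + Lp_norm p ?S (?D (cex_grad ?\<beta> k) n) + Lp_norm p ?S (?D (flux ?\<beta> k) n) < \<epsilon>"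
      using eventually_happens'[OF sequentially_bot] by blast
    have s: "0 < s n" "0 \<le> s n" by (simp_all add: s_def)
    let ?\<phi> = "\<lambda>z. cex ?\<beta> k (z + ?e (s n))"
    have "?\<phi> \<in> H1 p T ?O"
    proof (rule N(1)[OF Wc(1)[OF s(2)] Wg(1)[OF s(2)] _ Wf(1)[OF s(2)]])
      show "is_weak_grad T ?O ?\<phi> (\<lambda>z. cex_grad ?\<beta> k (z + ?e (s n)))" "dt_eq_div T ?O ?\<phi> (\<lambda>z. axis k (flux ?\<beta> k (z + ?e (s n)))) (\<lambda>_. 0)"
        using translate_combination[OF \<Omega> s(2), of T 0 ?\<beta> k 1] by simp_all
    qed
    moreover have "H1_norm p T ?O (?D (cex ?\<beta> k) n) < \<epsilon>"
    proof (rule le_less_trans[OF N(2)[OF Wc(2)[OF s(2)] Wg(2)[OF s(2)] _ Wf(2)[OF s(2)]] n])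
      show "is_weak_grad T ?O (?D (cex ?\<beta> k) n) (?D (cex_grad ?\<beta> k) n)"
        "dt_eq_div T ?O (?D (cex ?\<beta> k) n) (\<lambda>z. axis k (?D (flux ?\<beta> k) n z)) (\<lambda>_. 0)"
        using translate_combination[OF \<Omega> s(2), of T 1 ?\<beta> k "-1"] by simp_all
    qed
    ultimately show ?thesis using translate_C0_inf[OF T s(1)] by (intro bexI[of _ ?\<phi>]) auto
  qed
  with u show ?thesis by (simp add: H1_ring_def)
qed

section \<open>The zero extension and its spatial gradient\<close>

lemma zero_ext_cex: "zero_ext (half_space k) (cex \<beta> k) = cex \<beta> k"
  by (auto simp: zero_ext_def half_space_def fun_eq_iff cex_eq_0)

lemma cex_in_W10:
  fixes k :: "'d::finite"
  assumes p: "1 \<le> p" and b: "1 < b" "b \<le> 5 / 4"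
  shows "cex (1 - b / p) k \<in> W10 p T UNIV"
proof -
  let ?\<beta> = "1 - b / p"
  obtain C where C: "0 < C" "\<forall>z\<in>region k. \<bar>cex ?\<beta> k z\<bar> \<le> C * fst z powr (?\<beta> - 1)"
    "\<forall>z\<in>region k. norm (cex_grad ?\<beta> k z) \<le> C * fst z powr (?\<beta> - 1)"
    using region_bounds[of k ?\<beta>] by metis
  have "cex ?\<beta> k (t, x) = 0 \<and> cex_grad ?\<beta> k (t, x) = 0" if "(t, x) \<notin> region k" "0 < t" for t x
    using outside_region(1,2)[OF that] by (cases "0 < x $ k") (simp_all add: not_less cex_eq_0 cex_grad_eq_0)
  then have out: "\<forall>t x. (t, x) \<notin> region k \<longrightarrow> 0 < t \<longrightarrow> x \<in> UNIV \<longrightarrow> cex ?\<beta> k (t, x) = 0"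
    "\<forall>t x. (t, x) \<notin> region k \<longrightarrow> 0 < t \<longrightarrow> x \<in> UNIV \<longrightarrow> cex_grad ?\<beta> k (t, x) = 0"
    by blast+
  have "cex ?\<beta> k \<in> Lp p (cyl T UNIV)"
    using translates(1)[OF p b open_UNIV cex_continuous(1) C(1) C(2)[folded real_norm_def] out(1), where \<delta>=0 and T=T] by (simp flip: zero_prod_def)
  moreover have "cex_grad ?\<beta> k \<in> Lp p (cyl T UNIV)"
    using translates(1)[OF p b open_UNIV cex_continuous(2) C(1) C(3) out(2), where \<delta>=0 and T=T] by (simp flip: zero_prod_def)
  moreover have "is_weak_grad T UNIV (cex ?\<beta> k) (cex_grad ?\<beta> k)"
    using translate_combination(1)[OF open_UNIV order_refl, of T 1 ?\<beta> k 0] by (simp flip: zero_prod_def)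
  ultimately show ?thesis by (auto simp: W10_def)
qed

section \<open>The time derivative of the extension\<close>

text \<open>Near the boundary this is just \<open>zeta\<close>. The slopes in the direction k lie at
  -3 < x_k < -2, where the flux equals its trace, and at 4 < x_k < 5, beyond the layer, where the
  flux is 0.\<close>

definition cross_cut :: "'d \<Rightarrow> real ^ 'd::finite \<Rightarrow> real" where
  "cross_cut k x = smooth_step (x $ k + 3) * smooth_step (5 - x $ k) * zeta k x"

definition cross_cut_dx :: "'d \<Rightarrow> 'd \<Rightarrow> real ^ 'd::finite \<Rightarrow> real" where
  "cross_cut_dx k i x = (if i = k
     then (step1 (x $ k + 3) * smooth_step (5 - x $ k) - smooth_step (x $ k + 3) * step1 (5 - x $ k)) * zeta k x
     else smooth_step (x $ k + 3) * smooth_step (5 - x $ k) * dzeta k i x)"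

text \<open>For \<delta> > 0 supported in [\<delta>, 4 \<delta>] and equal to 1 on
  [2 \<delta>, 3 \<delta>].\<close>

definition time_bump :: "real \<Rightarrow> real \<Rightarrow> real" where
  "time_bump \<delta> t = smooth_step (t / \<delta> - 1) * smooth_step (4 - t / \<delta>)"

definition test_fun :: "real \<Rightarrow> 'd \<Rightarrow> 'd::finite spacetime \<Rightarrow> real" where
  "test_fun \<delta> k z = time_bump \<delta> (fst z) * cross_cut k (snd z)"

definition test_box :: "real \<Rightarrow> 'd \<Rightarrow> 'd::finite spacetime set" where
  "test_box \<delta> k = cbox (\<delta>, \<chi> j. if j = k then - 3 else - 2) (4 * \<delta>, \<chi> j. if j = k then 5 else 2)"

lemma time_bump_nonneg: "0 \<le> time_bump \<delta> t" and time_bump_le_1: "time_bump \<delta> t \<le> 1"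
  by (auto simp: time_bump_def intro!: mult_nonneg_nonneg mult_le_one smooth_step_nonneg smooth_step_le_1)

lemma mem_test_box:
  "(t, x) \<in> test_box \<delta> k \<longleftrightarrow> \<delta> \<le> t \<and> t \<le> 4 * \<delta> \<and> - 3 \<le> x $ k \<and> x $ k \<le> 5 \<and> (\<forall>j. j \<noteq> k \<longrightarrow> \<bar>x $ j\<bar> \<le> 2)"
  unfolding test_box_def cbox_Pair_eq mem_Times_iff mem_box_cart
  by (auto simp: abs_le_iff) (smt (verit))+

lemma outside_test_box:
  assumes "0 < \<delta>" "(t, x) \<notin> test_box \<delta> k"
  shows "time_bump \<delta> t * cross_cut k x = 0" "time_bump \<delta> t * cross_cut_dx k i x = 0"
proof -
  consider "t / \<delta> - 1 \<le> 0" | "4 - t / \<delta> \<le> 0" | "x $ k + 3 \<le> 0" | "5 - x $ k \<le> 0" | j where "j \<noteq> k" "2 \<le> \<bar>x $ j\<bar>"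
    using assms by (force simp: mem_test_box field_simps)
  then have "time_bump \<delta> t * cross_cut k x = 0 \<and> time_bump \<delta> t * cross_cut_dx k i x = 0"
    by cases (simp_all add: time_bump_def cross_cut_def cross_cut_dx_def smooth_step_eq_0 step1_eq_0 zeta_eq_0 dzeta_eq_0)
  then show "time_bump \<delta> t * cross_cut k x = 0" "time_bump \<delta> t * cross_cut_dx k i x = 0" by auto
qed

lemma cross_cut_DERIV:
  "((\<lambda>s. cross_cut k (x + s *\<^sub>R axis i 1)) has_real_derivative cross_cut_dx k i x) (at 0)"
proof (cases "i = k")
  case True
  have h: "((\<lambda>s. x $ k + s + 3) has_real_derivative 1) (at 0)" "((\<lambda>s. 5 - (x $ k + s)) has_real_derivative - 1) (at 0)"
    by (auto intro!: derivative_eq_intros)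
  from DERIV_cmult_right[OF DERIV_mult[OF this[THEN step_DERIV_chain(1)]], of "zeta k x"] show ?thesis
    using True by (simp add: cross_cut_def cross_cut_dx_def zeta_shift algebra_simps)
next
  case False
  have "axis i (1::real) $ k = 0" using False by (simp add: axis_def)
  then show ?thesis
    using DERIV_cmult[OF DERIV_zeta[OF False, of x], of "smooth_step (x $ k + 3) * smooth_step (5 - x $ k)"] False
    by (simp add: cross_cut_def cross_cut_dx_def)
qed

lemma test_fun_C0_inf:
  assumes \<delta>: "0 < \<delta>" "ereal (4 * \<delta>) < T"
  shows "test_fun \<delta> k \<in> C0_inf (cyl T (UNIV :: (real ^ 'd::finite) set))"
    and "test_box \<delta> k \<subseteq> cyl T UNIV"
proof -
  let ?S = "cyl T (UNIV :: (real ^ 'd) set)"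
  show sub: "test_box \<delta> k \<subseteq> ?S"
  proof
    fix z assume "z \<in> test_box \<delta> k"
    then obtain t x where z: "z = (t, x)" "\<delta> \<le> t" "t \<le> 4 * \<delta>" by (cases z) (auto simp: mem_test_box)
    have "ereal t < T" using \<delta>(2) z(3) by (metis ereal_less_eq(3) order_le_less_trans)
    then show "z \<in> ?S" using z \<delta> by (auto simp: cyl_def)
  qed
  show "test_fun \<delta> k \<in> C0_inf ?S"
  proof (rule C0_infI[OF _ _ sub])
    show "compact (test_box \<delta> k)" unfolding test_box_def by (rule compact_cbox)
    have sm: "Ck_on n S (\<lambda>z. smooth_step (h z))" if "Ck_on n S h" for n and S :: "'d spacetime set" and h
      by (rule Ck_on_compose[OF _ that, of UNIV]) (use smooth_smooth_step in \<open>simp_all add: smooth_fun_on_def\<close>)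
    have lin: "Ck_on n ?S (\<lambda>z. snd z $ j)" "Ck_on n ?S (\<lambda>z. fst z / \<delta>)" for n j
      by (intro Ck_on_linear bounded_linear_divide bounded_linear_compose[OF bounded_linear_vec_nth bounded_linear_snd]
          bounded_linear_compose[OF bounded_linear_divide bounded_linear_fst])+
    show "Ck_on n ?S (test_fun \<delta> k)" for n
      unfolding test_fun_def[abs_def] time_bump_def cross_cut_def zeta_def plateau_def
      by (intro Ck_on_mult Ck_on_prod Ck_on_add Ck_on_diff Ck_on_const lin sm)
    show "test_fun \<delta> k z = 0" if "z \<notin> test_box \<delta> k" for z
      using outside_test_box(1)[OF \<delta>(1), of "fst z" "snd z" k] that by (simp add: test_fun_def)
  qed
qed

lemma dx_test_fun:
  fixes k :: "'d::finite"
  assumes \<delta>: "0 < \<delta>" "ereal (4 * \<delta>) < T" and z: "z \<in> cyl T UNIV"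
  shows "dx i (test_fun \<delta> k) z = time_bump \<delta> (fst z) * cross_cut_dx k i (snd z)"
proof -
  have "(test_fun \<delta> k has_derivative frechet_derivative (test_fun \<delta> k) (at z)) (at z)"
    using C0_infE[OF test_fun_C0_inf(1)[OF \<delta>] open_cyl[OF open_UNIV]] z by metis
  from directional_DERIV[OF this, where v="(0, axis i 1)"]
  have 1: "((\<lambda>s. test_fun \<delta> k (z + s *\<^sub>R (0, axis i 1))) has_real_derivative dx i (test_fun \<delta> k) z) (at 0)"
    unfolding dx_def .
  have 2: "((\<lambda>s. test_fun \<delta> k (z + s *\<^sub>R (0, axis i 1))) has_real_derivative
      time_bump \<delta> (fst z) * cross_cut_dx k i (snd z)) (at 0)"
    using DERIV_cmult[OF cross_cut_DERIV[where k=k and x="snd z" and i=i], where c="time_bump \<delta> (fst z)"]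
    by (cases z) (simp add: test_fun_def)
  show ?thesis using DERIV_unique[OF 1 2] .
qed

lemma cross_cut_bound:
  obtains B where "1 \<le> B" "\<And>x::real ^ 'd::finite. \<bar>cross_cut k x\<bar> \<le> B" "\<And>i (x::real ^ 'd). \<bar>cross_cut_dx k i x\<bar> \<le> B"
proof -
  define K where "K = (cbox (\<chi> j. if j = k then - 3 else - 2) (\<chi> j. if j = k then 5 else 2) :: (real ^ 'd) set)"
  have cont: "continuous_on K (cross_cut k)" "continuous_on K (cross_cut_dx k i)" for i
  proof -
    note c = continuous_on_add continuous_on_diff continuous_on_mult continuous_on_const continuous_on_prod
      continuous_on_component continuous_on_id step_continuous_compose
    show "continuous_on K (cross_cut k)"
      unfolding cross_cut_def[abs_def] zeta_def plateau_def by (intro c)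
    show "continuous_on K (cross_cut_dx k i)"
      unfolding cross_cut_dx_def[abs_def] zeta_def plateau_def dzeta_def dplateau_def
      by (cases "i = k") (simp_all only: if_True if_False refl, (intro c)+)
  qed
  have K: "compact K" by (simp add: K_def)
  have bd: "\<exists>B. \<forall>x\<in>K. \<bar>f x\<bar> \<le> B" if "continuous_on K f" for f :: "real ^ 'd \<Rightarrow> real"
  proof -
    have "bounded (f ` K)" using compact_imp_bounded[OF compact_continuous_image[OF that K]] .
    then show ?thesis unfolding bounded_iff by auto
  qed
  have out: "cross_cut k x = 0" "cross_cut_dx k i x = 0" if "x \<notin> K" for x i
  proof -
    \<comment> \<open>At time 2.5 the bump with \<delta> = 1 equals 1, so the vanishing of the
      products passes to their spatial factors.\<close>
    have "(2.5, x) \<notin> test_box 1 k" using that by (simp add: test_box_def cbox_Pair_eq K_def)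
    moreover have "time_bump 1 2.5 = 1" by (simp add: time_bump_def smooth_step_eq_1)
    ultimately show "cross_cut k x = 0" "cross_cut_dx k i x = 0"
      using outside_test_box(1)[of 1 "2.5" x k] outside_test_box(2)[of 1 "2.5" x k i] by auto
  qed
  obtain B0 where B0: "\<forall>x\<in>K. \<bar>cross_cut k x\<bar> \<le> B0" using bd[OF cont(1)] by blast
  obtain B1 where B1: "\<And>i. \<forall>x\<in>K. \<bar>cross_cut_dx k i x\<bar> \<le> B1 i" using bd[OF cont(2)] by metis
  define B where "B = 1 + \<bar>B0\<bar> + (\<Sum>i\<in>UNIV. \<bar>B1 i\<bar>)"
  have s: "0 \<le> (\<Sum>i\<in>UNIV. \<bar>B1 i\<bar>)" "\<bar>B1 i\<bar> \<le> (\<Sum>i\<in>UNIV. \<bar>B1 i\<bar>)" for i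
    by (auto intro: sum_nonneg member_le_sum)
  show ?thesis
  proof
    show "1 \<le> B" using s(1) unfolding B_def by linarith
    show "\<bar>cross_cut k x\<bar> \<le> B" for x
    proof (cases "x \<in> K")
      case True
      then have "\<bar>cross_cut k x\<bar> \<le> B0" using B0 by blast
      then show ?thesis using s(1) unfolding B_def by linarith
    next
      case False
      then show ?thesis using out(1) s(1) unfolding B_def by simp
    qed
    show "\<bar>cross_cut_dx k i x\<bar> \<le> B" for i x
    proof (cases "x \<in> K")
      case True
      then have "\<bar>cross_cut_dx k i x\<bar> \<le> B1 i" using B1 by blast
      then show ?thesis using s(2)[of i] unfolding B_def by linarith
    next
      case False
      then show ?thesis using out(2) s(1) unfolding B_def by simp
    qed
  qed
qed

section \<open>Upper and lower bounds for the pairing with the test functions\<close>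

lemma measure_lebesgue_on_cbox:
  assumes "cbox a b \<subseteq> S" "S \<in> sets lebesgue"
  shows "integrable (lebesgue_on S) (indicator (cbox a b) :: 'a::euclidean_space \<Rightarrow> real)"
    and "(LINT z|lebesgue_on S. indicator (cbox a b) z) = measure lborel (cbox a b)"
proof -
  have eq: "(\<lambda>z. indicator S z *\<^sub>R (indicator (cbox a b) z :: real)) = indicator (cbox a b)"
    using assms(1) by (auto simp: indicator_def fun_eq_iff)
  show "integrable (lebesgue_on S) (indicator (cbox a b) :: 'a::euclidean_space \<Rightarrow> real)"
    using integrable_restrict_space[of S lebesgue "indicator (cbox a b) :: 'a \<Rightarrow> real"] assms(2) eq
    by (simp add: lmeasurable_iff_integrable[symmetric])
  show "(LINT z|lebesgue_on S. indicator (cbox a b) z) = measure lborel (cbox a b)"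
    using integral_restrict_space[of S lebesgue "indicator (cbox a b) :: 'a \<Rightarrow> real"] assms(2) eq
    by simp
qed

text \<open>If f fails to be integrable, its integral is 0 by convention and the bound holds because
  g is nonnegative.\<close>

lemma abs_integral_le:
  fixes f g :: "'a \<Rightarrow> real"
  assumes g: "integrable M g" and le: "\<And>z. z \<in> space M \<Longrightarrow> \<bar>f z\<bar> \<le> g z"
  shows "\<bar>integral\<^sup>L M f\<bar> \<le> integral\<^sup>L M g"
proof (cases "integrable M f")
  case True
  have "\<bar>integral\<^sup>L M f\<bar> \<le> integral\<^sup>L M (\<lambda>z. \<bar>f z\<bar>)" by (rule integral_abs_bound)
  also have "\<dots> \<le> integral\<^sup>L M g" using True g le by (intro integral_mono) auto
  finally show ?thesis .
next
  case False
  have "0 \<le> integral\<^sup>L M g"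
    using le by (intro integral_nonneg_AE AE_I2) (metis abs_ge_zero order_trans)
  then show ?thesis using False by (simp add: not_integrable_integral_eq)
qed

text \<open>The integrand is at most M (|G| + |F|) on a box of measure 3 \<delta> V and 0 elsewhere.
  By \<open>le_scaled_powr\<close> this splits into the L_p integrals with weight s^(p - 1) and the
  measure of the box divided by s. The constants are fixed before \<delta> and s, which are coupled
  only later.\<close>

lemma divergence_upper_bound:
  fixes G :: "'d::finite spacetime \<Rightarrow> real ^ 'd" and F :: "'d spacetime \<Rightarrow> real"
  assumes p: "1 \<le> p" and G: "G \<in> Lp p (cyl T UNIV)" and F: "F \<in> Lp p (cyl T UNIV)"
  obtains A N where "0 < A" "0 \<le> N"
    "\<And>\<delta> s. 0 < \<delta> \<Longrightarrow> ereal (4 * \<delta>) < T \<Longrightarrow> 0 < s \<Longrightarrow>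
      \<bar>LINT z|lebesgue_on (cyl T UNIV). - (\<Sum>i\<in>UNIV. G z $ i * dx i (test_fun \<delta> k) z) + F z * test_fun \<delta> k z\<bar>
        \<le> N * s powr (p - 1) + A * (\<delta> / s)"
proof -
  let ?S = "cyl T (UNIV :: (real ^ 'd) set)"
  obtain B where B: "1 \<le> B" "\<And>x::real ^ 'd. \<bar>cross_cut k x\<bar> \<le> B" "\<And>i (x::real ^ 'd). \<bar>cross_cut_dx k i x\<bar> \<le> B"
    using cross_cut_bound by metis
  have "open ?S" by (rule open_cyl[OF open_UNIV])
  then have S: "?S \<in> sets lebesgue" by simp
  have iG: "integrable (lebesgue_on ?S) (\<lambda>z. norm (G z) powr p)" and iF: "integrable (lebesgue_on ?S) (\<lambda>z. norm (F z) powr p)"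
    using G F by (auto simp: Lp_def)
  define M where "M = real CARD('d) * B"
  have M: "B \<le> M" "0 < M"
    using B(1) by (auto simp: M_def Suc_leI intro!: mult_pos_pos)
  define N where "N = M * ((LINT z|lebesgue_on ?S. norm (G z) powr p) + (LINT z|lebesgue_on ?S. norm (F z) powr p))"
  define V where "V = measure lborel (cbox (\<chi> j. if j = k then - 3 else - 2) (\<chi> j. if j = k then 5 else 2) :: (real ^ 'd) set)"
  have V: "0 < V" unfolding V_def
    by (subst content_pos_lt_eq) (auto simp: Basis_vec_def inner_axis)
  have N: "0 \<le> N" using M unfolding N_def by (intro mult_nonneg_nonneg add_nonneg_nonneg integral_nonneg) auto
  \<comment> \<open>6 = 2 * 3: the term 1 / s arises for G and for F, and the box has duration 3
    \<delta>.\<close>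
  have main: "\<bar>LINT z|lebesgue_on ?S. - (\<Sum>i\<in>UNIV. G z $ i * dx i (test_fun \<delta> k) z) + F z * test_fun \<delta> k z\<bar>
        \<le> N * s powr (p - 1) + 6 * M * V * (\<delta> / s)" if \<delta>: "0 < \<delta>" "ereal (4 * \<delta>) < T" and s: "0 < s" for \<delta> s
  proof -
    let ?Q = "indicator (test_box \<delta> k) :: 'd spacetime \<Rightarrow> real"
    let ?g = "\<lambda>z. (M * s powr (p - 1)) * (norm (G z) powr p + norm (F z) powr p) + (2 * M / s) * ?Q z"
    have iQ: "integrable (lebesgue_on ?S) ?Q" and LQ: "(LINT z|lebesgue_on ?S. ?Q z) = 3 * \<delta> * V"
    proof -
      note sub = test_fun_C0_inf(2)[OF \<delta>, of k]
      show "integrable (lebesgue_on ?S) ?Q"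
        using measure_lebesgue_on_cbox(1)[OF _ S] sub unfolding test_box_def by blast
      have "(LINT z|lebesgue_on ?S. ?Q z) = measure lborel (test_box \<delta> k)"
        using measure_lebesgue_on_cbox(2)[OF _ S] sub unfolding test_box_def by blast
      also have "\<dots> = 3 * \<delta> * V"
        using \<delta> unfolding test_box_def content_Pair V_def by simp
      finally show "(LINT z|lebesgue_on ?S. ?Q z) = 3 * \<delta> * V" .
    qed
    have "\<bar>- (\<Sum>i\<in>UNIV. G z $ i * dx i (test_fun \<delta> k) z) + F z * test_fun \<delta> k z\<bar> \<le> ?g z" if z: "z \<in> ?S" for z
    proof (cases "z \<in> test_box \<delta> k")
      case False
      then have "dx i (test_fun \<delta> k) z = 0" "test_fun \<delta> k z = 0" for i
        using outside_test_box[OF \<delta>(1), of "fst z" "snd z" k] dx_test_fun[OF \<delta> z] by (simp_all add: test_fun_def)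
      then show ?thesis using M s False by simp
    next
      case True
      have tb: "\<bar>time_bump \<delta> t * y\<bar> \<le> B" if "\<bar>y\<bar> \<le> B" for t y
      proof -
        have "\<bar>time_bump \<delta> t * y\<bar> \<le> 1 * B"
          unfolding abs_mult using that time_bump_nonneg[of \<delta> t] time_bump_le_1[of \<delta> t] by (intro mult_mono) auto
        then show ?thesis by simp
      qed
      have "\<bar>\<Sum>i\<in>UNIV. G z $ i * dx i (test_fun \<delta> k) z\<bar> \<le> (\<Sum>i\<in>(UNIV::'d set). norm (G z) * B)"
      proof (rule order_trans[OF sum_abs sum_mono])
        fix i
        show "\<bar>G z $ i * dx i (test_fun \<delta> k) z\<bar> \<le> norm (G z) * B"
          unfolding dx_test_fun[OF \<delta> z] abs_mult[of "G z $ i"]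
          by (rule mult_mono[OF component_le_norm_cart tb[OF B(3)]]) simp_all
      qed
      also have "\<dots> = M * norm (G z)" by (simp add: M_def mult_ac)
      finally have 1: "\<bar>\<Sum>i\<in>UNIV. G z $ i * dx i (test_fun \<delta> k) z\<bar> \<le> M * norm (G z)" .
      have "\<bar>F z * test_fun \<delta> k z\<bar> \<le> \<bar>F z\<bar> * M"
        unfolding abs_mult[of "F z"] test_fun_def by (rule mult_left_mono[OF order_trans[OF tb[OF B(2)] M(1)]]) simp
      then have 2: "\<bar>F z * test_fun \<delta> k z\<bar> \<le> M * norm (F z)" by (simp add: mult.commute)
      have "\<bar>- (\<Sum>i\<in>UNIV. G z $ i * dx i (test_fun \<delta> k) z) + F z * test_fun \<delta> k z\<bar> \<le> M * norm (G z) + M * norm (F z)"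
        using 1 2 by linarith
      also have "\<dots> \<le> M * (s powr (p - 1) * norm (G z) powr p + 1 / s) + M * (s powr (p - 1) * norm (F z) powr p + 1 / s)"
        using M by (intro add_mono mult_left_mono le_scaled_powr[OF p norm_ge_zero s]) auto
      also have "\<dots> = ?g z" using True by (simp add: algebra_simps)
      finally show ?thesis .
    qed
    then have "\<bar>LINT z|lebesgue_on ?S. - (\<Sum>i\<in>UNIV. G z $ i * dx i (test_fun \<delta> k) z) + F z * test_fun \<delta> k z\<bar> \<le> (LINT z|lebesgue_on ?S. ?g z)"
      using iG iF iQ by (intro abs_integral_le) auto
    also have "\<dots> = (LINT z|lebesgue_on ?S. (M * s powr (p - 1)) * (norm (G z) powr p + norm (F z) powr p)) + (LINT z|lebesgue_on ?S. (2 * M / s) * ?Q z)"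
      using iG iF iQ by (intro Bochner_Integration.integral_add integrable_mult_right Bochner_Integration.integrable_add)
    also have "\<dots> = N * s powr (p - 1) + 6 * M * V * (\<delta> / s)"
      unfolding integral_mult_right_zero LQ Bochner_Integration.integral_add[OF iG iF] by (simp add: N_def algebra_simps)
    finally show ?thesis .
  qed
  show ?thesis
    by (rule that[of "6 * M * V" N]) (use M V N main in auto)
qed

text \<open>Integration by parts on the whole space turns the pairing into the integral of the flux
  against the k-derivative of the test function. Only the strip at negative x_k contributes, and the
  integrand has the sign of \<beta> throughout, so nothing cancels.\<close>

lemma flux_lower_bound:
  fixes k :: "'d::finite"
  assumes \<beta>: "\<beta> \<noteq> 0" "\<beta> \<le> 1"
  obtains A where "0 < A"
    "\<And>\<delta>. 0 < \<delta> \<Longrightarrow> \<delta> < 1 / 8 \<Longrightarrow> ereal (4 * \<delta>) < T \<Longrightarrow>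
      A * ((3 * \<delta>) powr (\<beta> - 1) * \<delta>) \<le> \<bar>LINT z|lebesgue_on (cyl T UNIV). cex \<beta> k z * dt (test_fun \<delta> k) z\<bar>"
proof -
  let ?S = "cyl T (UNIV :: (real ^ 'd) set)"
  have S1: "open ?S" by (rule open_cyl[OF open_UNIV])
  then have "?S \<in> sets lebesgue" by simp
  note S = S1 this
  have "compact (step1 ` {1/4..3/4})"
    by (intro compact_continuous_image continuous_on_subset[OF step_continuous(2)]) auto
  then obtain m where m: "m \<in> step1 ` {1/4..3/4}" "\<forall>y\<in>step1 ` {1/4..3/4}. m \<le> y"
    using compact_attains_inf[of "step1 ` {1/4..3/4}"] by auto
  then have m0: "0 < m" using step1_pos by auto
  have mle: "m \<le> step1 y" if "1/4 \<le> y" "y \<le> 3/4" for y using m(2) that by auto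
  \<comment> \<open>In this range x_k + 3 lies in [1/4, 3/4], where the slope is at least m, and the
    other coordinates lie in [-1, 1], where \<open>zeta\<close> is 1.\<close>
  let ?a = "(\<chi> j. if j = k then - 11 / 4 else - 1) :: real ^ 'd" and ?b = "(\<chi> j. if j = k then - 9 / 4 else 1) :: real ^ 'd"
  define V where "V = measure lborel (cbox ?a ?b)"
  have V: "0 < V" unfolding V_def
    by (subst content_pos_lt_eq) (auto simp: Basis_vec_def inner_axis)
  have main: "\<bar>\<beta>\<bar> * m * V * ((3 * \<delta>) powr (\<beta> - 1) * \<delta>) \<le> \<bar>LINT z|lebesgue_on ?S. cex \<beta> k z * dt (test_fun \<delta> k) z\<bar>"
    if \<delta>: "0 < \<delta>" "\<delta> < 1 / 8" "ereal (4 * \<delta>) < T" for \<delta>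
  proof -
    let ?\<phi> = "test_fun \<delta> k"
    let ?h = "\<lambda>z. - (flux \<beta> k z * dx k ?\<phi> z)"
    let ?Q = "cbox (2 * \<delta>, ?a) (3 * \<delta>, ?b) :: 'd spacetime set"
    \<comment> \<open>\<beta> is negative for p < b; multiplication by its sign treats both cases
      together.\<close>
    have sgn_le: "sgn \<beta> * y \<le> \<bar>y\<bar>" for y by (simp add: sgn_if abs_ge_self abs_ge_minus_self)
    note \<phi> = test_fun_C0_inf(1)[OF \<delta>(1,3), of k]
    have "dt_eq_div T UNIV (cex \<beta> k) (\<lambda>z. axis k (flux \<beta> k z)) (\<lambda>_. 0)"
      using translate_combination(2)[OF open_UNIV order_refl, of T 1 \<beta> k 0] by (simp flip: zero_prod_def)
    then have "- (LINT z|lebesgue_on ?S. cex \<beta> k z * dt ?\<phi> z) =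
        (LINT z|lebesgue_on ?S. - (\<Sum>i\<in>UNIV. axis k (flux \<beta> k z) $ i * dx i ?\<phi> z) + 0 * ?\<phi> z)"
      unfolding dt_eq_div_def using \<phi> by blast
    also have "\<dots> = (LINT z|lebesgue_on ?S. ?h z)"
      by (simp add: axis_def if_distrib[of "\<lambda>x. x * _"] cong: if_cong)
    finally have L: "- (LINT z|lebesgue_on ?S. cex \<beta> k z * dt ?\<phi> z) = (LINT z|lebesgue_on ?S. ?h z)" .
    have ih: "integrable (lebesgue_on ?S) ?h"
    proof -
      obtain K where K: "compact K" "K \<subseteq> ?S"
        and D0: "\<And>z v. z \<in> ?S - K \<Longrightarrow> frechet_derivative ?\<phi> (at z) v = 0"
        and c: "\<And>v. continuous_on ?S (\<lambda>z. frechet_derivative ?\<phi> (at z) v)"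
        using C0_infE[OF \<phi> S(1)] by metis
      have "continuous_on ?S (flux \<beta> k)"
        by (rule continuous_on_subset[OF cex_continuous(4)]) (auto simp: cyl_def)
      then show ?thesis
        unfolding dx_def using D0
        by (intro integral_lebesgue_on_extend_0(1)[OF S(1) K] continuous_on_minus continuous_on_mult c) simp_all
    qed
    have sub: "?Q \<subseteq> ?S"
    proof
      fix z assume "z \<in> ?Q"
      then obtain t x where z: "z = (t, x)" "2 * \<delta> \<le> t" "t \<le> 3 * \<delta>" by (cases z) (auto simp: cbox_Pair_eq)
      have "ereal t \<le> ereal (4 * \<delta>)" using z(3) \<delta>(1) by simp
      then have "ereal t < T" using \<delta>(3) by (rule order_le_less_trans)
      then show "z \<in> ?S" using z \<delta> by (auto simp: cyl_def)
    qed
    have le: "\<bar>\<beta>\<bar> * m * (3 * \<delta>) powr (\<beta> - 1) * indicator ?Q z \<le> sgn \<beta> * ?h z" if z: "z \<in> ?S" for z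
    proof -
      obtain t x where tx: "z = (t, x)" by (cases z)
      have t: "0 < t" using z by (auto simp: cyl_def tx)
      have dx: "dx k ?\<phi> z = time_bump \<delta> t * cross_cut_dx k k x"
        using dx_test_fun[OF \<delta>(1,3) z, of k k] by (simp add: tx)
      \<comment> \<open>The second case is the strip that counts. Outside the time support and for
        -2 < x_k <= 4 the test function has no slope in the direction k; for x_k > 4 the flux is
        0.\<close>
      consider "t \<notin> {\<delta>..4 * \<delta>}" | "t \<in> {\<delta>..4 * \<delta>}" "x $ k \<le> - 2" | "t \<in> {\<delta>..4 * \<delta>}" "- 2 < x $ k" "x $ k \<le> 4"
        | "t \<in> {\<delta>..4 * \<delta>}" "4 < x $ k" by fastforce
      then show ?thesis
      proof cases
        case 1
        then have "(t, x) \<notin> test_box \<delta> k" by (auto simp: mem_test_box)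
        then have "dx k ?\<phi> z = 0" using outside_test_box(2)[OF \<delta>(1)] dx by simp
        moreover have "z \<notin> ?Q" using 1 \<delta> by (auto simp: tx cbox_Pair_eq)
        ultimately show ?thesis by simp
      next
        case 2
        have "x $ k * isq t \<le> 0" using 2 by (intro mult_nonpos_nonneg) auto
        then have s: "smooth_step (2 - x $ k * isq t) = 1" "step1 (2 - x $ k * isq t) = 0"
          by (auto intro!: smooth_step_eq_1 step_eq_0_le)
        \<comment> \<open>Here \<delta> < 1/8 enters: 4 \<delta> < 1/2, so \<open>tcut\<close> is
          still 1 on the time support of the test function.\<close>
        have tc: "tcut t = 1" "step1 (2 - 2 * t) = 0"
          using 2 \<delta> by (auto simp: tcut_def intro!: smooth_step_eq_1 step_eq_0_le)
        have "flux \<beta> k z = - (\<beta> * t powr (\<beta> - 1) * zeta k x)"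
          using powr_minus_1_eq_isq[OF t, of \<beta>] by (simp add: tx flux_def s tc mult.assoc)
        moreover have "cross_cut_dx k k x = step1 (x $ k + 3) * zeta k x"
          using 2 by (simp add: cross_cut_dx_def smooth_step_eq_1 step1_eq_0)
        ultimately have eq: "sgn \<beta> * ?h z = \<bar>\<beta>\<bar> * (t powr (\<beta> - 1) * (time_bump \<delta> t * (step1 (x $ k + 3) * (zeta k x)\<^sup>2)))"
          unfolding dx by (simp add: power2_eq_square abs_sgn mult_ac)
        show ?thesis
        proof (cases "z \<in> ?Q")
          case False
          then show ?thesis unfolding eq
            by (simp add: mult_nonneg_nonneg time_bump_nonneg step1_nonneg)
        next
          case True
          then have Q: "2 * \<delta> \<le> t" "t \<le> 3 * \<delta>" "\<And>j. (if j = k then - 11 / 4 else - 1) \<le> x $ j \<and> x $ j \<le> (if j = k then - 9 / 4 else 1)"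
            by (auto simp: tx cbox_Pair_eq mem_box_cart)
          have "time_bump \<delta> t = 1"
            using Q \<delta> by (simp add: time_bump_def smooth_step_eq_1 field_simps)
          moreover have "plateau (x $ j) = 1" if "j \<noteq> k" for j
            using Q(3)[of j] that by (simp add: plateau_def smooth_step_eq_1)
          then have "zeta k x = 1" unfolding zeta_def by (intro prod.neutral) auto
          moreover have "m \<le> step1 (x $ k + 3)" using Q(3)[of k] by (intro mle) auto
          \<comment> \<open>The exponent \<beta> - 1 is at most 0, so the power is smallest at the
            final time of the box.\<close>
          moreover have "(3 * \<delta>) powr (\<beta> - 1) \<le> t powr (\<beta> - 1)"
            using Q t \<beta>(2) by (intro powr_mono2') auto
          ultimately show ?thesis
            unfolding eq using True m0 by (simp add: mult.commute[of m] mult.assoc) (intro mult_left_mono mult_mono; simp)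
        qed
      next
        case 3
        then have "cross_cut_dx k k x = 0" by (simp add: cross_cut_dx_def step1_eq_0)
        moreover have "z \<notin> ?Q" using 3 by (auto simp: tx cbox_Pair_eq mem_box_cart dest: spec[of _ k])
        ultimately show ?thesis unfolding dx by simp
      next
        case 4
        have "t < 1" using 4 \<delta> by simp
        then have "4 * 1 \<le> x $ k * isq t" using 4 isq_ge_1[OF t] by (intro mult_mono) auto
        then have "(t, x) \<notin> region k" by (auto simp: region_def)
        then have "flux \<beta> k z = 0" unfolding tx by (rule outside_region(3)) (use t 4 in auto)
        moreover have "z \<notin> ?Q" using 4 by (auto simp: tx cbox_Pair_eq mem_box_cart dest: spec[of _ k])
        ultimately show ?thesis by simp
      qed
    qed
    have "\<bar>\<beta>\<bar> * m * V * ((3 * \<delta>) powr (\<beta> - 1) * \<delta>) = \<bar>\<beta>\<bar> * m * (3 * \<delta>) powr (\<beta> - 1) * measure lborel ?Q"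
      using \<delta> unfolding content_Pair V_def by simp
    also have "\<dots> = (LINT z|lebesgue_on ?S. \<bar>\<beta>\<bar> * m * (3 * \<delta>) powr (\<beta> - 1) * indicator ?Q z)"
      unfolding integral_mult_right_zero measure_lebesgue_on_cbox(2)[OF sub S(2)] ..
    also have "\<dots> \<le> (LINT z|lebesgue_on ?S. sgn \<beta> * ?h z)"
      using le by (intro integral_mono integrable_mult_right measure_lebesgue_on_cbox(1)[OF sub S(2)] ih) simp
    also have "\<dots> = sgn \<beta> * (LINT z|lebesgue_on ?S. ?h z)" by (rule integral_mult_right_zero)
    also have "\<dots> \<le> \<bar>LINT z|lebesgue_on ?S. ?h z\<bar>" by (rule sgn_le)
    also have "\<dots> = \<bar>LINT z|lebesgue_on ?S. cex \<beta> k z * dt ?\<phi> z\<bar>" unfolding L[symmetric] by simp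
    finally show ?thesis .
  qed
  show ?thesis
    by (rule that[of "\<bar>\<beta>\<bar> * m * V"]) (use assms m0 V main in auto)
qed

lemma cex_dt_not_divergence:
  fixes k :: "'d::finite" and F :: "'d spacetime \<Rightarrow> real"
  assumes T: "0 < T" and p: "1 \<le> p" and b: "1 < b" "b \<noteq> p"
    and G: "G \<in> Lp p (cyl T UNIV)" and F: "F \<in> Lp p (cyl T UNIV)"
  shows "\<not> dt_eq_div T UNIV (cex (1 - b / p) k) G F"
proof
  assume eq: "dt_eq_div T UNIV (cex (1 - b / p) k) G F"
  let ?\<beta> = "1 - b / p"
  have \<beta>: "?\<beta> \<noteq> 0" "?\<beta> \<le> 1" using p b by auto
  obtain A where A: "0 < A" "\<And>\<delta>. 0 < \<delta> \<Longrightarrow> \<delta> < 1 / 8 \<Longrightarrow> ereal (4 * \<delta>) < T \<Longrightarrow>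
      A * ((3 * \<delta>) powr (?\<beta> - 1) * \<delta>) \<le> \<bar>LINT z|lebesgue_on (cyl T UNIV). cex ?\<beta> k z * dt (test_fun \<delta> k) z\<bar>"
    by (rule flux_lower_bound[OF \<beta>, where T=T and k=k]) (rule that)
  obtain A' N where A': "0 < A'" "0 \<le> N"
    "\<And>\<delta> s. 0 < \<delta> \<Longrightarrow> ereal (4 * \<delta>) < T \<Longrightarrow> 0 < s \<Longrightarrow>
      \<bar>LINT z|lebesgue_on (cyl T UNIV). - (\<Sum>i\<in>UNIV. G z $ i * dx i (test_fun \<delta> k) z) + F z * test_fun \<delta> k z\<bar>
        \<le> N * s powr (p - 1) + A' * (\<delta> / s)"
    by (rule divergence_upper_bound[OF p G F, where k=k]) (rule that)
  define c where "c = A * 3 powr (?\<beta> - 1)"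
  \<comment> \<open>With this K the term A' \<delta> / s is exactly half of the lower bound c
    \<delta>^\<beta>, which absorbs it.\<close>
  define K where "K = 2 * A' / c"
  have c: "0 < c" and K: "0 < K" using A(1) A'(1) by (auto simp: c_def K_def)
  have key: "c / 2 \<le> N * K powr (p - 1) * \<delta> powr (b - 1)" if \<delta>: "0 < \<delta>" "\<delta> < 1 / 8" "ereal (4 * \<delta>) < T" for \<delta>
  proof -
    define s where "s = K * \<delta> powr (b / p)"
    have s: "0 < s" using K \<delta> by (simp add: s_def)
    have "\<delta> powr (- (b / p)) * \<delta> powr 1 = \<delta> powr (- (b / p) + 1)" by (rule powr_add[symmetric])
    then have pw: "\<delta> powr (?\<beta> - 1) * \<delta> = \<delta> powr ?\<beta>" using \<delta> by simp
    have "c * \<delta> powr ?\<beta> = A * ((3 * \<delta>) powr (?\<beta> - 1) * \<delta>)"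
      using \<delta> unfolding pw[symmetric] by (simp add: c_def powr_mult)
    also have "\<dots> \<le> \<bar>LINT z|lebesgue_on (cyl T UNIV). cex ?\<beta> k z * dt (test_fun \<delta> k) z\<bar>"
      using A(2)[OF \<delta>] .
    also have "\<dots> = \<bar>- (LINT z|lebesgue_on (cyl T UNIV). cex ?\<beta> k z * dt (test_fun \<delta> k) z)\<bar>" by simp
    also have "\<dots> = \<bar>LINT z|lebesgue_on (cyl T UNIV). - (\<Sum>i\<in>UNIV. G z $ i * dx i (test_fun \<delta> k) z) + F z * test_fun \<delta> k z\<bar>"
      by (rule arg_cong[of _ _ abs], rule eq[unfolded dt_eq_div_def, rule_format, OF test_fun_C0_inf(1)[OF \<delta>(1,3)]])
    also have "\<dots> \<le> N * s powr (p - 1) + A' * (\<delta> / s)" using A'(3)[OF \<delta>(1,3) s] .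
    also have "A' * (\<delta> / s) = c / 2 * \<delta> powr ?\<beta>"
    proof -
      have "\<delta> / \<delta> powr (b / p) = \<delta> powr ?\<beta>" using \<delta> by (simp add: powr_diff)
      then show ?thesis using c A'(1) \<delta> by (simp add: s_def K_def field_simps)
    qed
    also have "s powr (p - 1) = K powr (p - 1) * \<delta> powr (b / p * (p - 1))"
      using K \<delta> by (simp add: s_def powr_mult powr_powr)
    \<comment> \<open>Relative to the lower bound the remaining term carries the factor \<delta>^(b
      - 1), which tends to 0 because b > 1.\<close>
    also have "b / p * (p - 1) = ?\<beta> + (b - 1)" using p by (simp add: field_simps)
    also have "\<delta> powr (?\<beta> + (b - 1)) = \<delta> powr ?\<beta> * \<delta> powr (b - 1)" by (rule powr_add)
    finally have "\<delta> powr ?\<beta> * (c / 2) \<le> \<delta> powr ?\<beta> * (N * K powr (p - 1) * \<delta> powr (b - 1))"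
      by (simp add: algebra_simps)
    then show ?thesis using \<delta> by (simp add: mult_le_cancel_left_pos)
  qed
  \<comment> \<open>A positive real number not above T; \<delta> < r / 4 then ensures 4 \<delta> < T
    also when T is infinite.\<close>
  obtain r where r: "0 < r" "ereal r \<le> T"
  proof (cases "1 \<le> T")
    case True
    then show ?thesis using that[of 1] by (simp add: one_ereal_def)
  next
    case False
    then obtain r where "T = ereal r" using T by (cases T) auto
    then show ?thesis using that[of r] T by simp
  qed
  have "((\<lambda>\<delta>. N * K powr (p - 1) * \<delta> powr (b - 1)) \<longlongrightarrow> N * K powr (p - 1) * 0) (at_right 0)"
    using b by (intro tendsto_mult tendsto_const tendsto_zero_powrI[of _ _ _ "b - 1"] tendsto_ident_at)
      (auto simp: eventually_at_right_less intro: eventually_mono[OF eventually_at_right_less])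
  then have "\<forall>\<^sub>F \<delta> in at_right 0. N * K powr (p - 1) * \<delta> powr (b - 1) < c / 2"
    by (rule order_tendstoD(2)) (use c in simp)
  moreover have "\<forall>\<^sub>F \<delta> in at_right 0. \<delta> \<in> {0<..<min (1 / 8) (r / 4)}"
    by (rule eventually_at_right_real) (use r in simp)
  ultimately have "\<forall>\<^sub>F \<delta> in at_right (0::real). False"
  proof eventually_elim
    case (elim \<delta>)
    then have "ereal (4 * \<delta>) < ereal r" by simp
    then have "ereal (4 * \<delta>) < T" using r(2) by (rule order_less_le_trans)
    then show ?case using key[of \<delta>] elim by simp
  qed
  then show False by simp
qed

theorem theorem1p1:
  fixes T :: ereal and p :: real and k :: "'d::finite"
  assumes "0 < T" and "1 \<le> p"
  shows "\<exists>u \<in> H1_ring p T (half_space k).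
           zero_ext (half_space k) u \<notin> H1 p T (UNIV :: (real ^ 'd) set) \<and>
           zero_ext (half_space k) u \<in> W10 p T UNIV \<and>
           \<not> (\<exists>G \<in> Lp p (cyl T UNIV). \<exists>F \<in> Lp p (cyl T UNIV).
                 dt_eq_div T UNIV (zero_ext (half_space k) u) G F)"
proof -
  \<comment> \<open>The range 1 < b <= 5/4 suits every p. The value 9/8 avoids b = p, where \<beta>
    = 0 and the trace of the flux vanishes for small t.\<close>
  obtain b where b: "1 < b" "b \<le> 5 / 4" "b \<noteq> p"
  proof (cases "p = 5 / 4")
    case True
    then show ?thesis using that[of "9 / 8"] by simp
  next
    case False
    then show ?thesis using that[of "5 / 4"] by simp
  qed
  have no: "\<not> (\<exists>G \<in> Lp p (cyl T UNIV). \<exists>F \<in> Lp p (cyl T UNIV). dt_eq_div T UNIV (cex (1 - b / p) k) G F)"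
    using cex_dt_not_divergence[OF assms b(1,3)] by blast
  then have "cex (1 - b / p) k \<notin> H1 p T UNIV"
    by (simp add: H1_def dt_in_Hm1_def)
  with no show ?thesis
    using cex_in_H1_ring[OF assms b(1,2), of k] cex_in_W10[OF assms(2) b(1,2), of k T]
    by (intro bexI[of _ "cex (1 - b / p) k"]) (simp_all add: zero_ext_cex)
qed

end
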